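(* Let $\circledast\in\{*,\boxplus\}$, let $n\ge1$, let $p_1,\dots,p_n\in[0,1]$, and let $\mu_k=(1-p_k)\delta_0+p_k\delta_1$ for $k=1,\dots,n$. Let $q:=\frac1n\sum_{j=1}^n p_j$ and let $\nu_B^{q,n}:=\rho_q^{\circledast n}$ be the $n$-fold $\circledast$-convolution of $\rho_q:=(1-q)\delta_0+q\delta_1$ with itself (the $\circledast$-binomial distribution with success probability $q$ and sample size $n$). Then $$d_{W^1}\left(\mu_1\circledast\cdots\circledast\mu_n,\ \nu_B^{q,n}\right)\le\sum_{k=1}^n|p_k-q|.$$
   Context: **Non-commutative probability spaces.** A ($C^*$-)probability space is a pair $(\mathcal{A},\tau)$ with $\mathcal{A}$ a unital $C^*$-algebra and $\tau:\mathcal{A}\to\mathbb{C}$ a positive unital linear functional; it is tracial if $\tau(xy)=\tau(yx)$ for all $x,y$. For self-adjoint $a\in\mathcal{A}$, its (analytic) distribution is the unique compactly supported probability measure $\mu_a$ on $\mathbb{R}$ with $\int Q\,d\mu_a=\tau[Q(a)]$ for all polynomials $Q$. **Independence.** Unital subalgebras $\mathcal{A}_1,\dots,\mathcal{A}_r$ are tensor independent if they commute pairwise and $\tau[a_1\cdots a_r]=\prod_k\tau[a_k]$ for $a_k\in\mathcal{A}_k$. Unital subalgebras are freely independent if $\tau[a_1\cdots a_m]=0$ whenever $a_j\in\mathcal{A}_{i(j)}$, $\tau[a_j]=0$ for all $j$, and $i(j)\ne i(j+1)$ for $1\le j\le m-1$. **Convolutions.** For compactly supported probability measures $\mu,\nu$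 on $\mathbb{R}$, the measure $\mu*\nu$ (resp. $\mu\boxplus\nu$) is the distribution of $a+b$, where $a,b$ are self-adjoint elements of some $C^*$-probability space with distributions $\mu,\nu$, whose generated unital algebras are tensor (resp. freely) independent. In particular $*$ is the classical convolution. **Distance.** For compactly supported probability measures $\gamma_1,\gamma_2$ on $\mathbb{R}$, the non-commutative Wasserstein distance is $d_{W^1}(\gamma_1,\gamma_2)=\inf\tau(|b-a|)$, the infimum being over all tracial $C^*$-probability spaces $(\mathcal{A},\tau)$ and all self-adjoint $a,b\in\mathcal{A}$ with distributions $\mu_a=\gamma_1$, $\mu_b=\gamma_2$ (here $|b-a|$ is defined by continuous functional calculus). *)

theory Defs
  imports
    "HOL-Probability.Probability"
    "HOL-Library.Equipollence"
    "HOL-Library.Nonpos_Ints"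
    "HOL-Algebra.Module"
    "HOL-Algebra.Subrings"
begin

section \<open>\<open>C\<^sup>*\<close>-algebras and noncommutative probability spaces\<close>

text \<open>
  Statements about all \<open>C\<^sup>*\<close>-algebras are needed inside an infimum, so \<open>C\<^sup>*\<close>-algebras are records with
  an explicit carrier in some type \<open>'a\<close>, the universe.
\<close>

record 'a cstar_alg = "(complex, 'a) module" +
  star :: "'a \<Rightarrow> 'a"
  cnorm :: "'a \<Rightarrow> real"

locale unital_cstar_algebra = ring A for A :: "('a, 'b) cstar_alg_scheme" (structure) +
  assumes smult_closed: "x \<in> carrier A \<Longrightarrow> c \<odot> x \<in> carrier A"
    and smult_add_left: "x \<in> carrier A \<Longrightarrow> (c + d) \<odot> x = (c \<odot> x) \<oplus> (d \<odot> x)"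
    and smult_add_right:
      "\<lbrakk>x \<in> carrier A; y \<in> carrier A\<rbrakk> \<Longrightarrow> c \<odot> (x \<oplus> y) = (c \<odot> x) \<oplus> (c \<odot> y)"
    and smult_smult: "x \<in> carrier A \<Longrightarrow> (c * d) \<odot> x = c \<odot> (d \<odot> x)"
    and smult_one: "x \<in> carrier A \<Longrightarrow> 1 \<odot> x = x"
    and smult_mult_left:
      "\<lbrakk>x \<in> carrier A; y \<in> carrier A\<rbrakk> \<Longrightarrow> (c \<odot> x) \<otimes> y = c \<odot> (x \<otimes> y)"
    and smult_mult_right:
      "\<lbrakk>x \<in> carrier A; y \<in> carrier A\<rbrakk> \<Longrightarrow> x \<otimes> (c \<odot> y) = c \<odot> (x \<otimes> y)"
    and star_closed: "x \<in> carrier A \<Longrightarrow> star A x \<in> carrier A"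
    and star_star: "x \<in> carrier A \<Longrightarrow> star A (star A x) = x"
    and star_add:
      "\<lbrakk>x \<in> carrier A; y \<in> carrier A\<rbrakk> \<Longrightarrow> star A (x \<oplus> y) = star A x \<oplus> star A y"
    and star_smult: "x \<in> carrier A \<Longrightarrow> star A (c \<odot> x) = cnj c \<odot> star A x"
    and star_mult:
      "\<lbrakk>x \<in> carrier A; y \<in> carrier A\<rbrakk> \<Longrightarrow> star A (x \<otimes> y) = star A y \<otimes> star A x"
    and cnorm_nonneg: "x \<in> carrier A \<Longrightarrow> 0 \<le> cnorm A x"
    and cnorm_eq_0_iff: "x \<in> carrier A \<Longrightarrow> cnorm A x = 0 \<longleftrightarrow> x = \<zero>"
    and cnorm_triangle:
      "\<lbrakk>x \<in> carrier A; y \<in> carrier A\<rbrakk> \<Longrightarrow> cnorm A (x \<oplus> y) \<le> cnorm A x + cnorm A y"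
    and cnorm_smult: "x \<in> carrier A \<Longrightarrow> cnorm A (c \<odot> x) = cmod c * cnorm A x"
    and cnorm_mult:
      "\<lbrakk>x \<in> carrier A; y \<in> carrier A\<rbrakk> \<Longrightarrow> cnorm A (x \<otimes> y) \<le> cnorm A x * cnorm A y"
    and cnorm_cstar: "x \<in> carrier A \<Longrightarrow> cnorm A (star A x \<otimes> x) = (cnorm A x)\<^sup>2"
    and cnorm_complete:
      "\<lbrakk>\<And>n. X n \<in> carrier A;
        \<And>e. e > 0 \<Longrightarrow> \<exists>N. \<forall>m\<ge>N. \<forall>n\<ge>N. cnorm A (X m \<ominus> X n) < e\<rbrakk>
       \<Longrightarrow> \<exists>x\<in>carrier A. (\<lambda>n. cnorm A (X n \<ominus> x)) \<longlonglongrightarrow> 0"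

locale nc_prob_space = unital_cstar_algebra A
  for A :: "('a, 'b) cstar_alg_scheme" (structure) and \<tau> :: "'a \<Rightarrow> complex" +
  assumes tau_add: "\<lbrakk>x \<in> carrier A; y \<in> carrier A\<rbrakk> \<Longrightarrow> \<tau> (x \<oplus> y) = \<tau> x + \<tau> y"
    and tau_smult: "x \<in> carrier A \<Longrightarrow> \<tau> (c \<odot> x) = c * \<tau> x"
    and tau_positive: "x \<in> carrier A \<Longrightarrow> \<tau> (star A x \<otimes> x) \<in> \<real>\<^sub>\<ge>\<^sub>0"
    and tau_one: "\<tau> \<one> = 1"

locale tracial_nc_prob_space = nc_prob_space +
  assumes tau_commute: "\<lbrakk>x \<in> carrier A; y \<in> carrier A\<rbrakk> \<Longrightarrow> \<tau> (x \<otimes> y) = \<tau> (y \<otimes> x)"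

definition self_adjoint :: "('a, 'b) cstar_alg_scheme \<Rightarrow> 'a \<Rightarrow> bool" where
  "self_adjoint A a \<longleftrightarrow> a \<in> carrier A \<and> star A a = a"

definition poly_at :: "('a, 'b) cstar_alg_scheme \<Rightarrow> complex poly \<Rightarrow> 'a \<Rightarrow> 'a" where
  "poly_at A Q a = (\<Oplus>\<^bsub>A\<^esub>i\<in>{..Polynomial.degree Q}. Polynomial.coeff Q i \<odot>\<^bsub>A\<^esub> (a [^]\<^bsub>A\<^esub> i))"

definition spectrum :: "('a, 'b) cstar_alg_scheme \<Rightarrow> 'a \<Rightarrow> complex set" where
  "spectrum A a = {z. (z \<odot>\<^bsub>A\<^esub> \<one>\<^bsub>A\<^esub>) \<ominus>\<^bsub>A\<^esub> a \<notin> Units A}"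

text \<open>
  Continuous functional calculus of a self-adjoint \<open>a\<close>: \<open>f(a)\<close> is the norm limit of \<open>Q\<^sub>n(a)\<close> for
  polynomials \<open>Q\<^sub>n\<close> converging to \<open>f\<close> uniformly on the spectrum of \<open>a\<close>. The limit is unique because
  such polynomials exist (the spectrum is a compact set of reals).
\<close>

definition cont_fun_calc ::
    "('a, 'b) cstar_alg_scheme \<Rightarrow> (complex \<Rightarrow> complex) \<Rightarrow> 'a \<Rightarrow> 'a" where
  "cont_fun_calc A f a = (THE y. y \<in> carrier A \<and>
     (\<forall>Q. uniform_limit (spectrum A a) (\<lambda>n. poly (Q n)) f sequentially \<longrightarrow>
          (\<lambda>n. cnorm A (poly_at A (Q n) a \<ominus>\<^bsub>A\<^esub> y)) \<longlonglongrightarrow> 0))"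

definition cstar_abs :: "('a, 'b) cstar_alg_scheme \<Rightarrow> 'a \<Rightarrow> 'a" where
  "cstar_abs A a = cont_fun_calc A (\<lambda>z. complex_of_real (cmod z)) a"


section \<open>Distributions\<close>

definition compactly_supported_prob :: "real measure \<Rightarrow> bool" where
  "compactly_supported_prob \<mu> \<longleftrightarrow>
     prob_space \<mu> \<and> sets \<mu> = sets borel \<and> (\<exists>K. compact K \<and> emeasure \<mu> (- K) = 0)"

definition has_distribution ::
    "('a, 'b) cstar_alg_scheme \<Rightarrow> ('a \<Rightarrow> complex) \<Rightarrow> 'a \<Rightarrow> real measure \<Rightarrow> bool" where
  "has_distribution A \<tau> a \<mu> \<longleftrightarrow> self_adjoint A a \<and> compactly_supported_prob \<mu> \<and>
     (\<forall>Q :: complex poly. (LINT x|\<mu>. poly Q (complex_of_real x)) = \<tau> (poly_at A Q a))"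


section \<open>Independence\<close>

definition unital_subalgebra :: "('a, 'b) cstar_alg_scheme \<Rightarrow> 'a set \<Rightarrow> bool" where
  "unital_subalgebra A B \<longleftrightarrow> subring B A \<and> (\<forall>c. \<forall>x\<in>B. c \<odot>\<^bsub>A\<^esub> x \<in> B)"

definition generated_algebra :: "('a, 'b) cstar_alg_scheme \<Rightarrow> 'a \<Rightarrow> 'a set" where
  "generated_algebra A a = unital_subalgebra A hull {a}"

definition list_mult :: "('a, 'b) monoid_scheme \<Rightarrow> 'a list \<Rightarrow> 'a" where
  "list_mult A xs = foldr (\<lambda>x y. x \<otimes>\<^bsub>A\<^esub> y) xs \<one>\<^bsub>A\<^esub>"

type_synonym 'a independence = "'a cstar_alg \<Rightarrow> ('a \<Rightarrow> complex) \<Rightarrow> 'a set list \<Rightarrow> bool"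

definition tensor_independent :: "'a independence" where
  "tensor_independent A \<tau> Bs \<longleftrightarrow>
     (\<forall>B\<in>set Bs. unital_subalgebra A B) \<and>
     (\<forall>i<length Bs. \<forall>j<length Bs. i \<noteq> j \<longrightarrow>
        (\<forall>x\<in>Bs ! i. \<forall>y\<in>Bs ! j. x \<otimes>\<^bsub>A\<^esub> y = y \<otimes>\<^bsub>A\<^esub> x)) \<and>
     (\<forall>a. (\<forall>k<length Bs. a k \<in> Bs ! k) \<longrightarrow>
        \<tau> (list_mult A (map a [0..<length Bs])) = (\<Prod>k<length Bs. \<tau> (a k)))"

definition freely_independent :: "'a independence" where
  "freely_independent A \<tau> Bs \<longleftrightarrow>
     (\<forall>B\<in>set Bs. unital_subalgebra A B) \<and>
     (\<forall>m\<ge>1. \<forall>(i :: nat \<Rightarrow> nat) a.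
        (\<forall>j<m. i j < length Bs \<and> a j \<in> Bs ! i j \<and> \<tau> (a j) = 0) \<and>
        (\<forall>j. Suc j < m \<longrightarrow> i j \<noteq> i (Suc j)) \<longrightarrow>
        \<tau> (list_mult A (map a [0..<m])) = 0)"


section \<open>Convolutions\<close>

definition is_convolution ::
    "'u independence \<Rightarrow> real measure \<Rightarrow> real measure \<Rightarrow> real measure \<Rightarrow> bool" where
  "is_convolution indep \<mu> \<nu> \<eta> \<longleftrightarrow>
     (\<exists>A \<tau> a b. nc_prob_space A \<tau> \<and>
        has_distribution A \<tau> a \<mu> \<and> has_distribution A \<tau> b \<nu> \<and>
        indep A \<tau> [generated_algebra A a, generated_algebra A b] \<and>
        has_distribution A \<tau> (a \<oplus>\<^bsub>A\<^esub> b) \<eta>)"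

definition tensor_convolution ::
    "'u itself \<Rightarrow> real measure \<Rightarrow> real measure \<Rightarrow> real measure" where
  "tensor_convolution U \<mu> \<nu> = (THE \<eta>. is_convolution (tensor_independent :: 'u independence) \<mu> \<nu> \<eta>)"

definition free_convolution ::
    "'u itself \<Rightarrow> real measure \<Rightarrow> real measure \<Rightarrow> real measure" where
  "free_convolution U \<mu> \<nu> = (THE \<eta>. is_convolution (freely_independent :: 'u independence) \<mu> \<nu> \<eta>)"

text \<open>\<open>iterated_convolution conv \<mu> n\<close> is \<open>(\<dots>(\<mu> 1 \<circledast> \<mu> 2) \<circledast> \<dots>) \<circledast> \<mu> n\<close>, for \<open>n \<ge> 1\<close>.\<close>

definition iterated_convolution ::
    "(real measure \<Rightarrow> real measure \<Rightarrow> real measure) \<Rightarrow> (nat \<Rightarrow> real measure) \<Rightarrow> nat \<Rightarrow> real measure"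
  where "iterated_convolution conv \<mu> n = foldl conv (\<mu> 1) (map \<mu> [2..<Suc n])"

definition bernoulli_measure :: "real \<Rightarrow> real measure" where
  "bernoulli_measure p = distr (measure_pmf (bernoulli_pmf p)) borel of_bool"

lemma emeasure_bernoulli_measure:
  assumes "p \<in> {0..1}" and "S \<in> sets borel"
  shows "emeasure (bernoulli_measure p) S =
    ennreal (1 - p) * emeasure (return borel 0) S + ennreal p * emeasure (return borel 1) S"
proof -
  have "emeasure (bernoulli_measure p) S
      = emeasure (measure_pmf (bernoulli_pmf p)) (of_bool -` S)"
    using assms(2) unfolding bernoulli_measure_def by (subst emeasure_distr) auto
  also have "\<dots> = (\<integral>\<^sup>+b. indicator (of_bool -` S) b \<partial>measure_pmf (bernoulli_pmf p))"
    by simp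
  also have "\<dots> = ennreal (1 - p) * indicator S 0 + ennreal p * indicator S 1"
    using assms(1)
    by (simp add: indicator_def ac_simps)
  finally show ?thesis using assms(2) by simp
qed

definition binomial_convolution ::
    "(real measure \<Rightarrow> real measure \<Rightarrow> real measure) \<Rightarrow> real \<Rightarrow> nat \<Rightarrow> real measure" where
  "binomial_convolution conv q n = iterated_convolution conv (\<lambda>_. bernoulli_measure q) n"


section \<open>Noncommutative Wasserstein distance\<close>

text \<open>
  The infimum ranges over all tracial spaces whose carrier lies in the universe \<open>'u\<close>. Since \<open>\<tau>(|b - a|)\<close>
  only depends on the separable \<open>C\<^sup>*\<close>-subalgebra generated by \<open>1\<close>, \<open>a\<close>, \<open>b\<close>, every universe of at
  least continuum cardinality yields the same value; the same holds for the convolutions above.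
\<close>

definition nc_wasserstein :: "'u itself \<Rightarrow> real measure \<Rightarrow> real measure \<Rightarrow> ereal" where
  "nc_wasserstein U \<gamma>\<^sub>1 \<gamma>\<^sub>2 =
     Inf {ereal (Re (\<tau> (cstar_abs A (b \<ominus>\<^bsub>A\<^esub> a)))) | (A :: 'u cstar_alg) \<tau> a b.
       tracial_nc_prob_space A \<tau> \<and> has_distribution A \<tau> a \<gamma>\<^sub>1 \<and> has_distribution A \<tau> b \<gamma>\<^sub>2}"

end

theory Submission
  imports Defs "HOL-Computational_Algebra.Fundamental_Theorem_Algebra"
begin

text \<open>
  Couple the Bernoulli laws of parameters \<open>p\<^sub>k\<close> and \<open>q\<close> monotonically on a three-point space: they are the
  laws of projections \<open>a\<^sub>k\<close>, \<open>b\<^sub>k\<close> with \<open>b\<^sub>k - a\<^sub>k = \<plusminus>d\<^sub>k\<close> for a projection \<open>d\<^sub>k\<close> of trace \<open>\<bar>p\<^sub>k - q\<bar>\<close>.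
  In the tensor or free product of these \<open>n\<close> spaces, \<open>\<Sum> a\<^sub>k\<close> and \<open>\<Sum> b\<^sub>k\<close> have the two laws of the
  statement, and \<open>\<tau>(\<bar>\<Sum> \<plusminus>d\<^sub>k\<bar>) \<le> \<Sum> \<tau>(d\<^sub>k)\<close> since \<open>\<tau>\<close> is a trace.

  Both products are realized on a Hilbert space whose orthonormal basis is a countable set of words. The
  algebra consists of the bounded matrices that commute with the right action of the factors; the vacuum
  vector is cyclic for the right action, which makes the vacuum state a trace. A bounded matrix is
  determined by countably many real numbers, so the algebra embeds into every universe of at least
  continuum cardinality. The law of a sum of projections exists by the Hausdorff moment problem, and
  convolutions are unique because independence determines the moments of a sum.
\<close>

section \<open>Bounded infinite matrices\<close>

text \<open>The convolutions are given by \<open>THE\<close>, so nothing is known about them until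
  an independent pair has been exhibited inside the universe and its sum has been shown to have a
  compactly supported law. Concrete products are therefore unavoidable, and one product must carry
  both sums. As the convolution is iterated pairwise, independence is needed between the algebra of
  a partial sum and that of the next summand. The commutant of the right action is preferred to a
  closure of the left action: it is norm closed and contains every inverse that exists among all
  bounded matrices, so completeness, spectrum and functional calculus are those of the full matrix
  algebra. The price is that traciality has to be proved for elements of which only commutation
  relations are known; it follows because these relations identify the vacuum row of a matrix with
  its vacuum column, up to a reversal of words. Two nested events cut a probability space into three
  atoms, hence the three points. All atoms need positive mass, because cyclicity comes from
  multiplication by functions with the vacuum vector in the denominator.\<close>

definition l2 :: "('i \<Rightarrow> complex) \<Rightarrow> bool" where
  "l2 v \<longleftrightarrow> (\<lambda>i. (cmod (v i))\<^sup>2) summable_on UNIV"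

definition l2norm :: "('i \<Rightarrow> complex) \<Rightarrow> real" where
  "l2norm v = sqrt (\<Sum>\<^sub>\<infinity>i. (cmod (v i))\<^sup>2)"

lemma l2norm_nonneg [simp]: "0 \<le> l2norm v"
  unfolding l2norm_def by (simp add: infsum_nonneg)

lemma l2norm_squared: "(l2norm v)\<^sup>2 = (\<Sum>\<^sub>\<infinity>i. (cmod (v i))\<^sup>2)"
  unfolding l2norm_def by (simp add: infsum_nonneg)

lemma L2_set_le_l2norm:
  assumes "l2 v" and "finite F"
  shows "L2_set (\<lambda>i. cmod (v i)) F \<le> l2norm v"
  unfolding L2_set_def l2norm_def real_sqrt_le_iff
  using assms by (intro finite_sum_le_infsum) (auto simp: l2_def)

lemma l2_boundedI:
  assumes "\<And>F. finite F \<Longrightarrow> L2_set (\<lambda>i. cmod (v i)) F \<le> B"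
  shows "l2 v" and "l2norm v \<le> B"
proof -
  have B: "0 \<le> B" using assms[of "{}"] by simp
  have *: "(\<Sum>i\<in>F. (cmod (v i))\<^sup>2) \<le> B\<^sup>2" if "finite F" for F
    using assms[OF that] B unfolding L2_set_def by (metis real_sqrt_le_iff real_sqrt_unique)
  show l: "l2 v" unfolding l2_def
    by (rule nonneg_bounded_partial_sums_imp_summable_on[of _ _ "B\<^sup>2"])
      (auto intro!: * simp: eventually_finite_subsets_at_top)
  have "(\<Sum>\<^sub>\<infinity>i. (cmod (v i))\<^sup>2) \<le> B\<^sup>2"
    using l * unfolding l2_def by (intro infsum_le_finite_sums) auto
  thus "l2norm v \<le> B" unfolding l2norm_def using B real_le_lsqrt by blast
qed

lemma l2_restrict:
  assumes "l2 v"
  shows "l2 (\<lambda>i. if i \<in> L then v i else 0)"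
  using assms unfolding l2_def by (rule summable_on_comparison_test) auto

lemma l2_tail:
  assumes "l2 v" and "e > 0"
  obtains L where "finite L" and "l2norm (\<lambda>i. if i \<in> L then 0 else v i) \<le> e"
proof -
  have s: "(\<lambda>i. (cmod (v i))\<^sup>2) summable_on UNIV" using assms by (simp add: l2_def)
  obtain L where L: "finite L" and d: "dist (\<Sum>i\<in>L. (cmod (v i))\<^sup>2) (\<Sum>\<^sub>\<infinity>i. (cmod (v i))\<^sup>2) \<le> e\<^sup>2"
    using infsum_finite_approximation[OF s, of "e\<^sup>2"] assms(2) by auto
  have "(\<Sum>\<^sub>\<infinity>i. (cmod (if i \<in> L then 0 else v i))\<^sup>2) = (\<Sum>\<^sub>\<infinity>i\<in>UNIV - L. (cmod (v i))\<^sup>2)"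
    by (rule infsum_cong_neutral) auto
  also have "\<dots> = (\<Sum>\<^sub>\<infinity>i. (cmod (v i))\<^sup>2) - (\<Sum>i\<in>L. (cmod (v i))\<^sup>2)"
    using L s by (subst infsum_Diff) auto
  also have "\<dots> \<le> e\<^sup>2" using d by (simp add: dist_real_def abs_le_iff)
  finally have "l2norm (\<lambda>i. if i \<in> L then 0 else v i) \<le> e"
    unfolding l2norm_def using assms(2) by (simp add: real_le_lsqrt)
  thus ?thesis using that L by blast
qed

lemma L2_set_Cauchy_Schwarz:
  "cmod (\<Sum>i\<in>F. u i * v i) \<le> L2_set (\<lambda>i. cmod (u i)) F * L2_set (\<lambda>i. cmod (v i)) F"
proof -
  have "cmod (\<Sum>i\<in>F. u i * v i) \<le> (\<Sum>i\<in>F. \<bar>cmod (u i)\<bar> * \<bar>cmod (v i)\<bar>)"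
    by (rule order_trans[OF norm_sum]) (simp add: norm_mult)
  also have "\<dots> \<le> L2_set (\<lambda>i. cmod (u i)) F * L2_set (\<lambda>i. cmod (v i)) F"
    by (rule L2_set_mult_ineq)
  finally show ?thesis .
qed

lemma l2_mult_summable:
  assumes "l2 u" and "l2 v"
  shows "(\<lambda>i. norm (u i * v i)) summable_on UNIV"
proof (rule Infinite_Sum.abs_summable_on_comparison_test')
  show "(\<lambda>i. (cmod (u i))\<^sup>2 + (cmod (v i))\<^sup>2) summable_on UNIV"
    using assms unfolding l2_def by (rule summable_on_add)
  show "cmod (u i * v i) \<le> (cmod (u i))\<^sup>2 + (cmod (v i))\<^sup>2" for i
  proof -
    have "2 * (cmod (u i) * cmod (v i)) \<le> (cmod (u i))\<^sup>2 + (cmod (v i))\<^sup>2"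
      using sum_squares_bound[of "cmod (u i)" "cmod (v i)"] by (simp add: mult.assoc)
    moreover have "0 \<le> cmod (u i) * cmod (v i)" by simp
    ultimately show ?thesis unfolding norm_mult by linarith
  qed
qed

lemma l2_mult_summable': "l2 u \<Longrightarrow> l2 v \<Longrightarrow> (\<lambda>i. u i * v i) summable_on UNIV"
  by (rule abs_summable_summable[OF l2_mult_summable])

lemma l2_mult_bound:
  assumes "l2 u" and "l2 v"
  shows "cmod (\<Sum>\<^sub>\<infinity>i. u i * v i) \<le> l2norm u * l2norm v"
proof (rule tendsto_upperbound)
  show "((\<lambda>F. cmod (\<Sum>i\<in>F. u i * v i)) \<longlongrightarrow> cmod (\<Sum>\<^sub>\<infinity>i. u i * v i)) (finite_subsets_at_top UNIV)"
    by (intro tendsto_norm infsum_tendsto l2_mult_summable' assms)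
  show "\<forall>\<^sub>F F in finite_subsets_at_top UNIV. cmod (\<Sum>i\<in>F. u i * v i) \<le> l2norm u * l2norm v"
  proof (rule eventually_finite_subsets_at_top_weakI)
    fix F :: "'a set" assume F: "finite F"
    have "cmod (\<Sum>i\<in>F. u i * v i) \<le> L2_set (\<lambda>i. cmod (u i)) F * L2_set (\<lambda>i. cmod (v i)) F"
      by (rule L2_set_Cauchy_Schwarz)
    also have "\<dots> \<le> l2norm u * l2norm v"
      by (intro mult_mono L2_set_le_l2norm assms F) auto
    finally show "cmod (\<Sum>i\<in>F. u i * v i) \<le> l2norm u * l2norm v" .
  qed
qed auto

text \<open>The bound is imposed on the bilinear form over finitely supported vectors, with no
  conjugation of \<open>\<eta>\<close>. Only finite sums occur, and the condition is visibly
  preserved by transposition and by entrywise limits.\<close>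

definition mbound :: "('i \<Rightarrow> 'i \<Rightarrow> complex) \<Rightarrow> real \<Rightarrow> bool" where
  "mbound M C \<longleftrightarrow> 0 \<le> C \<and> (\<forall>F G \<eta> \<xi>. finite F \<longrightarrow> finite G \<longrightarrow>
     cmod (\<Sum>i\<in>F. \<Sum>j\<in>G. \<eta> i * M i j * \<xi> j)
       \<le> C * (L2_set (\<lambda>i. cmod (\<eta> i)) F * L2_set (\<lambda>j. cmod (\<xi> j)) G))"

lemma mboundI:
  assumes "0 \<le> C" and "\<And>F G \<eta> \<xi>. finite F \<Longrightarrow> finite G \<Longrightarrow>
     cmod (\<Sum>i\<in>F. \<Sum>j\<in>G. \<eta> i * M i j * \<xi> j)
       \<le> C * (L2_set (\<lambda>i. cmod (\<eta> i)) F * L2_set (\<lambda>j. cmod (\<xi> j)) G)"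
  shows "mbound M C"
  using assms by (simp add: mbound_def)

lemma mboundD:
  assumes "mbound M C" and "finite F" and "finite G"
  shows "cmod (\<Sum>i\<in>F. \<Sum>j\<in>G. \<eta> i * M i j * \<xi> j)
       \<le> C * (L2_set (\<lambda>i. cmod (\<eta> i)) F * L2_set (\<lambda>j. cmod (\<xi> j)) G)"
  using assms by (simp add: mbound_def)

lemma mbound_nonneg: "mbound M C \<Longrightarrow> 0 \<le> C"
  by (simp add: mbound_def)

lemma mbound_mono:
  assumes "mbound M C" and "C \<le> D"
  shows "mbound M D"
proof (rule mboundI)
  show "0 \<le> D" using mbound_nonneg[OF assms(1)] assms(2) by simp
  fix F G :: "'a set" and \<eta> \<xi> :: "'a \<Rightarrow> complex" assume F: "finite F" "finite G"
  let ?r = "L2_set (\<lambda>i. cmod (\<eta> i)) F * L2_set (\<lambda>j. cmod (\<xi> j)) G"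
  have "C * ?r \<le> D * ?r" using assms(2) by (intro mult_right_mono) auto
  thus "cmod (\<Sum>i\<in>F. \<Sum>j\<in>G. \<eta> i * M i j * \<xi> j) \<le> D * ?r"
    using mboundD[OF assms(1) F, of \<eta> \<xi>] by linarith
qed

lemma mbound_transpose:
  assumes "mbound M C"
  shows "mbound (\<lambda>i j. M j i) C"
proof (rule mboundI)
  show "0 \<le> C" using assms by (rule mbound_nonneg)
  fix F G :: "'a set" and \<eta> \<xi> :: "'a \<Rightarrow> complex"
  assume "finite F" "finite G"
  from mboundD[OF assms this(2,1), of \<xi> \<eta>]
  show "cmod (\<Sum>i\<in>F. \<Sum>j\<in>G. \<eta> i * M j i * \<xi> j)
       \<le> C * (L2_set (\<lambda>i. cmod (\<eta> i)) F * L2_set (\<lambda>j. cmod (\<xi> j)) G)"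
    by (subst sum.swap) (simp add: mult_ac)
qed

lemma mbound_cnj:
  assumes "mbound M C"
  shows "mbound (\<lambda>i j. cnj (M i j)) C"
proof (rule mboundI)
  show "0 \<le> C" using assms by (rule mbound_nonneg)
  fix F G :: "'a set" and \<eta> \<xi> :: "'a \<Rightarrow> complex"
  assume F: "finite F" "finite G"
  have "cmod (\<Sum>i\<in>F. \<Sum>j\<in>G. \<eta> i * cnj (M i j) * \<xi> j)
      = cmod (cnj (\<Sum>i\<in>F. \<Sum>j\<in>G. cnj (\<eta> i) * M i j * cnj (\<xi> j)))" by simp
  also have "\<dots> = cmod (\<Sum>i\<in>F. \<Sum>j\<in>G. cnj (\<eta> i) * M i j * cnj (\<xi> j))" by (rule complex_mod_cnj)
  finally show "cmod (\<Sum>i\<in>F. \<Sum>j\<in>G. \<eta> i * cnj (M i j) * \<xi> j)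
       \<le> C * (L2_set (\<lambda>i. cmod (\<eta> i)) F * L2_set (\<lambda>j. cmod (\<xi> j)) G)"
    using mboundD[OF assms F, of "\<lambda>i. cnj (\<eta> i)" "\<lambda>i. cnj (\<xi> i)"] by simp
qed

lemma mbound_entry:
  assumes "mbound M C"
  shows "cmod (M i j) \<le> C"
  using mboundD[OF assms, of "{i}" "{j}" "\<lambda>_. 1" "\<lambda>_. 1"] by simp

text \<open>Duality: testing the form against the conjugate of the image vector bounds the square of
  its norm by \<open>C\<close> times its norm times that of \<open>\<xi>\<close>, and one factor
  cancels.\<close>

lemma mbound_column:
  assumes "mbound M C" and F: "finite F" "finite G"
  shows "L2_set (\<lambda>i. cmod (\<Sum>j\<in>G. M i j * \<xi> j)) F \<le> C * L2_set (\<lambda>j. cmod (\<xi> j)) G"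
proof -
  define y where "y i = (\<Sum>j\<in>G. M i j * \<xi> j)" for i
  let ?y = "L2_set (\<lambda>i. cmod (y i)) F"
  have "complex_of_real (?y\<^sup>2) = (\<Sum>i\<in>F. complex_of_real ((cmod (y i))\<^sup>2))"
    by (simp add: L2_set_def sum_nonneg)
  also have "\<dots> = (\<Sum>i\<in>F. y i * cnj (y i))" by (intro sum.cong refl complex_norm_square)
  also have "\<dots> = (\<Sum>i\<in>F. cnj (y i) * y i)" by (intro sum.cong refl mult.commute)
  also have "\<dots> = (\<Sum>i\<in>F. \<Sum>j\<in>G. cnj (y i) * M i j * \<xi> j)"
    by (simp add: y_def sum_distrib_left mult.assoc)
  finally have "?y\<^sup>2 = cmod (\<Sum>i\<in>F. \<Sum>j\<in>G. cnj (y i) * M i j * \<xi> j)"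
    by (metis norm_of_real abs_power2)
  also have "\<dots> \<le> C * (L2_set (\<lambda>i. cmod (cnj (y i))) F * L2_set (\<lambda>j. cmod (\<xi> j)) G)"
    by (rule mboundD[OF assms])
  finally have "?y * ?y \<le> (C * L2_set (\<lambda>j. cmod (\<xi> j)) G) * ?y"
    by (simp add: power2_eq_square mult_ac)
  moreover have "0 \<le> C * L2_set (\<lambda>j. cmod (\<xi> j)) G" using mbound_nonneg[OF assms(1)] by simp
  ultimately have "?y \<le> C * L2_set (\<lambda>j. cmod (\<xi> j)) G"
    by (metis L2_set_nonneg mult_right_le_imp_le order_le_less)
  thus ?thesis by (simp add: y_def)
qed

definition app :: "('i \<Rightarrow> 'i \<Rightarrow> complex) \<Rightarrow> ('i \<Rightarrow> complex) \<Rightarrow> 'i \<Rightarrow> complex" where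
  "app M v i = (\<Sum>\<^sub>\<infinity>j. M i j * v j)"

lemma l2_column: "mbound M C \<Longrightarrow> l2 (\<lambda>i. M i j)"
  by (rule l2_boundedI[of _ C]) (use mbound_column[of M C _ "{j}" "\<lambda>_. 1"] in auto)

lemma l2_row: "mbound M C \<Longrightarrow> l2 (M i)"
  using l2_column[OF mbound_transpose[of M C], of i] by simp

lemma app_bound:
  assumes M: "mbound M C" and v: "l2 v"
  shows "l2 (app M v)" and "l2norm (app M v) \<le> C * l2norm v"
proof -
  have *: "L2_set (\<lambda>i. cmod (app M v i)) F \<le> C * l2norm v" if F: "finite F" for F
  proof (rule tendsto_upperbound)
    show "((\<lambda>G. L2_set (\<lambda>i. cmod (\<Sum>j\<in>G. M i j * v j)) F) \<longlongrightarrow> L2_set (\<lambda>i. cmod (app M v i)) F)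
       (finite_subsets_at_top UNIV)"
      unfolding L2_set_def app_def
      by (intro tendsto_intros infsum_tendsto l2_mult_summable' l2_row[OF M] v)
    show "\<forall>\<^sub>F G in finite_subsets_at_top UNIV.
        L2_set (\<lambda>i. cmod (\<Sum>j\<in>G. M i j * v j)) F \<le> C * l2norm v"
    proof (rule eventually_finite_subsets_at_top_weakI)
      fix G :: "'a set" assume G: "finite G"
      show "L2_set (\<lambda>i. cmod (\<Sum>j\<in>G. M i j * v j)) F \<le> C * l2norm v"
        by (rule order_trans[OF mbound_column[OF M F G]])
          (intro mult_left_mono L2_set_le_l2norm v G mbound_nonneg[OF M])
    qed
  qed auto
  show "l2 (app M v)" and "l2norm (app M v) \<le> C * l2norm v" using l2_boundedI[OF *] by auto
qed

lemma app_add: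
  assumes "mbound M C" and "l2 u" and "l2 v"
  shows "app M (\<lambda>i. u i + v i) i = app M u i + app M v i"
  unfolding app_def distrib_left
  by (intro infsum_add l2_mult_summable' assms l2_row[OF assms(1)])

lemma app_finite:
  assumes "finite L" and "\<And>i. i \<notin> L \<Longrightarrow> v i = 0"
  shows "app M v i = (\<Sum>j\<in>L. M i j * v j)"
proof -
  have "app M v i = (\<Sum>\<^sub>\<infinity>j\<in>L. M i j * v j)"
    unfolding app_def by (rule infsum_cong_neutral) (use assms in auto)
  thus ?thesis using assms(1) by simp
qed

lemma infsum_sum_swap:
  fixes f :: "'a \<Rightarrow> 'b \<Rightarrow> complex"
  assumes "finite L" and "\<And>l. l \<in> L \<Longrightarrow> (\<lambda>k. f k l) summable_on UNIV"
  shows "(\<Sum>\<^sub>\<infinity>k. \<Sum>l\<in>L. f k l) = (\<Sum>l\<in>L. \<Sum>\<^sub>\<infinity>k. f k l)"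
    and "(\<lambda>k. \<Sum>l\<in>L. f k l) summable_on UNIV"
proof -
  have "(\<Sum>\<^sub>\<infinity>k. \<Sum>l\<in>L. f k l) = (\<Sum>l\<in>L. \<Sum>\<^sub>\<infinity>k. f k l) \<and> (\<lambda>k. \<Sum>l\<in>L. f k l) summable_on UNIV"
    using assms
  proof (induction L rule: finite_induct)
    case (insert x F)
    then show ?case by (auto simp: infsum_add summable_on_add)
  qed auto
  thus "(\<Sum>\<^sub>\<infinity>k. \<Sum>l\<in>L. f k l) = (\<Sum>l\<in>L. \<Sum>\<^sub>\<infinity>k. f k l)"
    and "(\<lambda>k. \<Sum>l\<in>L. f k l) summable_on UNIV" by auto
qed

text \<open>The double series need not converge absolutely, so Fubini is not available; both sides are
  bounded bilinear forms that agree for finitely supported \<open>v\<close>.\<close>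

lemma app_associative:
  assumes M: "mbound M C" and u: "l2 u" and v: "l2 v"
  shows "(\<Sum>\<^sub>\<infinity>k. u k * app M v k) = (\<Sum>\<^sub>\<infinity>l. app (\<lambda>i j. M j i) u l * v l)"
proof -
  define A where "A v = (\<Sum>\<^sub>\<infinity>k. u k * app M v k)" for v
  define B where "B v = (\<Sum>\<^sub>\<infinity>l. app (\<lambda>i j. M j i) u l * v l)" for v
  note M' = mbound_transpose[OF M]
  have addA: "A (\<lambda>i. v i + w i) = A v + A w" if "l2 v" "l2 w" for v w
    unfolding A_def app_add[OF M that] distrib_left
    by (intro infsum_add l2_mult_summable' u app_bound[OF M] that)
  have addB: "B (\<lambda>i. v i + w i) = B v + B w" if "l2 v" "l2 w" for v w
    unfolding B_def distrib_left by (intro infsum_add l2_mult_summable' app_bound[OF M' u] that)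
  have bA: "cmod (A v) \<le> l2norm u * (C * l2norm v)" if "l2 v" for v
    unfolding A_def
    by (rule order_trans[OF l2_mult_bound[OF u app_bound(1)[OF M that]]])
      (intro mult_left_mono app_bound(2)[OF M that] l2norm_nonneg)
  have bB: "cmod (B v) \<le> l2norm u * (C * l2norm v)" if "l2 v" for v
    unfolding B_def
    by (rule order_trans[OF l2_mult_bound[OF app_bound(1)[OF M' u] that]])
      (use mult_right_mono[OF app_bound(2)[OF M' u] l2norm_nonneg[of v]] in \<open>simp add: mult_ac\<close>)
  have fin: "A w = B w" if L: "finite L" and w: "\<And>i. i \<notin> L \<Longrightarrow> w i = 0" for w L
  proof -
    have "A w = (\<Sum>\<^sub>\<infinity>k. \<Sum>l\<in>L. u k * M k l * w l)"
      unfolding A_def using app_finite[OF that, where M=M] by (simp add: sum_distrib_left mult.assoc)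
    also have "\<dots> = (\<Sum>l\<in>L. \<Sum>\<^sub>\<infinity>k. u k * M k l * w l)"
      by (intro infsum_sum_swap L summable_on_cmult_left l2_mult_summable' u l2_column[OF M])
    also have "\<dots> = (\<Sum>l\<in>L. app (\<lambda>i j. M j i) u l * w l)"
      unfolding app_def by (simp only: infsum_cmult_left' mult.commute[of _ "u _"])
    also have "\<dots> = B w" unfolding B_def
      using L w by (subst infsum_cong_neutral[of L UNIV]) auto
    finally show ?thesis .
  qed
  \<comment> \<open>Cutting \<open>v\<close> off outside a finite set leaves a remainder of norm at
    most \<open>e\<close>. The finite part contributes equally to both forms, so only the remainder
    is left to estimate.\<close>
  have small: "cmod (A v - B v) \<le> 2 * (l2norm u * C) * e" if e: "e > 0" for e
  proof -
    obtain L where L: "finite L" and le: "l2norm (\<lambda>i. if i \<in> L then 0 else v i) \<le> e"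
      using l2_tail[OF v e] by blast
    let ?w = "\<lambda>i. if i \<in> L then v i else 0" and ?r = "\<lambda>i. if i \<in> L then 0 else v i"
    have "?r = (\<lambda>i. if i \<in> - L then v i else 0)" by auto
    hence r: "l2 ?r" using l2_restrict[OF v, of "- L"] by simp
    have w: "l2 ?w" by (rule l2_restrict[OF v])
    have eq: "v = (\<lambda>i. ?w i + ?r i)" by auto
    have "A v - B v = (A ?w + A ?r) - (B ?w + B ?r)"
      using addA[OF w r] addB[OF w r] eq by metis
    also have "\<dots> = A ?r - B ?r" using fin[OF L, of ?w] by simp
    finally have "cmod (A v - B v) \<le> cmod (A ?r) + cmod (B ?r)" by (simp add: norm_triangle_ineq4)
    also have "\<dots> \<le> 2 * (l2norm u * (C * l2norm ?r))" using bA[OF r] bB[OF r] by simp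
    also have "\<dots> \<le> 2 * (l2norm u * (C * e))"
      using le mbound_nonneg[OF M] by (intro mult_left_mono) auto
    finally show ?thesis by (simp add: mult_ac)
  qed
  have "cmod (A v - B v) \<le> 0"
  proof (rule field_le_epsilon)
    fix e :: real assume e: "e > 0"
    \<comment> \<open>The summand 1 keeps the divisor positive when \<open>l2norm u * C\<close> is
      zero.\<close>
    define K where "K = 2 * (l2norm u * C) + 1"
    have K: "K > 0" using mbound_nonneg[OF M] by (simp add: K_def add_nonneg_pos)
    have "cmod (A v - B v) \<le> 2 * (l2norm u * C) * (e / K)" using small[of "e / K"] e K by simp
    also have "\<dots> \<le> K * (e / K)" using e K by (intro mult_right_mono) (auto simp: K_def)
    finally show "cmod (A v - B v) \<le> 0 + e" using K by simp
  qed
  thus ?thesis by (simp add: A_def B_def)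
qed

section \<open>Products of bounded matrices\<close>

definition mmult :: "('i \<Rightarrow> 'i \<Rightarrow> complex) \<Rightarrow> ('i \<Rightarrow> 'i \<Rightarrow> complex) \<Rightarrow> 'i \<Rightarrow> 'i \<Rightarrow> complex" where
  "mmult M N i j = (\<Sum>\<^sub>\<infinity>k. M i k * N k j)"

lemma mmult_summable: "mbound M C \<Longrightarrow> mbound N D \<Longrightarrow> (\<lambda>k. M i k * N k j) summable_on UNIV"
  by (intro l2_mult_summable' l2_row l2_column)

text \<open>With the inner sum cut off at a finite set \<open>K\<close>, the form pairs the image of
  \<open>\<eta>\<close> under the transpose of \<open>M\<close> with the image of
  \<open>\<xi>\<close> under \<open>N\<close>. Cauchy-Schwarz gives a bound independent of
  \<open>K\<close>, which survives the limit.\<close>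

lemma mbound_mmult:
  assumes M: "mbound M C" and N: "mbound N D"
  shows "mbound (mmult M N) (C * D)"
proof (rule mboundI)
  show "0 \<le> C * D" using mbound_nonneg M N by (meson mult_nonneg_nonneg)
  fix F G :: "'a set" and \<eta> \<xi> :: "'a \<Rightarrow> complex" assume F: "finite F" and G: "finite G"
  let ?h = "L2_set (\<lambda>i. cmod (\<eta> i)) F" and ?x = "L2_set (\<lambda>j. cmod (\<xi> j)) G"
  have eq: "(\<Sum>k\<in>K. (\<Sum>i\<in>F. M i k * \<eta> i) * (\<Sum>j\<in>G. N k j * \<xi> j))
      = (\<Sum>i\<in>F. \<Sum>j\<in>G. \<eta> i * (\<Sum>k\<in>K. M i k * N k j) * \<xi> j)" for K
  proof -
    have "(\<Sum>k\<in>K. (\<Sum>i\<in>F. M i k * \<eta> i) * (\<Sum>j\<in>G. N k j * \<xi> j))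
        = (\<Sum>k\<in>K. \<Sum>i\<in>F. \<Sum>j\<in>G. M i k * \<eta> i * (N k j * \<xi> j))" by (simp add: sum_product)
    also have "\<dots> = (\<Sum>i\<in>F. \<Sum>k\<in>K. \<Sum>j\<in>G. M i k * \<eta> i * (N k j * \<xi> j))" by (rule sum.swap)
    also have "\<dots> = (\<Sum>i\<in>F. \<Sum>j\<in>G. \<Sum>k\<in>K. M i k * \<eta> i * (N k j * \<xi> j))"
      by (intro sum.cong refl sum.swap)
    finally show ?thesis by (simp add: sum_distrib_left sum_distrib_right mult_ac)
  qed
  show "cmod (\<Sum>i\<in>F. \<Sum>j\<in>G. \<eta> i * mmult M N i j * \<xi> j) \<le> C * D * (?h * ?x)"
  proof (rule tendsto_upperbound)
    show "((\<lambda>K. cmod (\<Sum>i\<in>F. \<Sum>j\<in>G. \<eta> i * (\<Sum>k\<in>K. M i k * N k j) * \<xi> j)) \<longlongrightarrow>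
       cmod (\<Sum>i\<in>F. \<Sum>j\<in>G. \<eta> i * mmult M N i j * \<xi> j)) (finite_subsets_at_top UNIV)"
      unfolding mmult_def by (intro tendsto_intros infsum_tendsto mmult_summable[OF M N])
    show "\<forall>\<^sub>F K in finite_subsets_at_top UNIV.
       cmod (\<Sum>i\<in>F. \<Sum>j\<in>G. \<eta> i * (\<Sum>k\<in>K. M i k * N k j) * \<xi> j) \<le> C * D * (?h * ?x)"
    proof (rule eventually_finite_subsets_at_top_weakI)
      fix K :: "'a set" assume K: "finite K"
      have "cmod (\<Sum>k\<in>K. (\<Sum>i\<in>F. M i k * \<eta> i) * (\<Sum>j\<in>G. N k j * \<xi> j))
        \<le> L2_set (\<lambda>k. cmod (\<Sum>i\<in>F. M i k * \<eta> i)) K * L2_set (\<lambda>k. cmod (\<Sum>j\<in>G. N k j * \<xi> j)) K"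
        by (rule L2_set_Cauchy_Schwarz)
      also have "\<dots> \<le> (C * ?h) * (D * ?x)"
        using mbound_nonneg[OF M] mbound_nonneg[OF N]
        by (intro mult_mono mbound_column[OF mbound_transpose[OF M]] mbound_column[OF N] F G K) auto
      also have "(C * ?h) * (D * ?x) = C * D * (?h * ?x)" by simp
      finally show "cmod (\<Sum>i\<in>F. \<Sum>j\<in>G. \<eta> i * (\<Sum>k\<in>K. M i k * N k j) * \<xi> j) \<le> C * D * (?h * ?x)"
        unfolding eq .
    qed
  qed auto
qed

lemma mmult_assoc:
  assumes M: "mbound M C" and N: "mbound N D" and P: "mbound P E"
  shows "mmult (mmult M N) P = mmult M (mmult N P)"
proof (intro ext)
  fix i j
  have "mmult M (mmult N P) i j = (\<Sum>\<^sub>\<infinity>k. M i k * app N (\<lambda>l. P l j) k)"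
    by (simp add: mmult_def app_def)
  also have "\<dots> = (\<Sum>\<^sub>\<infinity>l. app (\<lambda>i j. N j i) (M i) l * P l j)"
    by (rule app_associative[OF N l2_row[OF M] l2_column[OF P]])
  also have "\<dots> = mmult (mmult M N) P i j"
    by (simp add: mmult_def app_def mult.commute)
  finally show "mmult (mmult M N) P i j = mmult M (mmult N P) i j" by simp
qed

lemma mbound_add:
  assumes M: "mbound M C" and N: "mbound N D"
  shows "mbound (\<lambda>i j. M i j + N i j) (C + D)"
proof (rule mboundI)
  show "0 \<le> C + D" using mbound_nonneg M N by (meson add_nonneg_nonneg)
  fix F G :: "'a set" and \<eta> \<xi> :: "'a \<Rightarrow> complex" assume F: "finite F" and G: "finite G"
  have "(\<Sum>i\<in>F. \<Sum>j\<in>G. \<eta> i * (M i j + N i j) * \<xi> j)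
      = (\<Sum>i\<in>F. \<Sum>j\<in>G. \<eta> i * M i j * \<xi> j) + (\<Sum>i\<in>F. \<Sum>j\<in>G. \<eta> i * N i j * \<xi> j)"
    by (simp add: algebra_simps sum.distrib)
  thus "cmod (\<Sum>i\<in>F. \<Sum>j\<in>G. \<eta> i * (M i j + N i j) * \<xi> j)
       \<le> (C + D) * (L2_set (\<lambda>i. cmod (\<eta> i)) F * L2_set (\<lambda>j. cmod (\<xi> j)) G)"
    using norm_triangle_mono[OF mboundD[OF M F G, of \<eta> \<xi>] mboundD[OF N F G, of \<eta> \<xi>]]
    by (simp add: distrib_right)
qed

lemma mbound_cmult:
  assumes M: "mbound M C"
  shows "mbound (\<lambda>i j. c * M i j) (cmod c * C)"
proof (rule mboundI)
  show "0 \<le> cmod c * C" using mbound_nonneg[OF M] by simp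
  fix F G :: "'a set" and \<eta> \<xi> :: "'a \<Rightarrow> complex" assume F: "finite F" and G: "finite G"
  have "(\<Sum>i\<in>F. \<Sum>j\<in>G. \<eta> i * (c * M i j) * \<xi> j) = c * (\<Sum>i\<in>F. \<Sum>j\<in>G. \<eta> i * M i j * \<xi> j)"
    by (simp add: sum_distrib_left mult_ac)
  thus "cmod (\<Sum>i\<in>F. \<Sum>j\<in>G. \<eta> i * (c * M i j) * \<xi> j)
       \<le> cmod c * C * (L2_set (\<lambda>i. cmod (\<eta> i)) F * L2_set (\<lambda>j. cmod (\<xi> j)) G)"
    using mult_left_mono[OF mboundD[OF M F G, of \<eta> \<xi>], of "cmod c"] by (simp add: norm_mult mult_ac)
qed

lemma mbound_diagonal:
  assumes "\<And>i. cmod (d i) \<le> C" and "0 \<le> C"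
  shows "mbound (\<lambda>i j. if i = j then d i else 0) C"
proof (rule mboundI[OF assms(2)])
  fix F G :: "'a set" and \<eta> \<xi> :: "'a \<Rightarrow> complex" assume F: "finite F" and G: "finite G"
  have "(\<Sum>i\<in>F. \<Sum>j\<in>G. \<eta> i * (if i = j then d i else 0) * \<xi> j) = (\<Sum>i\<in>F \<inter> G. \<eta> i * d i * \<xi> i)"
  proof -
    have "(\<Sum>j\<in>G. \<eta> i * (if i = j then d i else 0) * \<xi> j) = (if i \<in> G then \<eta> i * d i * \<xi> i else 0)" for i
    proof -
      have "(\<Sum>j\<in>G. \<eta> i * (if i = j then d i else 0) * \<xi> j) = (\<Sum>j\<in>G. if i = j then \<eta> i * d i * \<xi> i else 0)"
        by (rule sum.cong) auto
      thus ?thesis using G by simp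
    qed
    thus ?thesis using F by (simp add: sum.inter_restrict)
  qed
  also have "cmod \<dots> \<le> (\<Sum>i\<in>F \<inter> G. C * (\<bar>cmod (\<eta> i)\<bar> * \<bar>cmod (\<xi> i)\<bar>))"
    by (rule order_trans[OF norm_sum])
      (auto simp: norm_mult intro!: sum_mono mult_mono mult_nonneg_nonneg assms
        simp flip: mult.assoc simp: mult.commute[of _ "cmod (d _)"])
  also have "\<dots> \<le> C * (L2_set (\<lambda>i. cmod (\<eta> i)) (F \<inter> G) * L2_set (\<lambda>j. cmod (\<xi> j)) (F \<inter> G))"
    unfolding sum_distrib_left[symmetric] by (intro mult_left_mono L2_set_mult_ineq assms(2))
  also have "\<dots> \<le> C * (L2_set (\<lambda>i. cmod (\<eta> i)) F * L2_set (\<lambda>j. cmod (\<xi> j)) G)"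
    using F G unfolding L2_set_def
    by (intro mult_left_mono mult_mono real_sqrt_le_mono sum_mono2 assms(2)) (auto intro: sum_nonneg)
  finally show "cmod (\<Sum>i\<in>F. \<Sum>j\<in>G. \<eta> i * (if i = j then d i else 0) * \<xi> j)
     \<le> C * (L2_set (\<lambda>i. cmod (\<eta> i)) F * L2_set (\<lambda>j. cmod (\<xi> j)) G)" .
qed

text \<open>Each instance of the bound involves finitely many entries. Completeness uses this twice:
  the entrywise limit of a Cauchy sequence is bounded, and its distance to late members of the
  sequence is small.\<close>

lemma mbound_pointwise_limit:
  assumes "\<And>i j. (\<lambda>n. X n i j) \<longlonglongrightarrow> M i j" and "\<forall>\<^sub>F n in sequentially. mbound (X n) C"
  shows "mbound M C"
proof (rule mboundI)
  from eventually_happens'[OF sequentially_bot assms(2)]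
  show "0 \<le> C" using mbound_nonneg by blast
  fix F G :: "'a set" and \<eta> \<xi> :: "'a \<Rightarrow> complex" assume F: "finite F" and G: "finite G"
  show "cmod (\<Sum>i\<in>F. \<Sum>j\<in>G. \<eta> i * M i j * \<xi> j)
       \<le> C * (L2_set (\<lambda>i. cmod (\<eta> i)) F * L2_set (\<lambda>j. cmod (\<xi> j)) G)"
  proof (rule tendsto_upperbound)
    show "(\<lambda>n. cmod (\<Sum>i\<in>F. \<Sum>j\<in>G. \<eta> i * X n i j * \<xi> j)) \<longlonglongrightarrow>
        cmod (\<Sum>i\<in>F. \<Sum>j\<in>G. \<eta> i * M i j * \<xi> j)"
      by (intro tendsto_intros assms(1))
    show "\<forall>\<^sub>F n in sequentially. cmod (\<Sum>i\<in>F. \<Sum>j\<in>G. \<eta> i * X n i j * \<xi> j)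
       \<le> C * (L2_set (\<lambda>i. cmod (\<eta> i)) F * L2_set (\<lambda>j. cmod (\<xi> j)) G)"
      using assms(2) by eventually_elim (rule mboundD[OF _ F G])
  qed auto
qed

section \<open>The Banach algebra of bounded matrices and its involution\<close>

typedef 'i bmat = "{M :: 'i \<Rightarrow> 'i \<Rightarrow> complex. \<exists>C. mbound M C}"
  morphisms ent Abs_bmat
proof -
  have "mbound (\<lambda>(i::'i) j. if i = j then 0 else 0) 0" by (rule mbound_diagonal) auto
  thus ?thesis by blast
qed

setup_lifting type_definition_bmat

lemma mbound_ent: "\<exists>C. mbound (ent X) C"
  using ent by blast

lemma bmat_eqI: "(\<And>i j. ent X i j = ent Y i j) \<Longrightarrow> X = Y"
  by (metis ent_inject ext)

lift_definition cs :: "complex \<Rightarrow> 'i bmat \<Rightarrow> 'i bmat" is "\<lambda>c M i j. c * M i j"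
  using mbound_cmult by blast

lift_definition adj :: "'i bmat \<Rightarrow> 'i bmat" is "\<lambda>M i j. cnj (M j i)"
  using mbound_transpose mbound_cnj by blast

instantiation bmat :: (type) real_normed_vector
begin

lift_definition zero_bmat :: "'a bmat" is "\<lambda>i j. 0"
  using mbound_diagonal[of "\<lambda>_. 0" 0] by auto

lift_definition plus_bmat :: "'a bmat \<Rightarrow> 'a bmat \<Rightarrow> 'a bmat" is "\<lambda>M N i j. M i j + N i j"
  using mbound_add by blast

lift_definition uminus_bmat :: "'a bmat \<Rightarrow> 'a bmat" is "\<lambda>M i j. - M i j"
  using mbound_cmult[of _ _ "-1"] by auto

lift_definition minus_bmat :: "'a bmat \<Rightarrow> 'a bmat \<Rightarrow> 'a bmat" is "\<lambda>M N i j. M i j - N i j"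
proof -
  fix M N :: "'a \<Rightarrow> 'a \<Rightarrow> complex"
  assume "\<exists>C. mbound M C" "\<exists>C. mbound N C"
  then obtain C D where "mbound M C" "mbound N D" by blast
  from mbound_add[OF this(1) mbound_cmult[OF this(2), of "-1"]]
  show "\<exists>C. mbound (\<lambda>i j. M i j - N i j) C" by auto
qed

lift_definition scaleR_bmat :: "real \<Rightarrow> 'a bmat \<Rightarrow> 'a bmat" is "\<lambda>r M i j. complex_of_real r * M i j"
  using mbound_cmult by blast


definition norm_bmat :: "'a bmat \<Rightarrow> real" where
  "norm_bmat X = Inf {C. mbound (ent X) C}"

definition dist_bmat :: "'a bmat \<Rightarrow> 'a bmat \<Rightarrow> real" where
  "dist_bmat X Y = norm (X - Y)"

definition sgn_bmat :: "'a bmat \<Rightarrow> 'a bmat" where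
  "sgn_bmat X = scaleR (inverse (norm X)) X"

definition uniformity_bmat :: "('a bmat \<times> 'a bmat) filter" where
  "uniformity_bmat = (INF e\<in>{0<..}. principal {(x, y). dist x y < e})"

definition open_bmat :: "'a bmat set \<Rightarrow> bool" where
  "open_bmat U \<longleftrightarrow> (\<forall>x\<in>U. \<forall>\<^sub>F (x', y) in uniformity. x' = x \<longrightarrow> y \<in> U)"

text \<open>The infimum defining the norm is attained: for fixed test vectors the inequality is
  linear in \<open>C\<close>, so it passes to the infimum.\<close>

lemma mbound_norm: "mbound (ent (X :: 'a bmat)) (norm X)"
proof (rule mboundI)
  obtain C0 where C0: "mbound (ent X) C0" using mbound_ent by blast
  have ne: "{C. mbound (ent X) C} \<noteq> {}" using C0 by blast
  show "0 \<le> norm X" unfolding norm_bmat_def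
  proof (rule cInf_greatest[OF ne])
    fix C assume "C \<in> {C. mbound (ent X) C}"
    hence "mbound (ent X) C" by simp
    thus "0 \<le> C" by (rule mbound_nonneg)
  qed
  fix F G :: "'a set" and \<eta> \<xi> :: "'a \<Rightarrow> complex" assume F: "finite F" "finite G"
  let ?r = "L2_set (\<lambda>i. cmod (\<eta> i)) F * L2_set (\<lambda>j. cmod (\<xi> j)) G"
  let ?l = "cmod (\<Sum>i\<in>F. \<Sum>j\<in>G. \<eta> i * ent X i j * \<xi> j)"
  show "?l \<le> norm X * ?r"
  proof (cases "?r = 0")
    case True
    then show ?thesis using mboundD[OF C0 F, of \<eta> \<xi>] unfolding True by simp
  next
    case False
    hence r: "?r > 0" by (simp add: order_less_le)
    have "?l / ?r \<le> norm X" unfolding norm_bmat_def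
    proof (rule cInf_greatest[OF ne])
      fix C assume "C \<in> {C. mbound (ent X) C}"
      hence "?l \<le> C * ?r" using mboundD[OF _ F] by blast
      thus "?l / ?r \<le> C" using r by (simp add: pos_divide_le_eq)
    qed
    thus ?thesis using r by (simp add: pos_divide_le_eq)
  qed
qed

lemma norm_bmat_leI: "mbound (ent (X :: 'a bmat)) C \<Longrightarrow> norm X \<le> C"
  unfolding norm_bmat_def
  by (rule cInf_lower, simp, rule bdd_belowI[of _ 0]) (metis mbound_nonneg mem_Collect_eq)

lemma norm_cs: "norm (cs c (X :: 'a bmat)) = cmod c * norm X"
proof (cases "c = 0")
  case True
  have "norm (cs c X) \<le> cmod c * norm X"
    by (rule norm_bmat_leI) (simp add: cs.rep_eq mbound_cmult mbound_norm)
  thus ?thesis using True mbound_nonneg[OF mbound_norm, of "cs c X"] by simp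
next
  case False
  have 1: "norm (cs d Y) \<le> cmod d * norm Y" for d and Y :: "'a bmat"
    by (rule norm_bmat_leI) (simp add: cs.rep_eq mbound_cmult mbound_norm)
  have "cs (inverse c) (cs c X) = X"
    using False by (intro bmat_eqI) (simp add: cs.rep_eq)
  hence "norm X \<le> cmod (inverse c) * norm (cs c X)" using 1[of "inverse c" "cs c X"] by simp
  hence "cmod c * norm X \<le> norm (cs c X)"
    using False unfolding norm_inverse by (simp add: field_simps)
  thus ?thesis using 1[of c X] by simp
qed

lemma scaleR_conv_cs: "r *\<^sub>R X = cs (complex_of_real r) X" for X :: "'a bmat"
  by transfer simp

instance
proof
  fix a b :: real and x y z :: "'a bmat"
  show "a *\<^sub>R (x + y) = a *\<^sub>R x + a *\<^sub>R y" "(a + b) *\<^sub>R x = a *\<^sub>R x + b *\<^sub>R x"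
    "a *\<^sub>R b *\<^sub>R x = (a * b) *\<^sub>R x" "1 *\<^sub>R x = x"
    by (intro bmat_eqI; simp add: plus_bmat.rep_eq scaleR_bmat.rep_eq algebra_simps)+
  show "x + y + z = x + (y + z)" "x + y = y + x" "0 + x = x" "- x + x = 0" "x - y = x + - y"
    by (intro bmat_eqI; simp add: plus_bmat.rep_eq minus_bmat.rep_eq uminus_bmat.rep_eq
        zero_bmat.rep_eq)+
  show "dist x y = norm (x - y)" by (rule dist_bmat_def)
  show "sgn x = inverse (norm x) *\<^sub>R x" by (rule sgn_bmat_def)
  show "uniformity = (INF e\<in>{0<..}. principal {(x, y). dist x (y::'a bmat) < e})"
    by (rule uniformity_bmat_def)
  show "open U \<longleftrightarrow> (\<forall>x\<in>U. \<forall>\<^sub>F (x', y) in uniformity. x' = x \<longrightarrow> y \<in> U)" for U :: "'a bmat set"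
    by (rule open_bmat_def)
  show "norm (a *\<^sub>R x) = \<bar>a\<bar> * norm x" by (simp add: scaleR_conv_cs norm_cs)
  show "norm (x + y) \<le> norm x + norm y"
    by (rule norm_bmat_leI) (simp add: plus_bmat.rep_eq mbound_add mbound_norm)
  show "norm x = 0 \<longleftrightarrow> x = 0"
  proof
    assume "norm x = 0"
    hence "ent x i j = 0" for i j using mbound_entry[OF mbound_norm, of x i j] by simp
    thus "x = 0" by (intro bmat_eqI) (simp add: zero_bmat.rep_eq)
  next
    assume "x = 0"
    hence "norm x \<le> 0"
      using mbound_diagonal[of "\<lambda>_. 0" 0] by (intro norm_bmat_leI) (simp add: zero_bmat.rep_eq)
    thus "norm x = 0" using mbound_nonneg[OF mbound_norm, of x] by simp
  qed
qed

end

lemma norm_ent: "cmod (ent X i j) \<le> norm X"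
  by (rule mbound_entry[OF mbound_norm])

instance bmat :: (type) banach
proof
  fix X :: "nat \<Rightarrow> 'a bmat" assume C: "Cauchy X"
  have "Cauchy (\<lambda>n. ent (X n) i j)" for i j
  proof (rule metric_CauchyI)
    fix e :: real assume "e > 0"
    then obtain N where N: "\<And>m n. m \<ge> N \<Longrightarrow> n \<ge> N \<Longrightarrow> dist (X m) (X n) < e"
      using metric_CauchyD[OF C] by blast
    have "dist (ent (X m) i j) (ent (X n) i j) \<le> dist (X m) (X n)" for m n
      using norm_ent[of "X m - X n" i j] by (simp add: dist_norm minus_bmat.rep_eq)
    thus "\<exists>N. \<forall>m\<ge>N. \<forall>n\<ge>N. dist (ent (X m) i j) (ent (X n) i j) < e"
      using N by (meson le_less_trans)
  qed
  define M where "M i j = lim (\<lambda>n. ent (X n) i j)" for i j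
  have M: "(\<lambda>n. ent (X n) i j) \<longlonglongrightarrow> M i j" for i j
    unfolding M_def by (rule convergent_LIMSEQ_iff[THEN iffD1], rule Cauchy_convergent) fact
  obtain K where K: "\<And>n. norm (X n) \<le> K" using BseqE[OF Cauchy_Bseq[OF C]] by blast
  have "mbound M K"
    by (rule mbound_pointwise_limit[OF M]) (intro always_eventually allI mbound_mono[OF mbound_norm K])
  then obtain Y where Y: "ent Y = M" using Abs_bmat_inverse by blast
  have "X \<longlonglongrightarrow> Y"
  proof (rule metric_LIMSEQ_I)
    fix e :: real assume e: "e > 0"
    then obtain N where N: "\<And>m n. m \<ge> N \<Longrightarrow> n \<ge> N \<Longrightarrow> dist (X m) (X n) < e / 2"
      using metric_CauchyD[OF C, of "e / 2"] by auto
    have "dist (X n) Y < e" if n: "n \<ge> N" for n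
    proof -
      have "mbound (ent (X n - Y)) (e / 2)"
      proof (rule mbound_pointwise_limit)
        show "(\<lambda>m. ent (X n - X m) i j) \<longlonglongrightarrow> ent (X n - Y) i j" for i j
          by (simp add: minus_bmat.rep_eq Y) (intro tendsto_intros M)
        show "\<forall>\<^sub>F m in sequentially. mbound (ent (X n - X m)) (e / 2)"
          using eventually_ge_at_top[of N]

        proof eventually_elim
          case (elim m)
          show ?case
            by (rule mbound_mono[OF mbound_norm]) (use N[OF n elim] in \<open>simp add: dist_norm\<close>)
        qed
      qed
      from norm_bmat_leI[OF this] show ?thesis using e by (simp add: dist_norm)
    qed
    thus "\<exists>N. \<forall>n\<ge>N. dist (X n) Y < e" by blast
  qed
  thus "convergent X" by (rule convergentI)
qed

instantiation bmat :: (type) real_normed_algebra_1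
begin

lift_definition one_bmat :: "'a bmat" is "\<lambda>i j. if i = j then 1 else 0"
  using mbound_diagonal[of "\<lambda>_. 1" 1] by auto

lift_definition times_bmat :: "'a bmat \<Rightarrow> 'a bmat \<Rightarrow> 'a bmat" is mmult
  using mbound_mmult by blast

lemma cs_mult_left: "cs c X * Y = cs c (X * Y)" for X Y :: "'a bmat"
  by transfer (simp add: fun_eq_iff mmult_def infsum_cmult_right' mult.assoc)

lemma cs_mult_right: "X * cs c Y = cs c (X * Y)" for X Y :: "'a bmat"
  by transfer (simp add: fun_eq_iff mmult_def infsum_cmult_right' mult.left_commute)

instance
proof
  fix a :: real and x y z :: "'a bmat"
  show "x * y * z = x * (y * z)" 
    by (intro bmat_eqI) (simp add: times_bmat.rep_eq mmult_assoc[OF mbound_norm mbound_norm mbound_norm])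
  show "(x + y) * z = x * z + y * z" "x * (y + z) = x * y + x * z"
    by (intro bmat_eqI; simp add: plus_bmat.rep_eq times_bmat.rep_eq mmult_def distrib_left
        distrib_right infsum_add mmult_summable[OF mbound_norm mbound_norm])+
  have "mmult (\<lambda>i j. if i = j then 1 else 0) M i j = M i j" for M :: "'a \<Rightarrow> 'a \<Rightarrow> complex" and i j
    unfolding mmult_def by (subst infsum_cong_neutral[of "{i}"]) auto
  thus "1 * x = x" by transfer (intro ext)
  have "mmult M (\<lambda>i j. if i = j then 1 else 0) i j = M i j" for M :: "'a \<Rightarrow> 'a \<Rightarrow> complex" and i j
    unfolding mmult_def by (subst infsum_cong_neutral[of "{j}"]) auto
  thus "x * 1 = x" by transfer (intro ext)
  show "(0::'a bmat) \<noteq> 1" by transfer (metis zero_neq_one)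
  show "a *\<^sub>R x * y = a *\<^sub>R (x * y)" "x * a *\<^sub>R y = a *\<^sub>R (x * y)"
    by (simp_all add: scaleR_conv_cs cs_mult_left cs_mult_right)
  show "norm (x * y) \<le> norm x * norm y"
    by (rule norm_bmat_leI) (simp add: times_bmat.rep_eq mbound_mmult mbound_norm)
  show "norm (1::'a bmat) = 1"
  proof (rule antisym)
    show "norm (1::'a bmat) \<le> 1"
      using mbound_diagonal[of "\<lambda>_. 1" 1] by (intro norm_bmat_leI) (simp add: one_bmat.rep_eq)
    show "1 \<le> norm (1::'a bmat)" using norm_ent[of "1::'a bmat" undefined undefined]
      by (simp add: one_bmat.rep_eq)
  qed
qed

end

lemma ent_times: "ent (X * Y) i j = (\<Sum>\<^sub>\<infinity>k. ent X i k * ent Y k j)"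
  by (simp add: times_bmat.rep_eq mmult_def)

lemma ent_mult_summable: "(\<lambda>k. ent X i k * ent Y k j) summable_on UNIV"
  by (rule mmult_summable[OF mbound_norm mbound_norm])

lemma cs_add_left: "cs (c + d) X = cs c X + cs d X"
  by transfer (simp add: distrib_right)

lemma cs_add_right: "cs c (X + Y) = cs c X + cs c Y"
  by transfer (simp add: distrib_left)

lemma cs_cs: "cs c (cs d X) = cs (c * d) X"
  by transfer (simp add: mult.assoc)

lemma cs_1 [simp]: "cs 1 X = X"
  by transfer simp

lemma cs_0 [simp]: "cs 0 X = 0"
  by transfer simp

lemma adj_adj [simp]: "adj (adj X) = X"
  by transfer simp

lemma adj_add: "adj (X + Y) = adj X + adj Y"
  by transfer simp

lemma adj_cs: "adj (cs c X) = cs (cnj c) (adj X)"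
  by transfer simp

lemma adj_times: "adj (X * Y) = adj Y * adj X"
  by (intro bmat_eqI) (simp add: adj.rep_eq ent_times mult.commute flip: infsum_cnj)

lemma adj_1 [simp]: "adj 1 = 1"
  by transfer (auto simp: fun_eq_iff)

lemma adj_0 [simp]: "adj 0 = 0"
  by transfer auto

lemma adj_minus: "adj (X - Y) = adj X - adj Y"
  by transfer simp

lemma norm_adj [simp]: "norm (adj X) = norm X"
proof -
  have "norm (adj X) \<le> norm X" for X :: "'a bmat"
    by (rule norm_bmat_leI) (simp add: adj.rep_eq mbound_transpose mbound_cnj mbound_norm)
  from this[of X] this[of "adj X"] show ?thesis by simp
qed

section \<open>Vector states and the spectrum of a self-adjoint matrix\<close>

lemma cs_minus_right: "cs c (X - Y) = cs c X - cs c Y"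
  by transfer (simp add: right_diff_distrib)

lemma cs_uminus_left: "cs (- c) X = - cs c X"
  by transfer simp

text \<open>\<open>mvec F \<xi> X\<close> is the image under \<open>X\<close> of the vector
  \<open>\<xi>\<close> cut off outside \<open>F\<close>, and \<open>vstate F \<xi>\<close> the
  corresponding vector functional. Finite support suffices to compute norms, and the vacuum is a
  single basis vector.\<close>

definition mvec :: "'i set \<Rightarrow> ('i \<Rightarrow> complex) \<Rightarrow> 'i bmat \<Rightarrow> 'i \<Rightarrow> complex" where
  "mvec F \<xi> X i = (\<Sum>j\<in>F. ent X i j * \<xi> j)"

definition vstate :: "'i set \<Rightarrow> ('i \<Rightarrow> complex) \<Rightarrow> 'i bmat \<Rightarrow> complex" where
  "vstate F \<xi> X = (\<Sum>i\<in>F. cnj (\<xi> i) * mvec F \<xi> X i)"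

lemma mvec_add: "mvec F \<xi> (X + Y) i = mvec F \<xi> X i + mvec F \<xi> Y i"
  by (simp add: mvec_def plus_bmat.rep_eq distrib_right sum.distrib)

lemma mvec_cs: "mvec F \<xi> (cs c X) i = c * mvec F \<xi> X i"
  by (simp add: mvec_def cs.rep_eq sum_distrib_left mult.assoc)

lemma vstate_add: "vstate F \<xi> (X + Y) = vstate F \<xi> X + vstate F \<xi> Y"
  by (simp add: vstate_def mvec_add distrib_left sum.distrib)

lemma vstate_cs: "vstate F \<xi> (cs c X) = c * vstate F \<xi> X"
  by (simp add: vstate_def mvec_cs sum_distrib_left mult.left_commute)

lemma vstate_minus: "vstate F \<xi> (X - Y) = vstate F \<xi> X - vstate F \<xi> Y"
  using vstate_add[of F \<xi> "X - Y" Y] by (simp add: algebra_simps)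

lemma vstate_bound:
  assumes "finite F"
  shows "cmod (vstate F \<xi> X) \<le> norm X * (L2_set (\<lambda>i. cmod (\<xi> i)) F)\<^sup>2"
  using mboundD[OF mbound_norm assms assms, of "\<lambda>i. cnj (\<xi> i)" X \<xi>]
  by (simp add: vstate_def mvec_def sum_distrib_left mult.assoc power2_eq_square)

lemma vstate_one:
  assumes "finite F"
  shows "vstate F \<xi> 1 = complex_of_real ((L2_set (\<lambda>i. cmod (\<xi> i)) F)\<^sup>2)"
proof -
  have "mvec F \<xi> 1 i = \<xi> i" if "i \<in> F" for i
    unfolding mvec_def one_bmat.rep_eq
    using assms that by (simp add: if_distrib[of "\<lambda>x. x * _"] cong: if_cong)
  hence "vstate F \<xi> 1 = (\<Sum>i\<in>F. complex_of_real ((cmod (\<xi> i))\<^sup>2))"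
    unfolding vstate_def complex_norm_square by (intro sum.cong refl) (simp add: mult.commute)
  thus ?thesis by (simp add: L2_set_def sum_nonneg)
qed

lemma mvec_bound:
  assumes "finite F"
  shows "l2 (mvec F \<xi> X)" and "l2norm (mvec F \<xi> X) \<le> norm X * L2_set (\<lambda>i. cmod (\<xi> i)) F"
proof -
  have *: "L2_set (\<lambda>i. cmod (mvec F \<xi> X i)) G \<le> norm X * L2_set (\<lambda>i. cmod (\<xi> i)) F"
    if "finite G" for G
    unfolding mvec_def by (rule mbound_column[OF mbound_norm that assms])
  show "l2 (mvec F \<xi> X)" and "l2norm (mvec F \<xi> X) \<le> norm X * L2_set (\<lambda>i. cmod (\<xi> i)) F"
    using l2_boundedI[OF *] by auto
qed

lemma mvec_times:
  assumes "finite F"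
  shows "mvec F \<xi> (X * Y) = app (ent X) (mvec F \<xi> Y)"
proof
  fix i
  have "app (ent X) (mvec F \<xi> Y) i = (\<Sum>\<^sub>\<infinity>k. \<Sum>j\<in>F. ent X i k * ent Y k j * \<xi> j)"
    by (simp add: app_def mvec_def sum_distrib_left mult.assoc)
  also have "\<dots> = (\<Sum>j\<in>F. \<Sum>\<^sub>\<infinity>k. ent X i k * ent Y k j * \<xi> j)"
    by (intro infsum_sum_swap assms summable_on_cmult_left ent_mult_summable)
  also have "\<dots> = mvec F \<xi> (X * Y) i"
    by (simp add: mvec_def ent_times infsum_cmult_left')
  finally show "mvec F \<xi> (X * Y) i = app (ent X) (mvec F \<xi> Y) i" by simp
qed

lemma mvec_times_bound:
  assumes "finite F"
  shows "l2norm (mvec F \<xi> (X * Y)) \<le> norm X * l2norm (mvec F \<xi> Y)"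
  unfolding mvec_times[OF assms] by (rule app_bound(2)[OF mbound_norm mvec_bound(1)[OF assms]])

lemma vstate_adj_times:
  assumes "finite F"
  shows "vstate F \<xi> (adj X * Y) = (\<Sum>\<^sub>\<infinity>k. cnj (mvec F \<xi> X k) * mvec F \<xi> Y k)"
proof -
  have l: "l2 (\<lambda>k. ent (adj X) i k)" for i by (rule l2_row[OF mbound_norm])
  have "(\<Sum>\<^sub>\<infinity>k. cnj (mvec F \<xi> X k) * mvec F \<xi> Y k)
      = (\<Sum>\<^sub>\<infinity>k. \<Sum>i\<in>F. cnj (\<xi> i) * (ent (adj X) i k * mvec F \<xi> Y k))"
    by (simp add: mvec_def[of F \<xi> X] adj.rep_eq sum_distrib_left sum_distrib_right mult_ac)
  also have "\<dots> = (\<Sum>i\<in>F. \<Sum>\<^sub>\<infinity>k. cnj (\<xi> i) * (ent (adj X) i k * mvec F \<xi> Y k))"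
    by (intro infsum_sum_swap assms summable_on_cmult_right l2_mult_summable' l mvec_bound(1))
  also have "\<dots> = vstate F \<xi> (adj X * Y)"
    by (simp add: vstate_def mvec_times[OF assms] app_def infsum_cmult_right')
  finally show ?thesis by simp
qed

lemma vstate_adj_times_self:
  assumes "finite F"
  shows "vstate F \<xi> (adj X * X) = complex_of_real ((l2norm (mvec F \<xi> X))\<^sup>2)"
proof -
  have "vstate F \<xi> (adj X * X) = (\<Sum>\<^sub>\<infinity>k. complex_of_real ((cmod (mvec F \<xi> X k))\<^sup>2))"
    unfolding vstate_adj_times[OF assms] complex_norm_square by (simp add: mult.commute)
  also have "\<dots> = complex_of_real (\<Sum>\<^sub>\<infinity>k. (cmod (mvec F \<xi> X k))\<^sup>2)"
    using mvec_bound(1)[OF assms, of \<xi> X] unfolding l2_def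
    by (intro infsumI has_sum_of_real has_sum_infsum)
  finally show ?thesis by (simp add: l2norm_squared)
qed

lemma vstate_adj_times_bound:
  assumes "finite F"
  shows "cmod (vstate F \<xi> (adj X * Y)) \<le> l2norm (mvec F \<xi> X) * l2norm (mvec F \<xi> Y)"
proof -
  have n: "l2norm (\<lambda>k. cnj (mvec F \<xi> X k)) = l2norm (mvec F \<xi> X)" by (simp add: l2norm_def)
  have l: "l2 (\<lambda>k. cnj (mvec F \<xi> X k))" using mvec_bound(1)[OF assms, of \<xi> X] by (simp add: l2_def)
  show ?thesis unfolding vstate_adj_times[OF assms]
    using l2_mult_bound[OF l mvec_bound(1)[OF assms, of \<xi> Y]] by (simp add: n)
qed

lemma norm_bmat_leI_mvec:
  assumes "0 \<le> C"
    and "\<And>F \<xi>. finite F \<Longrightarrow> l2norm (mvec F \<xi> X) \<le> C * L2_set (\<lambda>i. cmod (\<xi> i)) F"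
  shows "norm X \<le> C"
proof (rule norm_bmat_leI, rule mboundI[OF assms(1)])
  fix F G :: "'a set" and \<eta> \<xi> :: "'a \<Rightarrow> complex" assume F: "finite F" "finite G"
  have "cmod (\<Sum>i\<in>F. \<Sum>j\<in>G. \<eta> i * ent X i j * \<xi> j) = cmod (\<Sum>i\<in>F. \<eta> i * mvec G \<xi> X i)"
    by (simp add: mvec_def sum_distrib_left mult.assoc)
  also have "\<dots> \<le> L2_set (\<lambda>i. cmod (\<eta> i)) F * L2_set (\<lambda>i. cmod (mvec G \<xi> X i)) F"
    by (rule L2_set_Cauchy_Schwarz)
  also have "\<dots> \<le> L2_set (\<lambda>i. cmod (\<eta> i)) F * (C * L2_set (\<lambda>j. cmod (\<xi> j)) G)"
    by (intro mult_left_mono order_trans[OF L2_set_le_l2norm[OF mvec_bound(1)[OF F(2)] F(1)]]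
        assms(2) F) simp
  finally show "cmod (\<Sum>i\<in>F. \<Sum>j\<in>G. \<eta> i * ent X i j * \<xi> j)
       \<le> C * (L2_set (\<lambda>i. cmod (\<eta> i)) F * L2_set (\<lambda>j. cmod (\<xi> j)) G)"
    by (simp add: mult_ac)
qed

text \<open>For the lower bound: the squared length of the image of a vector under \<open>X\<close>
  is the value of the vector functional at \<open>adj X * X\<close>, and finitely supported vectors
  already determine the norm.\<close>

lemma norm_adj_times: "norm (adj X * X) = (norm X)\<^sup>2"
proof (rule antisym)
  show "norm (adj X * X) \<le> (norm X)\<^sup>2"
    using norm_mult_ineq[of "adj X" X] by (simp add: power2_eq_square)
  have "norm X \<le> sqrt (norm (adj X * X))"
  proof (rule norm_bmat_leI_mvec)
    fix F \<xi> assume F: "finite (F :: 'a set)"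
    have "(l2norm (mvec F \<xi> X))\<^sup>2 = cmod (vstate F \<xi> (adj X * X))"
      unfolding vstate_adj_times_self[OF F] norm_of_real by simp
    also have "\<dots> \<le> norm (adj X * X) * (L2_set (\<lambda>i. cmod (\<xi> i)) F)\<^sup>2" by (rule vstate_bound[OF F])
    also have "\<dots> = (sqrt (norm (adj X * X)) * L2_set (\<lambda>i. cmod (\<xi> i)) F)\<^sup>2"
      by (simp add: power_mult_distrib)
    finally show "l2norm (mvec F \<xi> X) \<le> sqrt (norm (adj X * X)) * L2_set (\<lambda>i. cmod (\<xi> i)) F"
      by (rule power2_le_imp_le) simp
  qed simp
  from power_mono[OF this, of 2] show "(norm X)\<^sup>2 \<le> norm (adj X * X)" by simp
qed

text \<open>Vectors that almost attain the norm of \<open>y\<close> are almost annihilated by \<open>\<parallel>y\<parallel>\<^sup>2 - y\<^sup>2\<close>.\<close>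

lemma norm_square_minus_square_not_invertible:
  assumes y: "adj y = y" and w: "w * (cs (complex_of_real ((norm y)\<^sup>2)) 1 - y * y) = 1"
  shows False
proof -
  define c where "c = norm y"
  define T where "T = cs (complex_of_real (c\<^sup>2)) 1 - y * y"
  have wT: "w * T = 1" using w by (simp add: T_def c_def)
  have c0: "0 \<le> c" by (simp add: c_def)
  have c: "c > 0"
  proof (rule ccontr)
    assume "\<not> c > 0"
    hence "y = 0" by (simp add: c_def)
    thus False using w by simp
  qed
  have W: "norm w > 0" using wT by auto
  have key: "(l2norm (mvec F \<xi> y))\<^sup>2 \<le> (c\<^sup>2 - 1 / ((norm w)\<^sup>2 * c\<^sup>2)) * (L2_set (\<lambda>i. cmod (\<xi> i)) F)\<^sup>2"
    if F: "finite F" for F \<xi>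
  proof -
    let ?n = "L2_set (\<lambda>i. cmod (\<xi> i)) F" and ?y = "l2norm (mvec F \<xi> y)"
    note v1 = vstate_one[OF F, of \<xi>]
    have 1: "?n = l2norm (mvec F \<xi> 1)"
    proof -
      have "complex_of_real (?n\<^sup>2) = complex_of_real ((l2norm (mvec F \<xi> 1))\<^sup>2)"
        using vstate_adj_times_self[OF F, of \<xi> 1] v1 by simp
      thus ?thesis unfolding of_real_eq_iff by (simp add: power2_eq_iff_nonneg)
    qed
    have adjT: "adj T = T" by (simp add: T_def adj_minus adj_cs adj_times y)
    have adjyy: "adj (y * y) = y * y" by (simp add: adj_times y)
    have "T * T = cs (complex_of_real (c^4)) 1 - cs (complex_of_real (c\<^sup>2)) (y * y)
        - cs (complex_of_real (c\<^sup>2)) (y * y) + (y * y) * (y * y)"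
      by (simp add: T_def algebra_simps cs_mult_left cs_mult_right cs_cs cs_minus_right
          power4_eq_xxxx power2_eq_square)
    hence "vstate F \<xi> (T * T) = complex_of_real (c^4 * ?n\<^sup>2 - 2 * c\<^sup>2 * ?y\<^sup>2 + (l2norm (mvec F \<xi> (y * y)))\<^sup>2)"
      using vstate_adj_times_self[OF F, of \<xi> y] vstate_adj_times_self[OF F, of \<xi> "y * y"]
      by (simp add: vstate_add vstate_minus vstate_cs v1 y adjyy)
    hence "complex_of_real ((l2norm (mvec F \<xi> T))\<^sup>2) = complex_of_real (c^4 * ?n\<^sup>2 - 2 * c\<^sup>2 * ?y\<^sup>2 + (l2norm (mvec F \<xi> (y * y)))\<^sup>2)"
      using vstate_adj_times_self[OF F, of \<xi> T] by (simp only: adjT)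
    hence T2: "(l2norm (mvec F \<xi> T))\<^sup>2 = c^4 * ?n\<^sup>2 - 2 * c\<^sup>2 * ?y\<^sup>2 + (l2norm (mvec F \<xi> (y * y)))\<^sup>2"
      by (simp only: of_real_eq_iff)
    have yy: "(l2norm (mvec F \<xi> (y * y)))\<^sup>2 \<le> c\<^sup>2 * ?y\<^sup>2"
      using power_mono[OF mvec_times_bound[OF F, of \<xi> y y], of 2] by (simp add: power_mult_distrib c_def)
    have "?n\<^sup>2 \<le> (norm w)\<^sup>2 * (l2norm (mvec F \<xi> T))\<^sup>2"
      using power_mono[OF mvec_times_bound[OF F, of \<xi> w T], of 2] by (simp add: power_mult_distrib wT 1)
    \<comment> \<open>The expansion of the squared length of \<open>T \<xi>\<close> has three terms;
      bounding \<open>y * y\<close> applied to \<open>\<xi>\<close> by \<open>c\<close> times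
      \<open>y\<close> applied to \<open>\<xi>\<close> cancels half of the middle one.\<close>
    also have "\<dots> \<le> (norm w)\<^sup>2 * (c\<^sup>2 * (c\<^sup>2 * ?n\<^sup>2 - ?y\<^sup>2))"
      using yy T2 by (intro mult_left_mono) (auto simp: algebra_simps power4_eq_xxxx power2_eq_square)
    finally have "?n\<^sup>2 / ((norm w)\<^sup>2 * c\<^sup>2) \<le> c\<^sup>2 * ?n\<^sup>2 - ?y\<^sup>2"
      using c W by (simp add: divide_simps mult_ac)
    thus ?thesis by (simp add: algebra_simps)
  qed
  \<comment> \<open>Applying \<open>w\<close> bounds every vector by \<open>norm w\<close> times its
    image under \<open>T\<close>. So \<open>y\<close> multiplies squared lengths by at most
    \<open>d\<close>, which is below the square of its own norm. The maximum with 0 covers negative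
    \<open>d\<close>.\<close>
  define d where "d = c\<^sup>2 - 1 / ((norm w)\<^sup>2 * c\<^sup>2)"
  have d: "d < c\<^sup>2" using c W by (simp add: d_def)
  have "norm y \<le> sqrt (max d 0)"
  proof (rule norm_bmat_leI_mvec)
    fix F \<xi> assume F: "finite (F :: 'a set)"
    have "(l2norm (mvec F \<xi> y))\<^sup>2 \<le> d * (L2_set (\<lambda>i. cmod (\<xi> i)) F)\<^sup>2" using key[OF F] by (simp add: d_def)
    also have "\<dots> \<le> max d 0 * (L2_set (\<lambda>i. cmod (\<xi> i)) F)\<^sup>2" by (intro mult_right_mono) auto
    also have "\<dots> = (sqrt (max d 0) * L2_set (\<lambda>i. cmod (\<xi> i)) F)\<^sup>2" by (simp add: power_mult_distrib)
    finally show "l2norm (mvec F \<xi> y) \<le> sqrt (max d 0) * L2_set (\<lambda>i. cmod (\<xi> i)) F"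
      by (rule power2_le_imp_le) simp
  qed simp
  also have "\<dots> < c" using d c by (intro real_less_lsqrt) auto
  finally show False by (simp add: c_def)
qed

section \<open>Invertibility and the spectrum\<close>

definition invertible_bmat :: "'i bmat \<Rightarrow> bool" where
  "invertible_bmat x \<longleftrightarrow> (\<exists>w. w * x = 1 \<and> x * w = 1)"

lemma invertible_bmatI: "w * x = 1 \<Longrightarrow> x * w = 1 \<Longrightarrow> invertible_bmat x"
  by (auto simp: invertible_bmat_def)

lemma invertible_bmat_mult:
  assumes "invertible_bmat x" and "invertible_bmat y"
  shows "invertible_bmat (x * y)"
proof -
  obtain v w where v: "v * x = 1" "x * v = 1" and w: "w * y = 1" "y * w = 1"
    using assms by (auto simp: invertible_bmat_def)
  have "w * v * (x * y) = w * (v * x) * y" by (simp only: mult.assoc)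
  moreover have "x * y * (w * v) = x * (y * w) * v" by (simp only: mult.assoc)
  ultimately show ?thesis using v w by (intro invertible_bmatI[of "w * v"]) simp_all
qed

definition bspec :: "'i bmat \<Rightarrow> complex set" where
  "bspec x = {z. \<not> invertible_bmat (cs z 1 - x)}"

lemma invertible_one_minus:
  fixes x :: "'i bmat"
  assumes "norm x < 1"
  shows "invertible_bmat (1 - x)"
proof -
  define w where "w = (\<Sum>n. x ^ n)"
  have s: "summable (\<lambda>n. x ^ n)" by (rule complete_algebra_summable_geometric[OF assms])
  have w: "w = 1 + (\<Sum>n. x ^ Suc n)" unfolding w_def using suminf_split_head[OF s] by simp
  have "(\<Sum>n. x ^ Suc n) = x * w" unfolding w_def using suminf_mult[OF s, of x] by simp
  moreover have "(\<Sum>n. x ^ Suc n) = w * x"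
    unfolding w_def using suminf_mult2[OF s, of x] by (simp add: power_commutes)
  ultimately show ?thesis using w by (intro invertible_bmatI[of w]) (simp_all add: algebra_simps)
qed

lemma bspec_bounded:
  assumes "z \<in> bspec x"
  shows "cmod z \<le> norm x"
proof (rule ccontr)
  assume "\<not> cmod z \<le> norm x"
  hence z: "cmod z > norm x" by simp
  hence z0: "z \<noteq> 0" using norm_ge_zero[of x] by (auto simp del: norm_ge_zero)
  have "norm (cs (inverse z) x) < 1" unfolding norm_cs norm_inverse using z z0
    by (simp add: field_simps)
  from invertible_one_minus[OF this] obtain w where
    w: "w * (1 - cs (inverse z) x) = 1" "(1 - cs (inverse z) x) * w = 1"
    by (auto simp: invertible_bmat_def)
  have eq: "cs z 1 - x = cs z (1 - cs (inverse z) x)"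
    using z0 by (intro bmat_eqI) (simp add: minus_bmat.rep_eq cs.rep_eq algebra_simps)
  have "invertible_bmat (cs z 1 - x)"
    by (rule invertible_bmatI[of "cs (inverse z) w"])
      (use z0 w in \<open>simp_all add: eq cs_mult_left cs_mult_right cs_cs\<close>)
  thus False using assms by (simp add: bspec_def)
qed

text \<open>Arens's trick: adding \<open>\<i> * t\<close> to \<open>x\<close> shifts the spectrum by
  the same amount, while by the C*-identity the squared norm grows by at most the square of
  \<open>t\<close>. A nonzero imaginary part would contribute the linear term
  \<open>2 * Im z * t\<close>; the chosen \<open>t\<close> makes it exceed the squared norm of
  \<open>x\<close> by 1.\<close>

lemma bspec_real:
  fixes x :: "'i bmat"
  assumes x: "adj x = x" and z: "z \<in> bspec x"
  shows "Im z = 0"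
proof (rule ccontr)
  assume b: "Im z \<noteq> 0"
  define t where "t = ((norm x)\<^sup>2 + 1) / (2 * Im z)"
  define u :: "'i bmat" where "u = cs (\<i> * complex_of_real t) 1"
  have "cs (z + \<i> * complex_of_real t) 1 = cs z 1 + u"
    by (simp add: u_def cs_add_left)
  hence eq: "cs (z + \<i> * complex_of_real t) 1 - (x + u) = cs z 1 - x" by simp
  have "z + \<i> * complex_of_real t \<in> bspec (x + u)"
    using z unfolding bspec_def mem_Collect_eq eq .
  hence "(cmod (z + \<i> * complex_of_real t))\<^sup>2 \<le> (norm (x + u))\<^sup>2"
    by (intro power_mono bspec_bounded) auto
  also have "\<dots> = norm (adj (x + u) * (x + u))" by (rule norm_adj_times[symmetric])
  also have "adj (x + u) * (x + u) = x * x + cs (complex_of_real (t\<^sup>2)) 1"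
  proof -
    have a: "adj (x + u) = x - u"
      unfolding u_def adj_add x adj_cs adj_1
      by (intro bmat_eqI) (simp add: minus_bmat.rep_eq plus_bmat.rep_eq cs.rep_eq)
    show ?thesis unfolding a unfolding u_def
      by (simp add: algebra_simps cs_mult_left cs_mult_right cs_cs)
        (intro bmat_eqI, simp add: plus_bmat.rep_eq minus_bmat.rep_eq cs.rep_eq power2_eq_square algebra_simps)
  qed
  also have "norm (x * x + cs (complex_of_real (t\<^sup>2)) 1) \<le> (norm x)\<^sup>2 + t\<^sup>2"
  proof -
    have "norm (cs (complex_of_real (t\<^sup>2)) (1 :: 'i bmat)) = t\<^sup>2"
      unfolding norm_cs norm_of_real by simp
    thus ?thesis
      using norm_triangle_ineq[of "x * x" "cs (complex_of_real (t\<^sup>2)) 1"] norm_mult_ineq[of x x]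
      unfolding power2_eq_square[of "norm x"] by linarith
  qed
  finally have "(Re z)\<^sup>2 + (Im z + t)\<^sup>2 \<le> (norm x)\<^sup>2 + t\<^sup>2" by (simp add: cmod_power2)
  hence "2 * Im z * t \<le> (norm x)\<^sup>2" using zero_le_power2[of "Re z"] zero_le_power2[of "Im z"]
    unfolding power2_sum by linarith
  moreover have "2 * Im z * t = (norm x)\<^sup>2 + 1" using b by (simp add: t_def)
  ultimately show False by simp
qed

section \<open>Polynomials in a matrix and the spectral bound on their norm\<close>

definition pev :: "complex poly \<Rightarrow> 'i bmat \<Rightarrow> 'i bmat" where
  "pev Q x = (\<Sum>i\<le>Polynomial.degree Q. cs (Polynomial.coeff Q i) (x ^ i))"

lemma pev_pCons: "pev (pCons c Q) x = cs c 1 + x * pev Q x"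
proof (cases "Q = 0")
  case True
  then show ?thesis by (simp add: pev_def)
next
  case False
  then show ?thesis
    by (simp add: pev_def sum.atMost_Suc_shift sum_distrib_left cs_mult_right del: sum.atMost_Suc)
qed

lemma pev_0 [simp]: "pev 0 x = 0"
  by (simp add: pev_def)

lemma pev_const: "pev [:c:] x = cs c 1"
  by (simp add: pev_pCons)

lemma pev_add: "pev (P + Q) x = pev P x + pev Q x"
  by (induction P Q rule: poly_induct2) (simp_all add: pev_pCons cs_add_left algebra_simps)

lemma pev_smult: "pev (Polynomial.smult c P) x = cs c (pev P x)"
  by (induction P) (simp_all add: pev_pCons cs_add_right cs_mult_right cs_cs bmat_eqI cs.rep_eq zero_bmat.rep_eq)

lemma pev_mult: "pev (P * Q) x = pev P x * pev Q x"
  by (induction P) (simp_all add: pev_pCons pev_add pev_smult cs_mult_left algebra_simps)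

lemma pev_diff: "pev (P - Q) x = pev P x - pev Q x"
  using pev_add[of "P - Q" Q x] by (simp add: algebra_simps)

lemma pev_commute: "x * pev Q x = pev Q x * x"
proof -
  have "pev [:0, 1:] x = x" by (simp add: pev_pCons)
  thus ?thesis using pev_mult[of "[:0, 1:]" Q x] pev_mult[of Q "[:0, 1:]" x] by (simp add: mult.commute)
qed

lemma adj_pev:
  assumes "adj x = x"
  shows "adj (pev Q x) = pev (map_poly cnj Q) x"
  by (induction Q) (simp_all add: pev_pCons adj_add adj_cs adj_times assms pev_commute map_poly_pCons)

lemma poly_map_poly_cnj: "poly (map_poly cnj Q) (complex_of_real t) = cnj (poly Q (complex_of_real t))"
  by (induction Q) (simp_all add: map_poly_pCons)

text \<open>One half of the spectral mapping theorem: over the complex numbers \<open>P\<close>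
  splits into linear factors, and if no root lay in the spectrum, every factor would be invertible
  and so would be the product.\<close>

lemma pev_not_invertible_root:
  assumes "P \<noteq> 0" and "\<not> invertible_bmat (pev P x)"
  shows "\<exists>z\<in>bspec x. poly P z = 0"
  using assms
proof (induction "Polynomial.degree P" arbitrary: P rule: less_induct)
  case less
  show ?case
  proof (cases "Polynomial.degree P = 0")
    case True
    then obtain c where c: "P = [:c:]" by (rule degree_eq_zeroE)
    with less.prems(1) have "c \<noteq> 0" by simp
    hence "invertible_bmat (pev P x)"
      by (intro invertible_bmatI[of "cs (inverse c) 1"]) (simp_all add: c pev_const cs_mult_left cs_cs)
    thus ?thesis using less.prems by simp
  next
    case False
    then obtain z where z: "poly P z = 0"
      using fundamental_theorem_of_algebra[of P] by (auto simp: constant_degree)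
    then obtain P' where P': "P = [:- z, 1:] * P'" by (metis dvdE poly_eq_0_iff_dvd)
    have P0: "P' \<noteq> 0" using less.prems(1) P' by auto
    have d: "Polynomial.degree P' < Polynomial.degree P" using P0 unfolding P' by (subst Polynomial.degree_mult_eq) auto
    show ?thesis
    proof (cases "z \<in> bspec x")
      case True
      thus ?thesis using z by blast
    next
      case False
      hence "invertible_bmat (cs z 1 - x)" by (simp add: bspec_def)
      then obtain w where "w * (cs z 1 - x) = 1" "(cs z 1 - x) * w = 1" by (auto simp: invertible_bmat_def)
      hence i: "invertible_bmat (x - cs z 1)"
        by (intro invertible_bmatI[of "- w"]) (simp_all add: algebra_simps)
      have "pev [:- z, 1:] x = x - cs z 1"
        by (simp add: pev_pCons cs_uminus_left)
      hence "pev P x = (x - cs z 1) * pev P' x" unfolding P' pev_mult by simp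
      hence "\<not> invertible_bmat (pev P' x)" using invertible_bmat_mult[OF i] less.prems(2) by auto
      from less.hyps[OF d P0 this] show ?thesis unfolding P' by auto
    qed
  qed
qed

text \<open>No resolvent is involved: the square of \<open>norm x\<close> minus \<open>x * x\<close>
  is not invertible, so \<open>norm x\<close> or \<open>- norm x\<close> belongs to the
  spectrum.\<close>

lemma bspec_nonempty:
  assumes "adj x = x"
  shows "bspec x \<noteq> {}"
proof -
  let ?P = "[:complex_of_real ((norm x)\<^sup>2), 0, - 1:]"
  have "pev ?P x = cs (complex_of_real ((norm x)\<^sup>2)) 1 - x * x"
    by (simp add: pev_pCons) (intro bmat_eqI,
        simp add: plus_bmat.rep_eq minus_bmat.rep_eq uminus_bmat.rep_eq cs_mult_right cs.rep_eq)
  hence "\<not> invertible_bmat (pev ?P x)"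
    using norm_square_minus_square_not_invertible[OF assms] by (auto simp: invertible_bmat_def)
  thus ?thesis using pev_not_invertible_root[of ?P x] by auto
qed

text \<open>The norm is attained at a spectral point. With
  \<open>y = adj (pev Q x) * pev Q x\<close>, the squared norm of \<open>y\<close> minus
  \<open>y * y\<close> is a non-invertible polynomial in \<open>x\<close>, hence vanishes at some
  \<open>z\<close> of the spectrum. There the squared modulus of \<open>poly Q z\<close> equals
  \<open>norm y\<close>, which is the squared norm of \<open>pev Q x\<close>.\<close>

lemma norm_pev_le:
  assumes x: "adj x = x" and B: "\<And>t. complex_of_real t \<in> bspec x \<Longrightarrow> cmod (poly Q (complex_of_real t)) \<le> B"
  shows "norm (pev Q x) \<le> B"
proof -
  define R where "R = map_poly cnj Q * Q"
  define y where "y = pev R x"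
  have y: "y = adj (pev Q x) * pev Q x" by (simp add: y_def R_def pev_mult adj_pev[OF x])
  hence sa: "adj y = y" by (simp add: adj_times)
  have ny: "norm y = (norm (pev Q x))\<^sup>2" by (simp add: y norm_adj_times)
  define P where "P = [:complex_of_real ((norm y)\<^sup>2):] - R * R"
  have "pev P x = cs (complex_of_real ((norm y)\<^sup>2)) 1 - y * y"
    by (simp add: P_def pev_diff pev_mult pev_const y_def)
  hence ni: "\<not> invertible_bmat (pev P x)"
    using norm_square_minus_square_not_invertible[OF sa] by (auto simp: invertible_bmat_def)
  \<comment> \<open>If \<open>P\<close> is the zero polynomial, any spectral point is a root, so it
    is enough that the spectrum is nonempty.\<close>
  obtain z where z: "z \<in> bspec x" "poly P z = 0"
    using pev_not_invertible_root[OF _ ni] bspec_nonempty[OF x] by (cases "P = 0") auto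
  define t where "t = Re z"
  have zt: "z = complex_of_real t" using bspec_real[OF x z(1)] by (simp add: t_def complex_eq_iff)
  have "poly R z = complex_of_real ((cmod (poly Q z))\<^sup>2)"
    unfolding R_def poly_mult zt poly_map_poly_cnj complex_norm_square by (rule mult.commute)
  moreover have "poly R z * poly R z = complex_of_real ((norm y)\<^sup>2)" using z(2) by (simp add: P_def)
  ultimately have "complex_of_real ((norm y)\<^sup>2) = complex_of_real (((cmod (poly Q z))\<^sup>2)\<^sup>2)"
    by (simp add: power2_eq_square)
  hence "(norm y)\<^sup>2 = ((cmod (poly Q z))\<^sup>2)\<^sup>2" by (simp only: of_real_eq_iff)
  hence "norm y = (cmod (poly Q z))\<^sup>2" by (subst (asm) power2_eq_iff_nonneg) auto
  hence "norm (pev Q x) = cmod (poly Q z)" unfolding ny by (simp add: power2_eq_iff_nonneg)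
  thus ?thesis using B[of t] z(1) zt by simp
qed

section \<open>The absolute value of a self-adjoint matrix\<close>

lemma poly_map_poly_of_real:
  "poly (map_poly complex_of_real P) (complex_of_real t) = complex_of_real (poly P t)"
  by (induction P) (simp_all add: map_poly_pCons)

lemma Weierstrass_poly:
  fixes f :: "real \<Rightarrow> real"
  assumes "continuous_on {a..b} f" and "e > 0"
  obtains P :: "real poly" where "\<And>t. t \<in> {a..b} \<Longrightarrow> \<bar>poly P t - f t\<bar> < e"
proof -
  obtain g where g: "real_polynomial_function g" and gf: "\<And>x. x \<in> {a..b} \<Longrightarrow> \<bar>f x - g x\<bar> < e"
    using Stone_Weierstrass_real_polynomial_function[OF _ assms] by auto
  obtain c n where c: "g = (\<lambda>x. \<Sum>i\<le>n. c i * x ^ i)"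
    using g real_polynomial_function_iff_sum by blast
  define P where "P = (\<Sum>i\<le>n. Polynomial.monom (c i) i)"
  have "poly P t = g t" for t by (simp add: P_def c poly_sum poly_monom)
  thus ?thesis using that[of P] gf by (metis abs_minus_commute)
qed

section \<open>Commutants\<close>

definition commutant :: "'i bmat set \<Rightarrow> 'i bmat set" where
  "commutant R = {X. \<forall>Y\<in>R. X * Y = Y * X}"

lemma commutant_add: "X \<in> commutant R \<Longrightarrow> Y \<in> commutant R \<Longrightarrow> X + Y \<in> commutant R"
  by (simp add: commutant_def algebra_simps)

lemma commutant_minus: "X \<in> commutant R \<Longrightarrow> Y \<in> commutant R \<Longrightarrow> X - Y \<in> commutant R"
  by (simp add: commutant_def algebra_simps)

lemma commutant_uminus: "X \<in> commutant R \<Longrightarrow> - X \<in> commutant R"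
  by (simp add: commutant_def)

lemma commutant_times:
  assumes "X \<in> commutant R" and "Y \<in> commutant R"
  shows "X * Y \<in> commutant R"
  using assms unfolding commutant_def by (auto simp: mult.assoc) (metis mult.assoc)

lemma commutant_cs: "X \<in> commutant R \<Longrightarrow> cs c X \<in> commutant R"
  by (simp add: commutant_def cs_mult_left cs_mult_right)

lemma commutant_0: "0 \<in> commutant R"
  by (simp add: commutant_def)

lemma commutant_1: "1 \<in> commutant R"
  by (simp add: commutant_def)

lemma commutant_adj:
  assumes "adj ` R \<subseteq> R" and "X \<in> commutant R"
  shows "adj X \<in> commutant R"
  unfolding commutant_def
proof (intro CollectI ballI)
  fix Y assume "Y \<in> R"
  hence "X * adj Y = adj Y * X" using assms by (auto simp: commutant_def)
  from arg_cong[OF this, of adj] show "adj X * Y = Y * adj X" by (simp add: adj_times)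
qed

text \<open>Consequently an element of a commutant has the same spectrum there as among all
  matrices.\<close>

lemma commutant_inverse:
  assumes "X \<in> commutant R" and "W * X = 1" "X * W = 1"
  shows "W \<in> commutant R"
  unfolding commutant_def
proof (intro CollectI ballI)
  fix Y assume "Y \<in> R"
  hence "X * Y = Y * X" using assms(1) by (auto simp: commutant_def)
  have "W * Y = W * Y * (X * W)" using assms by simp
  also have "\<dots> = W * (Y * X) * W" by (simp only: mult.assoc)
  also have "\<dots> = W * (X * Y) * W" using \<open>X * Y = Y * X\<close> by simp
  also have "\<dots> = (W * X) * (Y * W)" by (simp only: mult.assoc)
  finally show "W * Y = Y * W" using assms by simp
qed

lemma commutant_pev: "X \<in> commutant R \<Longrightarrow> pev Q X \<in> commutant R"
  by (induction Q) (simp_all add: pev_pCons commutant_0 commutant_1 commutant_add commutant_cs commutant_times)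

lemma closed_commutant:
  assumes "\<And>n. X n \<in> commutant R" and "X \<longlonglongrightarrow> Y"
  shows "Y \<in> commutant R"
  unfolding commutant_def
proof (intro CollectI ballI)
  fix Z assume Z: "Z \<in> R"
  have "(\<lambda>n. X n * Z) \<longlonglongrightarrow> Y * Z" "(\<lambda>n. Z * X n) \<longlonglongrightarrow> Z * Y" by (intro tendsto_intros assms(2))+
  moreover have "X n * Z = Z * X n" for n using assms(1) Z by (auto simp: commutant_def)
  ultimately show "Y * Z = Z * Y" using LIMSEQ_unique by simp
qed

text \<open>The condition by which \<open>cont_fun_calc\<close> singles out the absolute value,
  expressed for matrices.\<close>

definition is_abs :: "'i bmat \<Rightarrow> 'i bmat \<Rightarrow> bool" where
  "is_abs x y \<longleftrightarrow> (\<forall>Q. uniform_limit (bspec x) (\<lambda>n. poly (Q n)) (\<lambda>z. complex_of_real (cmod z)) sequentially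
     \<longrightarrow> (\<lambda>n. pev (Q n) x) \<longlonglongrightarrow> y)"

lemma continuous_regularized_sign: "\<delta> > 0 \<Longrightarrow> continuous_on S (\<lambda>t::real. t / (\<bar>t\<bar> + \<delta>))"
  by (intro continuous_intros) (smt (verit) abs_ge_zero)

text \<open>The sign function is replaced by the continuous \<open>t / (\<bar>t\<bar> + d)\<close>
  with \<open>d = 1 / Suc n\<close>. It is bounded by 1, and \<open>t\<close> times it misses
  \<open>\<bar>t\<bar>\<close> by at most \<open>d\<close>. Weierstrass approximation to within
  \<open>d\<close> costs another \<open>d\<close> in the bound and \<open>M * d\<close> in the
  error.\<close>

lemma abs_approximation:
  obtains h :: "nat \<Rightarrow> real poly"
  where "\<And>n t. \<bar>t\<bar> \<le> M \<Longrightarrow> \<bar>poly (h n) t\<bar> \<le> 1 + 1 / real (Suc n)"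
    and "\<And>n t. \<bar>t\<bar> \<le> M \<Longrightarrow> \<bar>t * poly (h n) t - \<bar>t\<bar>\<bar> \<le> (M + 1) / real (Suc n)"
proof -
  have "\<exists>P :: real poly. \<forall>t\<in>{-M..M}. \<bar>poly P t - t / (\<bar>t\<bar> + 1 / real (Suc n))\<bar> < 1 / real (Suc n)" for n
    by (rule Weierstrass_poly[OF continuous_regularized_sign, of "1 / real (Suc n)" "1 / real (Suc n)" "-M" M])
      (simp, simp, blast)
  then obtain h :: "nat \<Rightarrow> real poly" where
    h: "\<And>n t. t \<in> {-M..M} \<Longrightarrow> \<bar>poly (h n) t - t / (\<bar>t\<bar> + 1 / real (Suc n))\<bar> < 1 / real (Suc n)"
    by metis
  show ?thesis
  proof (rule that[of h])
    fix n and t :: real assume t: "\<bar>t\<bar> \<le> M"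
    define d where "d = 1 / real (Suc n)"
    define f where "f = t / (\<bar>t\<bar> + d)"
    have d: "d > 0" by (simp add: d_def)
    have hf: "\<bar>poly (h n) t - f\<bar> < d" using h[of t n] t by (auto simp: d_def f_def abs_le_iff)
    have f1: "\<bar>f\<bar> \<le> 1" using d unfolding f_def abs_divide by (simp add: pos_divide_le_eq)
    show "\<bar>poly (h n) t\<bar> \<le> 1 + 1 / real (Suc n)" using hf f1 unfolding d_def[symmetric] by linarith
    have "\<bar>t\<bar> - t * f = \<bar>t\<bar> * d / (\<bar>t\<bar> + d)"
    proof -
      have "\<bar>t\<bar> + d \<noteq> 0" using d by linarith
      thus ?thesis by (simp add: f_def field_simps)
    qed
    moreover have "0 \<le> \<bar>t\<bar> * d / (\<bar>t\<bar> + d)" "\<bar>t\<bar> * d / (\<bar>t\<bar> + d) \<le> d"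
      using d by (auto simp: pos_divide_le_eq algebra_simps)
    ultimately have 1: "\<bar>t * f - \<bar>t\<bar>\<bar> \<le> d" by (metis abs_minus_commute abs_of_nonneg)
    have "\<bar>t * poly (h n) t - t * f\<bar> = \<bar>t\<bar> * \<bar>poly (h n) t - f\<bar>"
      by (simp add: abs_mult[symmetric] right_diff_distrib)
    also have "\<dots> \<le> M * d" using t hf by (intro mult_mono) auto
    finally have "\<bar>t * poly (h n) t - \<bar>t\<bar>\<bar> \<le> M * d + d"
      using 1 abs_triangle_ineq[of "t * poly (h n) t - t * f" "t * f - \<bar>t\<bar>"] by simp
    thus "\<bar>t * poly (h n) t - \<bar>t\<bar>\<bar> \<le> (M + 1) / real (Suc n)" by (simp add: d_def field_simps)
  qed
qed

text \<open>Besides existence and uniqueness this provides a substitute for the polar decomposition: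
  the absolute value is a limit of products of \<open>x\<close> with polynomials in \<open>x\<close>
  whose norms are asymptotically at most 1. No partial isometry is needed.\<close>

lemma abs_bmat_exists:
  fixes x :: "'i bmat"
  assumes x: "adj x = x"
  obtains h y where "is_abs x y" and "(\<lambda>n. x * pev (h n) x) \<longlonglongrightarrow> y"
    and "\<And>n. norm (pev (h n) x) \<le> 1 + 1 / real (Suc n)"
    and "\<And>z. is_abs x z \<Longrightarrow> z = y"
proof -
  define M where "M = norm x"
  obtain g :: "nat \<Rightarrow> real poly" where
    g1: "\<And>n t. \<bar>t\<bar> \<le> M \<Longrightarrow> \<bar>poly (g n) t\<bar> \<le> 1 + 1 / real (Suc n)" and
    g2: "\<And>n t. \<bar>t\<bar> \<le> M \<Longrightarrow> \<bar>t * poly (g n) t - \<bar>t\<bar>\<bar> \<le> (M + 1) / real (Suc n)"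
    using abs_approximation by blast
  define h where "h n = map_poly complex_of_real (g n)" for n
  define P where "P n = [:0, 1:] * h n" for n
  have bM: "\<bar>t\<bar> \<le> M" if "complex_of_real t \<in> bspec x" for t
    using bspec_bounded[OF that] by (simp add: M_def)
  have sR: "z \<in> bspec x \<Longrightarrow> \<exists>t. z = complex_of_real t" for z
    using bspec_real[OF x] by (metis complex_eq_iff Re_complex_of_real Im_complex_of_real)
  have pevP: "pev (P n) x = x * pev (h n) x" for n by (simp add: P_def pev_mult pev_pCons)
  have Pt: "poly (P n) (complex_of_real t) = complex_of_real (t * poly (g n) t)" for n t
    by (simp add: P_def h_def poly_map_poly_of_real)
  have nh: "norm (pev (h n) x) \<le> 1 + 1 / real (Suc n)" for n
  proof (rule norm_pev_le[OF x])
    fix t assume "complex_of_real t \<in> bspec x"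
    from g1[OF bM[OF this], of n] show "cmod (poly (h n) (complex_of_real t)) \<le> 1 + 1 / real (Suc n)"
      unfolding h_def poly_map_poly_of_real norm_of_real .
  qed
  have uP: "uniform_limit (bspec x) (\<lambda>n. poly (P n)) (\<lambda>z. complex_of_real (cmod z)) sequentially"
  proof (rule uniform_limitI)
    fix e :: real assume e: "e > 0"
    have "(\<lambda>n. (M + 1) / real (Suc n)) \<longlonglongrightarrow> 0" by real_asymp
    hence "\<forall>\<^sub>F n in sequentially. (M + 1) / real (Suc n) < e" using e by (rule order_tendstoD(2))
    thus "\<forall>\<^sub>F n in sequentially. \<forall>z\<in>bspec x. dist (poly (P n) z) (complex_of_real (cmod z)) < e"
    proof eventually_elim
      case (elim n)
      show ?case
      proof
        fix z assume z: "z \<in> bspec x"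
        then obtain t where t: "z = complex_of_real t" using sR by blast
        have "dist (poly (P n) z) (complex_of_real (cmod z)) = \<bar>t * poly (g n) t - \<bar>t\<bar>\<bar>"
          unfolding t Pt norm_of_real dist_of_real by (simp add: dist_real_def)
        also have "\<dots> \<le> (M + 1) / real (Suc n)" using g2 bM z t by blast
        finally show "dist (poly (P n) z) (complex_of_real (cmod z)) < e" using elim by simp
      qed
    qed
  qed
  \<comment> \<open>By the spectral bound any two approximating sequences give asymptotically equal
    matrices, so the limit found for \<open>P\<close> serves every sequence.\<close>
  have close: "(\<lambda>n. pev (Q n) x - pev (Q' n) x) \<longlonglongrightarrow> 0"
    if "uniform_limit (bspec x) (\<lambda>n. poly (Q n)) (\<lambda>z. complex_of_real (cmod z)) sequentially"
      "uniform_limit (bspec x) (\<lambda>n. poly (Q' n)) (\<lambda>z. complex_of_real (cmod z)) sequentially" for Q Q'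
  proof (rule LIMSEQ_I)
    fix e :: real assume e: "e > 0"
    have "uniform_limit (bspec x) (\<lambda>n z. poly (Q n) z - poly (Q' n) z) (\<lambda>z. complex_of_real (cmod z) - complex_of_real (cmod z)) sequentially"
      by (intro uniform_limit_intros that)
    hence "\<forall>\<^sub>F n in sequentially. \<forall>z\<in>bspec x. dist (poly (Q n) z - poly (Q' n) z)
        (complex_of_real (cmod z) - complex_of_real (cmod z)) < e / 2"
      using e by (intro uniform_limitD) auto
    then obtain N where
      N: "\<And>n z. n \<ge> N \<Longrightarrow> z \<in> bspec x \<Longrightarrow> cmod (poly (Q n) z - poly (Q' n) z) < e / 2"
      unfolding eventually_sequentially by (auto simp: dist_norm)
    have "norm (pev (Q n) x - pev (Q' n) x - 0) < e" if "n \<ge> N" for n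
    proof -
      have "norm (pev (Q n - Q' n) x) \<le> e / 2"
        by (rule norm_pev_le[OF x]) (use N[OF that] in \<open>simp add: less_imp_le\<close>)
      thus ?thesis using e by (simp add: pev_diff)
    qed
    thus "\<exists>N. \<forall>n\<ge>N. norm (pev (Q n) x - pev (Q' n) x - 0) < e" by blast
  qed
  have "Cauchy (\<lambda>n. pev (P n) x)"
  proof (rule metric_CauchyI)
    fix e :: real assume e: "e > 0"
    have "\<forall>\<^sub>F n in sequentially. \<forall>z\<in>bspec x. dist (poly (P n) z) (complex_of_real (cmod z)) < e / 4"
      using e by (intro uniform_limitD[OF uP]) auto
    then obtain N where
      N: "\<And>n z. n \<ge> N \<Longrightarrow> z \<in> bspec x \<Longrightarrow> dist (poly (P n) z) (complex_of_real (cmod z)) < e / 4"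
      unfolding eventually_sequentially by blast
    have "dist (pev (P m) x) (pev (P n) x) < e" if "m \<ge> N" "n \<ge> N" for m n
    proof -
      have "norm (pev (P m - P n) x) \<le> e / 2"
      proof (rule norm_pev_le[OF x])
        fix t assume t: "complex_of_real t \<in> bspec x"
        show "cmod (poly (P m - P n) (complex_of_real t)) \<le> e / 2"
          using dist_triangle2[of "poly (P m) (complex_of_real t)" "poly (P n) (complex_of_real t)"
              "complex_of_real (cmod (complex_of_real t))"]
            N[OF that(1) t] N[OF that(2) t] unfolding poly_diff dist_norm by linarith
      qed
      thus ?thesis using e by (simp add: pev_diff dist_norm)
    qed
    thus "\<exists>N. \<forall>m\<ge>N. \<forall>n\<ge>N. dist (pev (P m) x) (pev (P n) x) < e" by blast
  qed
  then obtain y where y: "(\<lambda>n. pev (P n) x) \<longlonglongrightarrow> y"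
    using Cauchy_convergent convergent_def by blast
  show ?thesis
  proof (rule that)
    show "is_abs x y" unfolding is_abs_def
    proof (intro allI impI)
      fix Q assume "uniform_limit (bspec x) (\<lambda>n. poly (Q n)) (\<lambda>z. complex_of_real (cmod z)) sequentially"
      from tendsto_add[OF close[OF this uP] y] show "(\<lambda>n. pev (Q n) x) \<longlonglongrightarrow> y" by simp
    qed
    show "(\<lambda>n. x * pev (h n) x) \<longlonglongrightarrow> y" using y by (simp add: pevP)
    show "norm (pev (h n) x) \<le> 1 + 1 / real (Suc n)" for n by (rule nh)
    show "z = y" if "is_abs x z" for z
      using that uP y LIMSEQ_unique unfolding is_abs_def by blast
  qed
qed

text \<open>The triangle inequality for the \<open>L\<^sup>1\<close>-norm of a trace: \<open>\<bar>x\<bar>\<close> is a limit of \<open>x h(x)\<close> with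
  \<open>\<parallel>h(x)\<parallel> \<rightarrow> 1\<close>, and \<open>\<bar>\<tau>(d h)\<bar> = \<bar>\<tau>(d h d)\<bar> \<le> \<parallel>h\<parallel> \<tau>(d)\<close> for a projection \<open>d\<close>.\<close>

lemma trace_abs_bound:
  fixes x :: "'i bmat"
  assumes F: "finite F" and unit: "L2_set (\<lambda>i. cmod (\<xi> i)) F = 1"
    and trace: "\<And>X Y. X \<in> commutant R \<Longrightarrow> Y \<in> commutant R \<Longrightarrow> vstate F \<xi> (X * Y) = vstate F \<xi> (Y * X)"
    and d: "\<And>k. k \<in> K \<Longrightarrow> d k \<in> commutant R" "\<And>k. k \<in> K \<Longrightarrow> adj (d k) = d k"
      "\<And>k. k \<in> K \<Longrightarrow> d k * d k = d k"
    and \<epsilon>: "\<And>k. k \<in> K \<Longrightarrow> cmod (\<epsilon> k) \<le> 1"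
    and xd: "x = (\<Sum>k\<in>K. cs (\<epsilon> k) (d k))" and x: "adj x = x" and y: "is_abs x y"
  shows "cmod (vstate F \<xi> y) \<le> (\<Sum>k\<in>K. Re (vstate F \<xi> (d k)))"
proof -
  obtain h y' where "is_abs x y'" and y': "(\<lambda>n. x * pev (h n) x) \<longlonglongrightarrow> y'"
    and h: "\<And>n. norm (pev (h n) x) \<le> 1 + 1 / real (Suc n)" and u: "\<And>z. is_abs x z \<Longrightarrow> z = y'"
    by (rule abs_bmat_exists[OF x]) blast
  note lim = y'[folded u[OF y]]
  let ?\<tau> = "vstate F \<xi>" and ?D = "\<Sum>k\<in>K. Re (vstate F \<xi> (d k))"
  have xR: "x \<in> commutant R"
    unfolding xd using d(1)
    by (induction K rule: infinite_finite_induct) (auto simp: commutant_0 intro: commutant_add commutant_cs)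
  have dk: "cmod (?\<tau> (d k * g)) \<le> norm g * Re (?\<tau> (d k))" if k: "k \<in> K" and g: "g \<in> commutant R" for k g
  proof -
    have "?\<tau> (d k * g) = ?\<tau> (d k * (d k * g))" using d(3)[OF k] by (simp add: mult.assoc[symmetric])
    also have "\<dots> = ?\<tau> ((d k * g) * d k)" using d(1)[OF k] g by (intro trace) (auto intro: commutant_times)
    also have "\<dots> = ?\<tau> (adj (d k) * (g * d k))" using d(2)[OF k] by (simp add: mult.assoc)
    also have "cmod \<dots> \<le> l2norm (mvec F \<xi> (d k)) * l2norm (mvec F \<xi> (g * d k))"
      by (rule vstate_adj_times_bound[OF F])
    also have "\<dots> \<le> l2norm (mvec F \<xi> (d k)) * (norm g * l2norm (mvec F \<xi> (d k)))"
      by (intro mult_left_mono mvec_times_bound F) simp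
    also have "\<dots> = norm g * Re (?\<tau> (adj (d k) * d k))"
      unfolding vstate_adj_times_self[OF F] by (simp add: power2_eq_square)
    finally show ?thesis using d(2,3)[OF k] by simp
  qed
  have lin: "?\<tau> (x * g) = (\<Sum>k\<in>K. \<epsilon> k * ?\<tau> (d k * g))" for g
  proof -
    have z: "?\<tau> 0 = 0" using vstate_cs[of F \<xi> 0 0] by simp
    show ?thesis unfolding xd
      by (induction K rule: infinite_finite_induct) (simp_all add: z distrib_right vstate_add cs_mult_left vstate_cs)
  qed
  have D0: "0 \<le> ?D"
  proof (rule sum_nonneg)
    fix k assume k: "k \<in> K"
    have "?\<tau> (d k) = ?\<tau> (adj (d k) * d k)" using d(2,3)[OF k] by simp
    thus "0 \<le> Re (?\<tau> (d k))" unfolding vstate_adj_times_self[OF F] by simp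
  qed
  have bd: "cmod (?\<tau> (x * pev (h n) x)) \<le> (1 + 1 / real (Suc n)) * ?D" for n
  proof -
    have "cmod (?\<tau> (x * pev (h n) x)) \<le> (\<Sum>k\<in>K. cmod (\<epsilon> k * ?\<tau> (d k * pev (h n) x)))"
      unfolding lin by (rule norm_sum)
    also have "\<dots> \<le> (\<Sum>k\<in>K. 1 * (norm (pev (h n) x) * Re (?\<tau> (d k))))"
      unfolding norm_mult by (intro sum_mono mult_mono \<epsilon> dk commutant_pev xR) auto
    also have "\<dots> = norm (pev (h n) x) * ?D" by (simp add: sum_distrib_left)
    also have "\<dots> \<le> (1 + 1 / real (Suc n)) * ?D" by (intro mult_right_mono h D0)
    finally show ?thesis .
  qed
  have "(\<lambda>n. ?\<tau> (x * pev (h n) x)) \<longlonglongrightarrow> ?\<tau> y"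
  proof (rule LIMSEQ_I)
    fix e :: real assume "e > 0"
    then obtain N where "\<And>n. n \<ge> N \<Longrightarrow> norm (x * pev (h n) x - y) < e" using LIMSEQ_D[OF lim] by blast
    moreover have "cmod (?\<tau> u - ?\<tau> v) \<le> norm (u - v)" for u v
      using vstate_bound[OF F, of \<xi> "u - v"] by (simp add: vstate_minus unit)
    ultimately show "\<exists>N. \<forall>n\<ge>N. cmod (?\<tau> (x * pev (h n) x) - ?\<tau> y) < e" by (meson le_less_trans)
  qed
  hence "(\<lambda>n. cmod (?\<tau> (x * pev (h n) x))) \<longlonglongrightarrow> cmod (?\<tau> y)" by (rule tendsto_norm)
  moreover have "(\<lambda>n. (1 + 1 / real (Suc n)) * ?D) \<longlonglongrightarrow> (1 + 0) * ?D"
    by (intro tendsto_intros LIMSEQ_inverse_real_of_nat[unfolded inverse_eq_divide])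
  ultimately show ?thesis using bd by (intro LIMSEQ_le) auto
qed

section \<open>Compactly supported measures and their moments\<close>

lemma compactly_supported_AE_bound:
  assumes "compactly_supported_prob \<mu>"
  obtains K where "K \<ge> 0" and "AE x in \<mu>. \<bar>x\<bar> \<le> K"
proof -
  obtain C where C: "compact C" "emeasure \<mu> (- C) = 0" and s: "sets \<mu> = sets borel"
    using assms by (auto simp: compactly_supported_prob_def)
  obtain K where K: "\<And>x. x \<in> C \<Longrightarrow> norm x \<le> K" using compact_imp_bounded[OF C(1)] by (auto simp: bounded_iff)
  have "- C \<in> sets \<mu>" using compact_imp_closed[OF C(1)] s by auto
  hence "AE x in \<mu>. x \<notin> - C" using C(2) by (intro AE_not_in) (auto simp: null_sets_def)
  hence "AE x in \<mu>. \<bar>x\<bar> \<le> max K 0" by eventually_elim (use K in force)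
  thus ?thesis using that[of "max K 0"] by simp
qed

lemma compactly_supported_real_distribution:
  "compactly_supported_prob \<mu> \<Longrightarrow> real_distribution \<mu>"
  by (auto simp: compactly_supported_prob_def real_distribution_def real_distribution_axioms_def
      dest: sets_eq_imp_space_eq)

lemma (in real_distribution) integrable_bounded_power:
  assumes "AE x in M. \<bar>x\<bar> \<le> K"
  shows "integrable M (\<lambda>x. x ^ k)"
  by (rule integrable_const_bound[of _ "K ^ k"])
    (use assms in \<open>auto simp: power_abs intro!: power_mono elim!: eventually_mono\<close>)

text \<open>The Taylor remainder of the characteristic function is controlled by the
  \<open>n\<close>-th absolute moment, here at most \<open>K ^ n\<close>, so it is dominated by a
  term of an exponential series. Moments therefore determine the characteristic function.\<close>

lemma (in real_distribution) char_moment_limit: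
  assumes K: "K \<ge> 0" "AE x in M. \<bar>x\<bar> \<le> K"
  shows "(\<lambda>n. \<Sum>k\<le>n. ((\<i> * t) ^ k / fact k) * expectation (\<lambda>x. x ^ k)) \<longlonglongrightarrow> char M t"
proof -
  have b: "cmod ((\<Sum>k\<le>n. ((\<i> * t) ^ k / fact k) * expectation (\<lambda>x. x ^ k)) - char M t)
      \<le> 2 * (inverse (fact n) * (\<bar>t\<bar> * K) ^ n)" for n
  proof -
    have "expectation (\<lambda>x. \<bar>x\<bar> ^ n) \<le> expectation (\<lambda>_. K ^ n)"
    proof (rule integral_mono_AE)
      show "integrable M (\<lambda>x. \<bar>x\<bar> ^ n)"
        using integrable_norm[OF integrable_bounded_power[OF K(2), of n]] by (simp add: power_abs)
      show "AE x in M. \<bar>x\<bar> ^ n \<le> K ^ n" using K(2) by eventually_elim (auto intro: power_mono)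
    qed auto
    hence e: "expectation (\<lambda>x. \<bar>x\<bar> ^ n) \<le> K ^ n" using prob_space by simp
    have "cmod ((\<Sum>k\<le>n. ((\<i> * t) ^ k / fact k) * expectation (\<lambda>x. x ^ k)) - char M t)
        \<le> (2 * \<bar>t\<bar> ^ n / fact n) * expectation (\<lambda>x. \<bar>x\<bar> ^ n)"
      by (subst norm_minus_commute) (rule char_approx1[OF integrable_bounded_power[OF K(2)]])
    also have "\<dots> \<le> (2 * \<bar>t\<bar> ^ n / fact n) * K ^ n" by (intro mult_left_mono e) auto
    finally show ?thesis by (simp add: power_mult_distrib field_simps)
  qed
  have lim: "(\<lambda>n. 2 * (inverse (fact n) * (\<bar>t\<bar> * K) ^ n)) \<longlonglongrightarrow> 0"
    by (intro tendsto_mult_right_zero summable_LIMSEQ_zero summable_exp)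
  have "(\<lambda>n. (\<Sum>k\<le>n. ((\<i> * t) ^ k / fact k) * expectation (\<lambda>x. x ^ k)) - char M t) \<longlonglongrightarrow> 0"
    by (rule Lim_null_comparison[OF always_eventually[OF allI[OF b]] lim])
  thus ?thesis by (simp add: LIM_zero_iff)
qed

lemma compactly_supported_moments_unique:
  assumes \<mu>: "compactly_supported_prob \<mu>" and \<nu>: "compactly_supported_prob \<nu>"
    and eq: "\<And>k::nat. (LINT x|\<mu>. x ^ k) = (LINT x|\<nu>. x ^ k)"
  shows "\<mu> = \<nu>"
proof (rule Levy_uniqueness)
  show m: "real_distribution \<mu>" and n: "real_distribution \<nu>"
    using \<mu> \<nu> by (auto intro: compactly_supported_real_distribution)
  obtain K where K: "K \<ge> 0" "AE x in \<mu>. \<bar>x\<bar> \<le> K" using compactly_supported_AE_bound[OF \<mu>] .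
  obtain L where L: "L \<ge> 0" "AE x in \<nu>. \<bar>x\<bar> \<le> L" using compactly_supported_AE_bound[OF \<nu>] .
  show "char \<mu> = char \<nu>"
  proof
    fix t
    show "char \<mu> t = char \<nu> t"
      using real_distribution.char_moment_limit[OF m K, of t] real_distribution.char_moment_limit[OF n L, of t]
      unfolding eq by (rule LIMSEQ_unique)
  qed
qed

section \<open>Polynomial calculus in unital \<open>C\<^sup>*\<close>-algebras\<close>

text \<open>Mixed monomials in a pair, where the flag selects the variable: \<open>False\<close>
  stands for \<open>a\<close>, \<open>True\<close> for \<open>b\<close>. The letters are polynomials
  instead of powers, so that merging two letters or subtracting a constant from one yields a letter
  again.\<close>

fun poly_word :: "('a, 'b) cstar_alg_scheme \<Rightarrow> 'a \<Rightarrow> 'a \<Rightarrow> (bool \<times> complex poly) list \<Rightarrow> 'a" where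
  "poly_word A a b [] = \<one>\<^bsub>A\<^esub>"
| "poly_word A a b ((c, P) # ws) = poly_at A P (if c then b else a) \<otimes>\<^bsub>A\<^esub> poly_word A a b ws"

context unital_cstar_algebra
begin

lemma smult_zero_left [simp]: "x \<in> carrier A \<Longrightarrow> 0 \<odot> x = \<zero>"
proof -
  assume x: "x \<in> carrier A"
  have "0 \<odot> x \<oplus> 0 \<odot> x = 0 \<odot> x" using smult_add_left[OF x, of 0 0] by simp
  thus ?thesis using smult_closed[OF x, of 0] by (metis add.l_cancel_one)
qed

lemma smult_zero_right [simp]: "c \<odot> \<zero> = \<zero>"
proof -
  have "c \<odot> \<zero> \<oplus> c \<odot> \<zero> = c \<odot> \<zero>" using smult_add_right[of \<zero> \<zero> c] by simp
  thus ?thesis using smult_closed[of \<zero> c] by (metis add.l_cancel_one zero_closed)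
qed

lemma smult_minus_one: "x \<in> carrier A \<Longrightarrow> (- 1) \<odot> x = \<ominus> x"
proof -
  assume x: "x \<in> carrier A"
  have "(- 1) \<odot> x \<oplus> x = \<zero>" using smult_add_left[OF x, of "-1" 1] smult_one[OF x] x by simp
  thus ?thesis using minus_equality[of "(- 1) \<odot> x" x] x smult_closed by simp
qed

lemma poly_at_closed [simp, intro]:
  assumes "a \<in> carrier A"
  shows "poly_at A Q a \<in> carrier A"
  unfolding poly_at_def using assms by (intro finsum_closed) (auto intro: smult_closed)

lemma poly_at_0 [simp]: "poly_at A 0 a = \<zero>" if "a \<in> carrier A"
  using that by (simp add: poly_at_def)

lemma smult_one_mult: "x \<in> carrier A \<Longrightarrow> (c \<odot> \<one>) \<otimes> x = c \<odot> x"
  by (simp add: smult_mult_left)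

lemma poly_at_pCons:
  assumes a: "a \<in> carrier A"
  shows "poly_at A (pCons c Q) a = c \<odot> \<one> \<oplus> a \<otimes> poly_at A Q a"
proof (cases "Q = 0")
  case True
  then show ?thesis using a smult_closed[of \<one>] by (simp add: poly_at_def)
next
  case False
  define d where "d = Polynomial.degree Q"
  have c: "a [^] i \<otimes> a = a \<otimes> a [^] i" for i :: nat using nat_pow_Suc2[OF a, of i] by simp
  have "poly_at A (pCons c Q) a
      = (\<Oplus>i\<in>{..Suc d}. Polynomial.coeff (pCons c Q) i \<odot> (a [^] i))"
    using False by (simp add: poly_at_def d_def)
  also have "\<dots> = (\<Oplus>i\<in>{..d}. Polynomial.coeff Q i \<odot> (a [^] Suc i)) \<oplus> c \<odot> \<one>"
    using a smult_closed by (subst finsum_Suc2) auto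
  also have "(\<Oplus>i\<in>{..d}. Polynomial.coeff Q i \<odot> (a [^] Suc i)) =
      (\<Oplus>i\<in>{..d}. a \<otimes> (Polynomial.coeff Q i \<odot> (a [^] i)))"
    using a smult_closed by (intro finsum_cong') (auto simp: smult_mult_right c)
  also have "\<dots> = a \<otimes> poly_at A Q a"
    using a smult_closed unfolding poly_at_def d_def by (subst finsum_rdistr) auto
  finally show ?thesis using a smult_closed[of \<one>] by (simp add: a_comm)
qed

lemma poly_at_add:
  assumes a: "a \<in> carrier A"
  shows "poly_at A (P + Q) a = poly_at A P a \<oplus> poly_at A Q a"
proof (induction P Q rule: poly_induct2)
  case 0
  then show ?case using a by simp
next
  case (pCons c P d Q)
  have "poly_at A (pCons c P + pCons d Q) a
      = (c \<odot> \<one> \<oplus> d \<odot> \<one>) \<oplus> (a \<otimes> poly_at A P a \<oplus> a \<otimes> poly_at A Q a)"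
    using a pCons by (simp add: poly_at_pCons smult_add_left r_distr)
  also have "\<dots> = (c \<odot> \<one> \<oplus> a \<otimes> poly_at A P a) \<oplus> (d \<odot> \<one> \<oplus> a \<otimes> poly_at A Q a)"
    using a smult_closed[of \<one>] by (simp add: a_ac)
  finally show ?case using a by (simp add: poly_at_pCons)
qed

lemma poly_at_smult:
  assumes a: "a \<in> carrier A"
  shows "poly_at A (Polynomial.smult c P) a = c \<odot> poly_at A P a"
proof (induction P)
  case 0
  then show ?case using a by simp
next
  case (pCons d P)
  then show ?case using a smult_closed[of \<one>]
    by (simp add: poly_at_pCons smult_add_right smult_smult smult_mult_right)
qed

lemma poly_at_mult:
  assumes a: "a \<in> carrier A"
  shows "poly_at A (P * Q) a = poly_at A P a \<otimes> poly_at A Q a"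
proof (induction P)
  case 0
  then show ?case using a by simp
next
  case (pCons d P)
  then show ?case using a smult_closed[of \<one>]
    by (simp add: poly_at_pCons poly_at_add poly_at_smult l_distr smult_one_mult m_assoc)
qed

lemma poly_at_1 [simp]: "a \<in> carrier A \<Longrightarrow> poly_at A 1 a = \<one>"
  by (simp add: one_pCons poly_at_pCons smult_one)

lemma poly_at_const: "a \<in> carrier A \<Longrightarrow> poly_at A [:c:] a = c \<odot> \<one>"
  using smult_closed[of \<one>] by (simp add: poly_at_pCons)

lemma poly_at_X: "a \<in> carrier A \<Longrightarrow> poly_at A [:0, 1:] a = a"
  by (simp add: poly_at_pCons smult_one)

lemma poly_at_monom: "a \<in> carrier A \<Longrightarrow> poly_at A (Polynomial.monom 1 k) a = a [^] k"
proof (induction k)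
  case 0
  then show ?case using poly_at_const[of a 1] by (simp add: monom_0 smult_one)
next
  case (Suc k)
  then show ?case using nat_pow_Suc2[of a k] by (simp add: monom_Suc poly_at_pCons)
qed

lemma unital_subalgebra_poly_at:
  assumes B: "unital_subalgebra A B" and a: "a \<in> B"
  shows "poly_at A Q a \<in> B"
proof -
  have s: "subring B A" using B by (simp add: unital_subalgebra_def)
  have ac: "a \<in> carrier A" using subringE(1)[OF s] a by blast
  show ?thesis
  proof (induction Q)
    case 0
    then show ?case using subringE(2)[OF s] ac by simp
  next
    case (pCons c Q)
    have "c \<odot> \<one> \<in> B" using B subringE(3)[OF s] by (auto simp: unital_subalgebra_def)
    thus ?case using pCons subringE(6,7)[OF s] a ac by (simp add: poly_at_pCons)
  qed
qed

lemma generated_algebra_self: "a \<in> generated_algebra A a"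
  using hull_subset[of "{a}" "unital_subalgebra A"] by (simp add: generated_algebra_def)

lemma generated_algebra_minimal:
  "unital_subalgebra A B \<Longrightarrow> a \<in> B \<Longrightarrow> generated_algebra A a \<subseteq> B"
  unfolding generated_algebra_def by (rule hull_minimal) auto

lemma poly_word_closed [simp, intro]:
  assumes "a \<in> carrier A" and "b \<in> carrier A"
  shows "poly_word A a b ws \<in> carrier A"
  using assms by (induction ws) auto

lemma poly_word_append:
  assumes "a \<in> carrier A" and "b \<in> carrier A"
  shows "poly_word A a b (us @ vs) = poly_word A a b us \<otimes> poly_word A a b vs"
  using assms by (induction us) (auto simp: m_assoc)

lemma poly_word_list_mult: "poly_word A a b ws
    = list_mult A (map (\<lambda>j. poly_at A (snd (ws ! j)) (if fst (ws ! j) then b else a)) [0..<length ws])"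
proof -
  have "map (\<lambda>j. poly_at A (snd (ws ! j)) (if fst (ws ! j) then b else a)) [0..<length ws]
     = map (\<lambda>(c, P). poly_at A P (if c then b else a)) ws"
    by (intro nth_equalityI) (auto simp: case_prod_beta)
  moreover have "poly_word A a b ws = list_mult A (map (\<lambda>(c, P). poly_at A P (if c then b else a)) ws)"
    by (induction ws) (auto simp: list_mult_def)
  ultimately show ?thesis by simp
qed

end

section \<open>Uniqueness of convolutions\<close>

context unital_cstar_algebra
begin

lemma poly_word_merge:
  assumes "a \<in> carrier A" and "b \<in> carrier A"
  shows "poly_word A a b (us @ (c, P) # (c, Q) # vs) = poly_word A a b (us @ (c, P * Q) # vs)"
  using assms by (simp add: poly_word_append poly_at_mult m_assoc)

text \<open>When \<open>t\<close> is the mean of the letter, this centers the letter at the cost of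
  a shorter word.\<close>

lemma poly_word_split:
  assumes a: "a \<in> carrier A" and b: "b \<in> carrier A"
  shows "poly_word A a b (us @ (c, P) # vs)
    = poly_word A a b (us @ (c, P - [:t:]) # vs) \<oplus> t \<odot> poly_word A a b (us @ vs)"
proof -
  define x where "x = (if c then b else a)"
  have x: "x \<in> carrier A" using a b by (simp add: x_def)
  note cl = smult_closed[OF one_closed] smult_closed[OF poly_word_closed[OF a b]]
  have "poly_at A P x = poly_at A (P - [:t:]) x \<oplus> t \<odot> \<one>"
    using poly_at_add[OF x, of "P - [:t:]" "[:t:]"] poly_at_const[OF x] by simp
  hence "poly_word A a b ((c, P) # vs)
    = poly_at A (P - [:t:]) x \<otimes> poly_word A a b vs \<oplus> t \<odot> poly_word A a b vs"
    using a b x cl by (simp add: x_def[symmetric] l_distr smult_one_mult)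
  thus ?thesis
    using a b x cl by (simp add: poly_word_append x_def[symmetric] r_distr smult_mult_right del: poly_word.simps)
      (simp add: x_def)
qed

end

context nc_prob_space
begin

lemma poly_at_in_generated_algebra:
  assumes "unital_subalgebra A (generated_algebra A a)"
  shows "poly_at A P a \<in> generated_algebra A a"
  by (rule unital_subalgebra_poly_at[OF assms generated_algebra_self])

text \<open>Freeness is assumed in expanded form, because \<open>freely_independent\<close> is typed
  for \<open>cstar_alg\<close> without extension fields, whereas the locale allows an arbitrary
  record scheme.\<close>

lemma free_poly_word_zero:
  assumes a: "a \<in> carrier A" and b: "b \<in> carrier A"
    and free: "\<And>Bs. Bs = [generated_algebra A a, generated_algebra A b] \<Longrightarrow>
       (\<forall>B\<in>set Bs. unital_subalgebra A B) \<and>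
       (\<forall>m\<ge>1. \<forall>(i :: nat \<Rightarrow> nat) x.
        (\<forall>j<m. i j < length Bs \<and> x j \<in> Bs ! i j \<and> \<tau> (x j) = 0) \<and>
        (\<forall>j. Suc j < m \<longrightarrow> i j \<noteq> i (Suc j)) \<longrightarrow>
        \<tau> (list_mult A (map x [0..<m])) = 0)"
    and ne: "ws \<noteq> []"
    and centered: "\<And>c P. (c, P) \<in> set ws \<Longrightarrow> \<tau> (poly_at A P (if c then b else a)) = 0"
    and alternating: "\<And>j. Suc j < length ws \<Longrightarrow> fst (ws ! j) \<noteq> fst (ws ! Suc j)"
  shows "\<tau> (poly_word A a b ws) = 0"
proof -
  let ?Bs = "[generated_algebra A a, generated_algebra A b]"
  let ?x = "\<lambda>j. poly_at A (snd (ws ! j)) (if fst (ws ! j) then b else a)"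
  let ?i = "\<lambda>j. if fst (ws ! j) then 1 else 0 :: nat"
  note F = free[OF refl]
  have u: "unital_subalgebra A (generated_algebra A a)" "unital_subalgebra A (generated_algebra A b)"
    using F by auto
  have 1: "\<forall>j<length ws. ?i j < length ?Bs \<and> ?x j \<in> ?Bs ! ?i j \<and> \<tau> (?x j) = 0"
  proof (intro allI impI)
    fix j assume j: "j < length ws"
    have "(fst (ws ! j), snd (ws ! j)) \<in> set ws" using j by simp
    from centered[OF this] show "?i j < length ?Bs \<and> ?x j \<in> ?Bs ! ?i j \<and> \<tau> (?x j) = 0"
      using u by (auto intro: poly_at_in_generated_algebra)
  qed
  have 2: "\<forall>j. Suc j < length ws \<longrightarrow> ?i j \<noteq> ?i (Suc j)" using alternating by auto
  have "1 \<le> length ws" using ne by (cases ws) auto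
  from conjunct2[OF F, THEN spec, THEN mp, OF this, THEN spec[of _ ?i], THEN spec[of _ ?x], THEN mp, OF conjI[OF 1 2]]
  have "\<tau> (list_mult A (map ?x [0..<length ws])) = 0" .
  thus ?thesis by (simp add: poly_word_list_mult)
qed

end

lemma not_alternating_split:
  assumes "Suc j < length ws" and "fst (ws ! j) = fst (ws ! Suc j)"
  obtains us c P Q vs where "ws = us @ (c, P) # (c, Q) # vs"
proof -
  have "ws = take j ws @ ws ! j # ws ! Suc j # drop (Suc (Suc j)) ws"
    using assms(1) by (metis Cons_nth_drop_Suc Suc_lessD append_take_drop_id)
  moreover have "ws ! j = (fst (ws ! j), snd (ws ! j))" "ws ! Suc j = (fst (ws ! j), snd (ws ! Suc j))"
    using assms(2) by (simp_all add: prod_eq_iff)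
  ultimately show ?thesis using that by metis
qed

text \<open>Freeness determines mixed moments, by induction on the length of the word and, for fixed
  length, on the number of letters with nonzero mean. Adjacent letters of one variable are merged; a
  letter with nonzero mean is centered, which leaves a better word of the same length and a shorter
  one; a word that allows neither is alternating and centered, so both moments vanish.\<close>

lemma free_poly_word_moments:
  fixes A :: "'u cstar_alg" and B :: "'u cstar_alg"
  assumes A: "nc_prob_space A \<tau>" and B: "nc_prob_space B \<sigma>"
    and a: "a \<in> carrier A" "b \<in> carrier A" and c: "c \<in> carrier B" "d \<in> carrier B"
    and fA: "freely_independent A \<tau> [generated_algebra A a, generated_algebra A b]"
    and fB: "freely_independent B \<sigma> [generated_algebra B c, generated_algebra B d]"
    and m1: "\<And>Q. \<tau> (poly_at A Q a) = \<sigma> (poly_at B Q c)"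
    and m2: "\<And>Q. \<tau> (poly_at A Q b) = \<sigma> (poly_at B Q d)"
  shows "\<tau> (poly_word A a b ws) = \<sigma> (poly_word B c d ws)"
proof -
  interpret A: nc_prob_space A \<tau> by fact
  interpret B: nc_prob_space B \<sigma> by fact
  define t where "t w = \<tau> (poly_at A (snd w) (if fst w then b else a))" for w :: "bool \<times> complex poly"
  have tB: "t w = \<sigma> (poly_at B (snd w) (if fst w then d else c))" for w
    using m1 m2 by (simp add: t_def)
  have "\<forall>ws. length ws = n \<longrightarrow> \<tau> (poly_word A a b ws) = \<sigma> (poly_word B c d ws)" for n
  proof (induction n rule: less_induct)
    case (less n)
    have short: "\<tau> (poly_word A a b ws) = \<sigma> (poly_word B c d ws)" if "length ws < n" for ws
      using less that by blast
    have "\<forall>ws. length ws = n \<longrightarrow> length (filter (\<lambda>w. t w \<noteq> 0) ws) = k \<longrightarrow>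
        \<tau> (poly_word A a b ws) = \<sigma> (poly_word B c d ws)" for k
    proof (induction k rule: less_induct)
      case (less k)
      show ?case
      proof (intro allI impI)
        fix ws assume n: "length ws = n" and k: "length (filter (\<lambda>w. t w \<noteq> 0) ws) = k"
        consider (empty) "ws = []"
          | (merge) j where "Suc j < length ws" "fst (ws ! j) = fst (ws ! Suc j)"
          | (center) w where "w \<in> set ws" "t w \<noteq> 0"
          | (free) "ws \<noteq> []" "\<And>j. Suc j < length ws \<Longrightarrow> fst (ws ! j) \<noteq> fst (ws ! Suc j)"
              "\<And>w. w \<in> set ws \<Longrightarrow> t w = 0"
          by blast
        thus "\<tau> (poly_word A a b ws) = \<sigma> (poly_word B c d ws)"
        proof cases
          case empty
          then show ?thesis by (simp add: A.tau_one B.tau_one)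
        next
          case merge
          then obtain us e P Q vs where ws: "ws = us @ (e, P) # (e, Q) # vs"
            by (rule not_alternating_split)
          have "length (us @ (e, P * Q) # vs) < n" using n by (simp add: ws)
          from short[OF this] show ?thesis
            unfolding ws A.poly_word_merge[OF a] B.poly_word_merge[OF c] .
        next
          case center
          then obtain us vs where ws: "ws = us @ w # vs" by (meson split_list)
          define e P where "e = fst w" and "P = snd w"
          have w: "w = (e, P)" by (simp add: e_def P_def)
          let ?P = "P - [:t w:]"
          have tx: "\<tau> (poly_at A ?P x) = \<tau> (poly_at A P x) - t w" if x: "x \<in> carrier A" for x
          proof -
            have "poly_at A P x = poly_at A ?P x \<oplus>\<^bsub>A\<^esub> t w \<odot>\<^bsub>A\<^esub> \<one>\<^bsub>A\<^esub>"
              using A.poly_at_add[OF x, of ?P "[:t w:]"] A.poly_at_const[OF x] by simp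
            thus ?thesis using x A.smult_closed[of "\<one>\<^bsub>A\<^esub>"]
              by (simp add: A.tau_add A.tau_smult A.tau_one)
          qed
          have t0: "t (e, ?P) = 0" using tx a by (auto simp: t_def w)
          have "length (filter (\<lambda>w. t w \<noteq> 0) (us @ (e, ?P) # vs)) < k" "length (us @ (e, ?P) # vs) = n"
            using k n center(2) t0 by (auto simp: ws)
          hence 1: "\<tau> (poly_word A a b (us @ (e, ?P) # vs)) = \<sigma> (poly_word B c d (us @ (e, ?P) # vs))"
            using less.IH by blast
          have 2: "\<tau> (poly_word A a b (us @ vs)) = \<sigma> (poly_word B c d (us @ vs))"
            using n by (intro short) (simp add: ws)
          have "\<tau> (poly_word A a b ws) = \<tau> (poly_word A a b (us @ (e, ?P) # vs)) + t w * \<tau> (poly_word A a b (us @ vs))"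
            unfolding ws w A.poly_word_split[OF a, of us e P vs "t (e, P)"]
            by (simp only: A.tau_add A.tau_smult A.poly_word_closed[OF a] A.smult_closed)
          moreover have "\<sigma> (poly_word B c d ws) = \<sigma> (poly_word B c d (us @ (e, ?P) # vs)) + t w * \<sigma> (poly_word B c d (us @ vs))"
            unfolding ws w B.poly_word_split[OF c, of us e P vs "t (e, P)"]
            by (simp only: B.tau_add B.tau_smult B.poly_word_closed[OF c] B.smult_closed)
          ultimately show ?thesis using 1 2 by simp
        next
          case free
          have z: "t (e, P) = 0" if "(e, P) \<in> set ws" for e P using free(3)[OF that] .
          have "\<tau> (poly_word A a b ws) = 0"
          proof (rule A.free_poly_word_zero[OF a _ free(1) _ free(2)])
            show "\<tau> (poly_at A P (if e then b else a)) = 0" if "(e, P) \<in> set ws" for e P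
              using z[OF that] by (simp add: t_def)
          qed (use fA in \<open>simp_all only: freely_independent_def\<close>)
          moreover have "\<sigma> (poly_word B c d ws) = 0"
          proof (rule B.free_poly_word_zero[OF c _ free(1) _ free(2)])
            show "\<sigma> (poly_at B P (if e then d else c)) = 0" if "(e, P) \<in> set ws" for e P
              using z[OF that] by (simp add: tB)
          qed (use fB in \<open>simp_all only: freely_independent_def\<close>)
          ultimately show ?thesis by simp
        qed
      qed
    qed
    thus ?case by blast
  qed
  thus ?thesis by blast
qed

definition color_prod :: "bool \<Rightarrow> (bool \<times> complex poly) list \<Rightarrow> complex poly" where
  "color_prod c ws = prod_list (map snd (filter (\<lambda>w. fst w = c) ws))"

lemma (in nc_prob_space) tensor_poly_word:
  assumes a: "a \<in> carrier A" and b: "b \<in> carrier A"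
    and ab: "\<And>x y. x \<in> generated_algebra A a \<Longrightarrow> y \<in> generated_algebra A b \<Longrightarrow> x \<otimes> y = y \<otimes> x"
    and u: "unital_subalgebra A (generated_algebra A a)" "unital_subalgebra A (generated_algebra A b)"
  shows "poly_word A a b ws = poly_at A (color_prod False ws) a \<otimes> poly_at A (color_prod True ws) b"
proof (induction ws)
  case Nil
  then show ?case using a b by (simp add: color_prod_def)
next
  case (Cons w ws)
  obtain c P where w: "w = (c, P)" by (cases w)
  let ?p = "poly_at A (color_prod False ws) a" and ?q = "poly_at A (color_prod True ws) b"
  have cl: "poly_at A Q a \<in> carrier A" "poly_at A Q b \<in> carrier A" for Q using a b by auto
  show ?case
  proof (cases c)
    case True
    have "poly_at A P b \<otimes> (?p \<otimes> ?q) = (poly_at A P b \<otimes> ?p) \<otimes> ?q" using cl by (simp add: m_assoc)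
    also have "poly_at A P b \<otimes> ?p = ?p \<otimes> poly_at A P b"
      by (intro ab[symmetric] poly_at_in_generated_algebra u)
    also have "(?p \<otimes> poly_at A P b) \<otimes> ?q = ?p \<otimes> (poly_at A P b \<otimes> ?q)" using cl by (simp add: m_assoc)
    finally show ?thesis using True Cons a b by (simp add: w color_prod_def poly_at_mult)
  next
    case False
    then show ?thesis using Cons a b by (simp add: w color_prod_def poly_at_mult m_assoc)
  qed
qed

lemma (in nc_prob_space) tensor_poly_word_moment:
  assumes a: "a \<in> carrier A" and b: "b \<in> carrier A"
    and ind: "(\<forall>B\<in>set Bs. unital_subalgebra A B) \<and>
     (\<forall>i<length Bs. \<forall>j<length Bs. i \<noteq> j \<longrightarrow> (\<forall>x\<in>Bs ! i. \<forall>y\<in>Bs ! j. x \<otimes> y = y \<otimes> x)) \<and>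
     (\<forall>x. (\<forall>k<length Bs. x k \<in> Bs ! k) \<longrightarrow>
        \<tau> (list_mult A (map x [0..<length Bs])) = (\<Prod>k<length Bs. \<tau> (x k)))"
    and Bs: "Bs = [generated_algebra A a, generated_algebra A b]"
  shows "\<tau> (poly_word A a b ws) = \<tau> (poly_at A (color_prod False ws) a) * \<tau> (poly_at A (color_prod True ws) b)"
proof -
  have u: "unital_subalgebra A (generated_algebra A a)" "unital_subalgebra A (generated_algebra A b)"
    using ind by (auto simp: Bs)
  have ab: "x \<otimes> y = y \<otimes> x" if "x \<in> generated_algebra A a" "y \<in> generated_algebra A b" for x y
    using conjunct1[OF conjunct2[OF ind], rule_format, of 0 1 x y] that by (simp add: Bs)
  define x where "x k = (if k = (0::nat) then poly_at A (color_prod False ws) a else poly_at A (color_prod True ws) b)" for k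
  have xk: "\<forall>k<length Bs. x k \<in> Bs ! k"
    by (auto simp: x_def Bs less_Suc_eq intro: poly_at_in_generated_algebra u)
  have "\<tau> (list_mult A (map x [0..<length Bs])) = (\<Prod>k<length Bs. \<tau> (x k))"
    using conjunct2[OF conjunct2[OF ind]] xk by blast
  thus ?thesis using a b
    by (simp add: tensor_poly_word[OF a b ab u] Bs x_def list_mult_def numeral_2_eq_2 upt_rec)
qed

lemma poly_word_moments:
  fixes A :: "'u cstar_alg" and B :: "'u cstar_alg"
  assumes ind: "indep \<in> {tensor_independent, freely_independent}"
    and A: "nc_prob_space A \<tau>" and B: "nc_prob_space B \<sigma>"
    and a: "a \<in> carrier A" "b \<in> carrier A" and c: "c \<in> carrier B" "d \<in> carrier B"
    and fA: "indep A \<tau> [generated_algebra A a, generated_algebra A b]"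
    and fB: "indep B \<sigma> [generated_algebra B c, generated_algebra B d]"
    and m1: "\<And>Q. \<tau> (poly_at A Q a) = \<sigma> (poly_at B Q c)"
    and m2: "\<And>Q. \<tau> (poly_at A Q b) = \<sigma> (poly_at B Q d)"
  shows "\<tau> (poly_word A a b ws) = \<sigma> (poly_word B c d ws)"
proof (cases "indep = freely_independent")
  case True
  then show ?thesis using assms by (intro free_poly_word_moments[OF A B a c _ _ m1 m2]) auto
next
  case False
  hence "indep = tensor_independent" using ind by auto
  thus ?thesis
    using nc_prob_space.tensor_poly_word_moment[OF A a, of "[generated_algebra A a, generated_algebra A b]" ws]
      nc_prob_space.tensor_poly_word_moment[OF B c, of "[generated_algebra B c, generated_algebra B d]" ws]
      fA fB m1 m2 by (simp add: tensor_independent_def)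
qed

text \<open>Powers of \<open>a + b\<close> are moved into the word one factor at a time, which
  reduces moments of the sum to mixed moments without an explicit non-commutative expansion.\<close>

lemma (in nc_prob_space) tau_pow_poly_word_Suc:
  assumes a: "a \<in> carrier A" and b: "b \<in> carrier A"
  shows "\<tau> ((a \<oplus> b) [^] Suc k \<otimes> poly_word A a b ws)
    = \<tau> ((a \<oplus> b) [^] k \<otimes> poly_word A a b ((False, [:0, 1:]) # ws))
      + \<tau> ((a \<oplus> b) [^] k \<otimes> poly_word A a b ((True, [:0, 1:]) # ws))"
proof -
  have w: "poly_word A a b ws \<in> carrier A" using a b by auto
  have "(a \<oplus> b) [^] Suc k \<otimes> poly_word A a b ws
    = (a \<oplus> b) [^] k \<otimes> (a \<otimes> poly_word A a b ws) \<oplus> (a \<oplus> b) [^] k \<otimes> (b \<otimes> poly_word A a b ws)"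
    using a b w by (simp add: m_assoc l_distr r_distr)
  thus ?thesis using a b w by (simp add: poly_at_X tau_add)
qed

lemma has_distribution_moment:
  assumes A: "nc_prob_space A \<tau>" and h: "has_distribution A \<tau> a \<mu>"
  shows "complex_of_real (LINT x|\<mu>. x ^ k) = \<tau> (a [^]\<^bsub>A\<^esub> (k::nat))"
proof -
  interpret nc_prob_space A \<tau> by fact
  have a: "a \<in> carrier A" using h by (simp add: has_distribution_def self_adjoint_def)
  have "(LINT x|\<mu>. poly (Polynomial.monom 1 k) (complex_of_real x)) = \<tau> (poly_at A (Polynomial.monom 1 k) a)"
    using h unfolding has_distribution_def by blast
  hence "(LINT x|\<mu>. complex_of_real (x ^ k)) = \<tau> (a [^]\<^bsub>A\<^esub> k)"
    by (simp add: poly_monom poly_at_monom[OF a])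
  thus ?thesis by (simp only: integral_complex_of_real)
qed

text \<open>The moments of \<open>a + b\<close> are determined by those of \<open>a\<close> and of \<open>b\<close>.\<close>

lemma is_convolution_unique:
  fixes indep :: "'u independence"
  assumes ind: "indep \<in> {tensor_independent, freely_independent}"
    and 1: "is_convolution indep \<mu> \<nu> \<eta>" and 2: "is_convolution indep \<mu> \<nu> \<theta>"
  shows "\<eta> = \<theta>"
proof -
  obtain A \<tau> a b where A: "nc_prob_space A \<tau>" and a: "has_distribution A \<tau> a \<mu>" "has_distribution A \<tau> b \<nu>"
    and iA: "indep A \<tau> [generated_algebra A a, generated_algebra A b]"
    and sA: "has_distribution A \<tau> (a \<oplus>\<^bsub>A\<^esub> b) \<eta>" using 1 unfolding is_convolution_def by blast
  obtain B \<sigma> c d where B: "nc_prob_space B \<sigma>" and c: "has_distribution B \<sigma> c \<mu>" "has_distribution B \<sigma> d \<nu>"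
    and iB: "indep B \<sigma> [generated_algebra B c, generated_algebra B d]"
    and sB: "has_distribution B \<sigma> (c \<oplus>\<^bsub>B\<^esub> d) \<theta>" using 2 unfolding is_convolution_def by blast
  interpret A: nc_prob_space A \<tau> by fact
  interpret B: nc_prob_space B \<sigma> by fact
  have ca: "a \<in> carrier A" "b \<in> carrier A" and cc: "c \<in> carrier B" "d \<in> carrier B"
    using a c by (auto simp: has_distribution_def self_adjoint_def)
  have words: "\<tau> (poly_word A a b ws) = \<sigma> (poly_word B c d ws)" for ws
    using a c by (intro poly_word_moments[OF ind A B ca cc iA iB])
      (metis has_distribution_def)+
  have "\<forall>ws. \<tau> ((a \<oplus>\<^bsub>A\<^esub> b) [^]\<^bsub>A\<^esub> k \<otimes>\<^bsub>A\<^esub> poly_word A a b ws)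
      = \<sigma> ((c \<oplus>\<^bsub>B\<^esub> d) [^]\<^bsub>B\<^esub> k \<otimes>\<^bsub>B\<^esub> poly_word B c d ws)" for k :: nat
  proof (induction k)
    case 0
    then show ?case using ca cc words by simp
  next
    case (Suc k)
    show ?case
      unfolding A.tau_pow_poly_word_Suc[OF ca] B.tau_pow_poly_word_Suc[OF cc] using Suc by metis
  qed
  from spec[OF this, of _ "[]"] have m: "\<tau> ((a \<oplus>\<^bsub>A\<^esub> b) [^]\<^bsub>A\<^esub> k) = \<sigma> ((c \<oplus>\<^bsub>B\<^esub> d) [^]\<^bsub>B\<^esub> k)" for k :: nat
    using ca cc by simp
  show "\<eta> = \<theta>"
  proof (rule compactly_supported_moments_unique)
    show "compactly_supported_prob \<eta>" "compactly_supported_prob \<theta>"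
      using sA sB by (auto simp: has_distribution_def)
    show "(LINT x|\<eta>. x ^ k) = (LINT x|\<theta>. x ^ k)" for k :: nat
      using has_distribution_moment[OF A sA, of k] has_distribution_moment[OF B sB, of k] m
      by (metis of_real_eq_iff)
  qed
qed

section \<open>The moment problem on the unit interval\<close>

text \<open>The factorial moments of a binomial law, as an identity in commutative rings; it is
  applied with the polynomials \<open>[:0, 1:]\<close> and \<open>[:1, -1:]\<close> in the place of
  \<open>x\<close> and \<open>y\<close>.\<close>

lemma binomial_factorial_moment:
  fixes x y :: "'a :: comm_ring_1"
  assumes xy: "x + y = 1" and j: "j \<le> N"
  shows "(\<Sum>k\<le>N. of_nat (k choose j) * (of_nat (N choose k) * x ^ k * y ^ (N - k))) = of_nat (N choose j) * x ^ j"
proof -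
  have "(\<Sum>k\<le>N. of_nat (k choose j) * (of_nat (N choose k) * x ^ k * y ^ (N - k)))
      = (\<Sum>k\<in>{j..N}. of_nat ((N choose k) * (k choose j)) * x ^ k * y ^ (N - k))"
    by (rule sum.mono_neutral_cong_right) (auto simp: binomial_eq_0 mult_ac)
  also have "\<dots> = (\<Sum>k\<in>{j..N}. of_nat ((N choose j) * ((N - j) choose (k - j))) * x ^ k * y ^ (N - k))"
    by (intro sum.cong refl) (simp only: choose_mult atLeastAtMost_iff)
  also have "\<dots> = (\<Sum>i\<le>N - j. of_nat ((N choose j) * ((N - j) choose i)) * x ^ (i + j) * y ^ (N - j - i))"
    using j by (intro sum.reindex_bij_witness[of _ "\<lambda>i. i + j" "\<lambda>k. k - j"]) auto
  also have "\<dots> = of_nat (N choose j) * x ^ j * (\<Sum>i\<le>N - j. of_nat ((N - j) choose i) * x ^ i * y ^ (N - j - i))"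
    by (simp add: sum_distrib_left power_add mult_ac)
  also have "(\<Sum>i\<le>N - j. of_nat ((N - j) choose i) * x ^ i * y ^ (N - j - i)) = (x + y) ^ (N - j)"
    by (simp only: binomial_ring)
  finally show ?thesis using xy by simp
qed

text \<open>Sampling without replacement compared with sampling with replacement. Passing from
  \<open>j\<close> to \<open>Suc j\<close> multiplies the ratio by \<open>(k - j) / (N - j)\<close>,
  which differs from \<open>k / N\<close> by at most \<open>j / (N - j)\<close>.\<close>

lemma binomial_ratio_approx:
  assumes "k \<le> N" and "j < N"
  shows "\<bar>real (k choose j) / real (N choose j) - (real k / real N) ^ j\<bar> \<le> (real j)\<^sup>2 / (real N - real j)"
proof -
  have p: "real (N choose j) > 0" if "j < N" for j using that by simp
  have le1: "real (k choose j) / real (N choose j) \<le> 1" if "j < N" for j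
    using p[OF that] binomial_right_mono[OF assms(1), of j] by (simp add: divide_le_eq)
  show "\<bar>real (k choose j) / real (N choose j) - (real k / real N) ^ j\<bar> \<le> (real j)\<^sup>2 / (real N - real j)"
    using assms(2)
  proof (induction j)
    case 0
    then show ?case by simp
  next
    case (Suc j)
    define b where "b = real (k choose j) / real (N choose j)"
    define s where "s = real k / real N"
    define r where "r = (real k - real j) / (real N - real j)"
    have jN: "real j < real N" using Suc.prems by simp
    have s: "0 \<le> s" "s \<le> 1" using assms(1) Suc.prems by (auto simp: s_def divide_le_eq)
    have b: "0 \<le> b" "b \<le> 1" using le1[of j] Suc.prems by (auto simp: b_def)
    have absorb: "real (Suc j) * real (n choose Suc j) = (real n - real j) * real (n choose j)" for n
    proof (cases "j \<le> n")
      case True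
      have "Suc j * (n choose Suc j) = (n - j) * (n choose j)"
        using binomial_absorb_comp[of n j] binomial_absorption[of j n] by (metis binomial_absorption binomial_absorb_comp)
      from arg_cong[OF this, of real] show ?thesis using True by (simp only: of_nat_mult of_nat_diff)
    next
      case False
      thus ?thesis by (simp add: binomial_eq_0)
    qed
    have step: "real (k choose Suc j) / real (N choose Suc j) = b * r"
    proof -
      have "real (k choose Suc j) / real (N choose Suc j)
          = (real (Suc j) * real (k choose Suc j)) / (real (Suc j) * real (N choose Suc j))" by simp
      also have "\<dots> = b * r" unfolding absorb b_def r_def by (simp add: mult.commute)
      finally show ?thesis .
    qed
    have rs: "\<bar>r - s\<bar> \<le> real j / (real N - real j)"
    proof -
      define u where "u = (real N - real k) / real N"
      have "s - r = real j / (real N - real j) * u"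
        using jN by (simp add: r_def s_def u_def divide_simps) (simp add: algebra_simps)
      moreover have "0 \<le> u" "u \<le> 1" using jN assms(1) by (auto simp: u_def divide_le_eq)
      moreover have "0 \<le> real j / (real N - real j)" using jN by simp
      ultimately have "\<bar>s - r\<bar> \<le> real j / (real N - real j) * 1"
        by (simp only: abs_mult abs_of_nonneg mult_left_mono)
      thus ?thesis by (simp add: abs_minus_commute)
    qed
    have "\<bar>b * r - s ^ Suc j\<bar> = \<bar>b * (r - s) + (b - s ^ j) * s\<bar>" by (simp add: algebra_simps)
    also have "\<dots> \<le> b * \<bar>r - s\<bar> + \<bar>b - s ^ j\<bar> * s"
      using abs_triangle_ineq[of "b * (r - s)" "(b - s ^ j) * s"] b s by (simp add: abs_mult)
    also have "\<dots> \<le> 1 * (real j / (real N - real j)) + (real j)\<^sup>2 / (real N - real j) * 1"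
      using Suc jN b s rs by (intro add_mono mult_mono) (auto simp: b_def s_def)
    also have "\<dots> = (real j + (real j)\<^sup>2) / (real N - real j)" by (simp add: add_divide_distrib)
    also have "\<dots> \<le> (real (Suc j))\<^sup>2 / (real N - real (Suc j))"
      using Suc.prems by (intro frac_le) (auto simp: power2_eq_square algebra_simps)
    finally show ?case unfolding step s_def .
  qed
qed

text \<open>The functional is approximated by its values on Bernstein polynomials, which define discrete
  measures on \<open>{k/N}\<close>; Helly's theorem provides a limit.\<close>

lemma Hausdorff_moment_problem:
  fixes L :: "real poly \<Rightarrow> real"
  assumes add: "\<And>P Q. L (P + Q) = L P + L Q" and smult: "\<And>c P. L (Polynomial.smult c P) = c * L P"
    and one: "L 1 = 1" and pos: "\<And>j l. 0 \<le> L ([:0, 1:] ^ j * [:1, -1:] ^ l)"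
  obtains \<mu> where "prob_space \<mu>" and "sets \<mu> = sets borel" and "AE x in \<mu>. x \<in> {0..1}"
    and "\<And>j::nat. (LINT x|\<mu>. x ^ j) = L ([:0, 1:] ^ j)"
proof -
  have L0: "L 0 = 0" using smult[of 0 0] by simp
  have Lsum: "L (\<Sum>i\<in>I. f i) = (\<Sum>i\<in>I. L (f i))" for f :: "nat \<Rightarrow> real poly" and I
    by (induction I rule: infinite_finite_induct) (auto simp: add L0)
  define c where "c N k = real (N choose k) * L ([:0, 1:] ^ k * [:1, -1:] ^ (N - k))" for N k :: nat
  have c0: "0 \<le> c N k" for N k using pos by (simp add: c_def)
  \<comment> \<open>The discrete measures have exactly the right factorial moments; only the passage
    to ordinary moments costs an error, and it vanishes as \<open>N\<close> grows.\<close>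
  have moment: "(\<Sum>k\<le>N. c N k * (real (k choose j) / real (N choose j))) = L ([:0, 1:] ^ j)" if "j \<le> N" for N j
  proof -
    have "(\<Sum>k\<le>N. of_nat (k choose j) * (of_nat (N choose k) * [:0, 1:] ^ k * [:1, -1:] ^ (N - k)))
        = of_nat (N choose j) * ([:0, 1:] ^ j :: real poly)"
      by (rule binomial_factorial_moment) (simp_all add: that one_pCons)
    from arg_cong[OF this, of L]
    have "(\<Sum>k\<le>N. real (k choose j) * c N k) = real (N choose j) * L ([:0, 1:] ^ j)"
      unfolding Lsum by (simp add: of_nat_poly c_def smult mult.assoc mult.left_commute)
    moreover have "real (N choose j) \<noteq> 0" using that by simp
    moreover have "(\<Sum>k\<le>N. c N k * (real (k choose j) / real (N choose j)))
       = (\<Sum>k\<le>N. real (k choose j) * c N k) / real (N choose j)"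
      by (simp add: sum_divide_distrib mult.commute)
    ultimately show ?thesis by simp
  qed
  have c1: "(\<Sum>k\<le>N. c N k) = 1" for N using moment[of 0 N] one by simp
  \<comment> \<open>The index is shifted to \<open>Suc N\<close>, so that the atoms
    \<open>k / Suc N\<close> never involve division by zero.\<close>
  define D where "D N = point_measure {..Suc N} (\<lambda>k. ennreal (c (Suc N) k))" for N
  define \<mu> where "\<mu> N = distr (D N) borel (\<lambda>k. real k / real (Suc N))" for N
  have pD: "prob_space (D N)" for N
    unfolding D_def by (intro prob_space_point_measure) (auto simp: c0 c1 sum_ennreal simp del: sum.atMost_Suc)
  have mD: "(\<lambda>k. real k / real (Suc N)) \<in> measurable (D N) borel" for N
    by (auto simp: D_def point_measure_def)
  have rd: "real_distribution (\<mu> N)" for N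
    unfolding \<mu>_def using prob_space.prob_space_distr[OF pD mD]
    by (simp add: real_distribution_def real_distribution_axioms_def)
  have int\<mu>: "(LINT x|\<mu> N. f x) = (\<Sum>k\<le>Suc N. c (Suc N) k * f (real k / real (Suc N)))"
    if f: "f \<in> borel_measurable borel" for f :: "real \<Rightarrow> real" and N
  proof -
    have "(LINT x|\<mu> N. f x) = (LINT k|D N. f (real k / real (Suc N)))"
      unfolding \<mu>_def by (rule integral_distr[OF mD f])
    also have "\<dots> = (\<Sum>k\<le>Suc N. c (Suc N) k * f (real k / real (Suc N)))"
      unfolding D_def by (subst lebesgue_integral_point_measure_finite) (auto simp: c0)
    finally show ?thesis .
  qed
  have tight: "tight \<mu>"
    unfolding tight_def
  proof (intro conjI allI impI)
    fix e :: real assume e: "e > 0"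
    \<comment> \<open>Tightness is stated with half-open intervals; the left end lies below 0
      because 0 may carry an atom.\<close>
    have "measure (\<mu> N) {-1<..1} = 1" for N
    proof -
      have "measure (\<mu> N) {-1<..1} = measure (D N) ((\<lambda>k. real k / real (Suc N)) -` {-1<..1} \<inter> space (D N))"
        unfolding \<mu>_def by (intro measure_distr mD) auto
      also have "(\<lambda>k. real k / real (Suc N)) -` {-1<..1} \<inter> space (D N) = space (D N)"
      proof -
        have "-1 < real k / real (Suc N)" for k by (rule less_le_trans[of _ 0]) auto
        thus ?thesis by (auto simp: D_def space_point_measure simp del: of_nat_Suc)
      qed
      finally show ?thesis using prob_space.prob_space[OF pD] by simp
    qed
    hence "\<forall>N. measure (\<mu> N) {-1<..1} > 1 - e" using e by simp
    thus "\<exists>a b. a < b \<and> (\<forall>N. measure (\<mu> N) {a<..b} > 1 - e)" by (intro exI[of _ "-1"] exI[of _ 1]) auto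
  qed (rule rd)
  obtain r M where r: "strict_mono (r :: nat \<Rightarrow> nat)" and M: "real_distribution M"
    and wc: "weak_conv_m (\<mu> \<circ> id \<circ> r) M"
    using tight_imp_convergent_subsubsequence[OF tight strict_mono_id] by auto
  interpret M: real_distribution M by fact
  have conv: "(\<lambda>n. LINT x|\<mu> (r n). f x) \<longlonglongrightarrow> (LINT x|M. f x)"
    if "\<And>x. isCont f x" "\<And>x. norm (f x) \<le> B" for f :: "real \<Rightarrow> real" and B
    using weak_conv_imp_integral_bdd_continuous_conv[OF _ M wc that] rd by simp
  \<comment> \<open>Weak convergence tests bounded continuous functions only. Powers are therefore
    tested after clamping to the unit interval, which moves no atom of the approximating
    measures.\<close>
  define cl where "cl x = max 0 (min 1 x)" for x :: real
  have cl01: "0 \<le> cl x" "cl x \<le> 1" for x by (auto simp: cl_def)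
  have cont_cl: "isCont cl x" for x unfolding cl_def by (intro continuous_intros)
  have clk: "cl (real k / real N) = real k / real N" if "k \<le> N" "N > 0" for k N :: nat
    using that by (auto simp: cl_def divide_le_eq)
  have AE01: "AE x in M. x \<in> {0..1}"
  proof -
    \<comment> \<open>A bounded continuous function that vanishes exactly on the unit interval. Its
      integral is zero along the sequence, hence also for the limit, which is thus carried by the
      interval.\<close>
    define f where "f x = min 1 \<bar>x - cl x\<bar>" for x :: real
    have fc: "isCont f x" for x unfolding f_def by (intro continuous_intros cont_cl)
    have f0: "0 \<le> f x" "f x \<le> 1" for x by (auto simp: f_def)
    have fm: "f \<in> borel_measurable borel"
      by (intro borel_measurable_continuous_onI continuous_at_imp_continuous_on ballI fc)
    have "(LINT x|\<mu> N. f x) = 0" for N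
      unfolding int\<mu>[OF fm] by (intro sum.neutral ballI) (simp add: f_def clk del: of_nat_Suc)
    hence "(LINT x|M. f x) = 0" using conv[OF fc, of 1] f0 LIMSEQ_unique[OF _ tendsto_const] by auto
    moreover have "integrable M f" by (rule M.integrable_const_bound[of _ 1]) (use f0 fm in auto)
    ultimately have "AE x in M. f x = 0" using f0 by (simp add: integral_nonneg_eq_0_iff_AE)
    thus ?thesis
    proof eventually_elim
      case (elim x)
      hence "x = cl x" by (auto simp: f_def min_def split: if_splits)
      thus ?case using cl01[of x] by simp
    qed
  qed
  have mom: "(LINT x|M. x ^ j) = L ([:0, 1:] ^ j)" for j :: nat
  proof -
    have fc: "isCont (\<lambda>x. cl x ^ j) x" for x by (intro continuous_intros cont_cl)
    have f1: "norm (cl x ^ j) \<le> 1" for x using cl01[of x] by (simp add: power_le_one)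
    have fm: "(\<lambda>x. cl x ^ j) \<in> borel_measurable borel"
      by (intro borel_measurable_continuous_onI continuous_at_imp_continuous_on ballI fc)
    have "\<bar>(LINT x|\<mu> N. cl x ^ j) - L ([:0, 1:] ^ j)\<bar> \<le> (real j)\<^sup>2 / (real (Suc N) - real j)" if N: "j \<le> N" for N
    proof -
      have "(LINT x|\<mu> N. cl x ^ j) = (\<Sum>k\<le>Suc N. c (Suc N) k * (real k / real (Suc N)) ^ j)"
        unfolding int\<mu>[OF fm] by (intro sum.cong refl) (simp add: clk del: of_nat_Suc)
      hence "\<bar>(LINT x|\<mu> N. cl x ^ j) - L ([:0, 1:] ^ j)\<bar>
          = \<bar>\<Sum>k\<le>Suc N. c (Suc N) k * ((real k / real (Suc N)) ^ j - real (k choose j) / real (Suc N choose j))\<bar>"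
        using moment[of j "Suc N"] N by (simp add: right_diff_distrib sum_subtractf del: sum.atMost_Suc of_nat_Suc binomial_Suc_Suc)
      also have "\<dots> \<le> (\<Sum>k\<le>Suc N. c (Suc N) k * ((real j)\<^sup>2 / (real (Suc N) - real j)))"
      proof (rule order_trans[OF sum_abs sum_mono])
        fix k assume "k \<in> {..Suc N}"
        hence "\<bar>real (k choose j) / real (Suc N choose j) - (real k / real (Suc N)) ^ j\<bar> \<le> (real j)\<^sup>2 / (real (Suc N) - real j)"
          using N by (intro binomial_ratio_approx) auto
        thus "\<bar>c (Suc N) k * ((real k / real (Suc N)) ^ j - real (k choose j) / real (Suc N choose j))\<bar>
           \<le> c (Suc N) k * ((real j)\<^sup>2 / (real (Suc N) - real j))"
          unfolding abs_mult abs_of_nonneg[OF c0] by (intro mult_left_mono c0) (simp only: abs_minus_commute)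
      qed
      also have "\<dots> = (real j)\<^sup>2 / (real (Suc N) - real j)"
        unfolding sum_distrib_right[symmetric] c1 by simp
      finally show ?thesis .
    qed
    hence "\<forall>\<^sub>F N in sequentially. norm ((LINT x|\<mu> N. cl x ^ j) - L ([:0, 1:] ^ j)) \<le> (real j)\<^sup>2 / (real (Suc N) - real j)"
      unfolding real_norm_def eventually_sequentially by blast
    moreover have "(\<lambda>N. (real j)\<^sup>2 / (real (Suc N) - real j)) \<longlonglongrightarrow> 0" by real_asymp
    ultimately have "(\<lambda>N. (LINT x|\<mu> N. cl x ^ j) - L ([:0, 1:] ^ j)) \<longlonglongrightarrow> 0" by (rule Lim_null_comparison)
    hence "(\<lambda>N. LINT x|\<mu> N. cl x ^ j) \<longlonglongrightarrow> L ([:0, 1:] ^ j)" by (simp add: LIM_zero_iff)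
    from LIMSEQ_subseq_LIMSEQ[OF this r] have "(\<lambda>n. LINT x|\<mu> (r n). cl x ^ j) \<longlonglongrightarrow> L ([:0, 1:] ^ j)"
      by (simp add: o_def)
    from LIMSEQ_unique[OF conv[OF fc f1] this] have "(LINT x|M. cl x ^ j) = L ([:0, 1:] ^ j)" .
    moreover have "(LINT x|M. x ^ j) = (LINT x|M. cl x ^ j)"
    proof (rule integral_cong_AE)
      show "AE x in M. x ^ j = cl x ^ j" using AE01 by eventually_elim (auto simp: cl_def)
    qed (use fm in auto)
    ultimately show ?thesis by simp
  qed
  show ?thesis using that[OF M.prob_space_axioms _ AE01 mom] by simp
qed

section \<open>Distributions of sums of projections\<close>

text \<open>Positivity is used through the cone of sums of squares: vector functionals are
  nonnegative on it and it is stable under conjugation, so no square roots of positive matrices are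
  required.\<close>

inductive_set sos :: "'i bmat set" where
  square: "adj b * b \<in> sos"
| add: "x \<in> sos \<Longrightarrow> y \<in> sos \<Longrightarrow> x + y \<in> sos"
| scale: "x \<in> sos \<Longrightarrow> c \<ge> 0 \<Longrightarrow> cs (complex_of_real c) x \<in> sos"

lemma sos_conjugate: "x \<in> sos \<Longrightarrow> adj w * x * w \<in> sos"
proof (induction rule: sos.induct)
  case (square b)
  have "adj w * (adj b * b) * w = adj (b * w) * (b * w)" by (simp add: adj_times mult.assoc)
  then show ?case by (simp add: sos.square)
qed (simp_all add: algebra_simps cs_mult_left cs_mult_right sos.add sos.scale flip: mult.assoc)

lemma sos_sum: "(\<And>k. k \<in> K \<Longrightarrow> f k \<in> sos) \<Longrightarrow> (\<Sum>k\<in>K. f k) \<in> sos"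
proof (induction K rule: infinite_finite_induct)
  case empty
  then show ?case using sos.square[of 0] by simp
qed (use sos.square[of 0] in \<open>auto intro: sos.add\<close>)

lemma vstate_sos:
  assumes "x \<in> sos" and "finite F"
  shows "vstate F \<xi> x = complex_of_real (Re (vstate F \<xi> x)) \<and> 0 \<le> Re (vstate F \<xi> x)"
  using assms(1) by (induction rule: sos.induct) (auto simp: vstate_adj_times_self[OF assms(2)] vstate_add vstate_cs complex_eq_iff)

text \<open>Conjugation by \<open>Y\<close> or by \<open>1 - Y\<close> lowers an exponent by 2,
  which leaves exponents at most 1. The product \<open>Y * (1 - Y)\<close> is handled by inserting
  \<open>Y + (1 - Y) = 1\<close>, which writes it as a sum of two conjugates.\<close>

lemma sos_power_product:
  assumes Y: "adj Y = Y" "Y \<in> sos" and Z: "1 - Y \<in> sos"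
  shows "Y ^ j * (1 - Y) ^ l \<in> sos"
proof (induction "j + l" arbitrary: j l rule: less_induct)
  case less
  have c: "Y ^ i * (1 - Y) ^ k = (1 - Y) ^ k * Y ^ i" for i k
  proof -
    have "Y * (1 - Y) = (1 - Y) * Y" by (simp add: algebra_simps)
    thus ?thesis by (metis power_commuting_commutes)
  qed
  have aZ: "adj (1 - Y) = 1 - Y" by (simp add: adj_minus Y)
  consider (j) i where "j = Suc (Suc i)" | (l) i where "l = Suc (Suc i)" | (small) "j \<le> 1" "l \<le> 1"
    by (metis One_nat_def not0_implies_Suc le_SucI le_zero_eq nat_le_linear not_less_eq_eq)
  thus ?case
  proof cases
    case j
    have "adj Y * (Y ^ i * (1 - Y) ^ l) * Y \<in> sos" using less[of i l] by (intro sos_conjugate) (simp add: j)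
    also have "adj Y * (Y ^ i * (1 - Y) ^ l) * Y = Y * Y ^ i * (Y ^ 1 * (1 - Y) ^ l)"
      unfolding c[of 1 l] by (simp add: Y mult.assoc)
    also have "\<dots> = Y ^ j * (1 - Y) ^ l" by (simp add: j mult.assoc[symmetric] power_commutes[symmetric])
    finally show ?thesis .
  next
    case l
    have "adj (1 - Y) * (Y ^ j * (1 - Y) ^ i) * (1 - Y) \<in> sos"
      using less[of j i] by (intro sos_conjugate) (simp add: l)
    also have "adj (1 - Y) * (Y ^ j * (1 - Y) ^ i) * (1 - Y) = (1 - Y) ^ 1 * Y ^ j * ((1 - Y) ^ i * (1 - Y))"
      by (simp add: aZ mult.assoc)
    also have "\<dots> = Y ^ j * (1 - Y) ^ l"
      unfolding c[symmetric] by (simp add: l mult.assoc power_commutes)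
    finally show ?thesis .
  next
    case small
    have 11: "Y * (1 - Y) = adj Y * (1 - Y) * Y + adj (1 - Y) * Y * (1 - Y)"
      by (simp add: aZ Y algebra_simps)
    have "Y * (1 - Y) \<in> sos" unfolding 11 by (intro sos.add sos_conjugate Y Z)
    moreover have "(1 :: 'a bmat) \<in> sos" using sos.square[of 1] by simp
    ultimately show ?thesis using small Y Z by (auto simp: le_Suc_eq)
  qed
qed

text \<open>After scaling, both \<open>Y\<close> and \<open>1 - Y\<close> are sums of squares, so
  the functional given by evaluating a real polynomial at \<open>Y\<close> meets the positivity
  condition of the Hausdorff moment problem. The resulting measure is then stretched back by the
  factor \<open>n\<close>.\<close>

lemma sum_of_projections_distribution:
  assumes F: "finite F" and unit: "L2_set (\<lambda>i. cmod (\<xi> i)) F = 1" and K: "finite K"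
    and a: "\<And>k. k \<in> K \<Longrightarrow> adj (a k) = a k" "\<And>k. k \<in> K \<Longrightarrow> a k * a k = a k"
    and X: "X = (\<Sum>k\<in>K. a k)"
  obtains \<mu> where "compactly_supported_prob \<mu>"
    and "\<And>j::nat. complex_of_real (LINT x|\<mu>. x ^ j) = vstate F \<xi> (X ^ j)"
proof -
  \<comment> \<open>One more than the number of projections, to be positive even if \<open>K\<close>
    is empty; the surplus reappears as the summand 1 in the formula for
    \<open>1 - Y\<close>.\<close>
  define n where "n = real (Suc (card K))"
  have n: "n > 0" by (simp add: n_def)
  define Y where "Y = cs (complex_of_real (1 / n)) X"
  have asos: "a k \<in> sos" if "k \<in> K" for k using sos.square[of "a k"] a[OF that] by simp
  have bsos: "1 - a k \<in> sos" if "k \<in> K" for k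
    using sos.square[of "1 - a k"] a[OF that] by (simp add: adj_minus algebra_simps)
  have Xadj: "adj X = X" unfolding X using a(1) K
    by (induction K rule: infinite_finite_induct) (auto simp: adj_add)
  have Yadj: "adj Y = Y" by (simp add: Y_def adj_cs Xadj)
  have Ysos: "Y \<in> sos" unfolding Y_def X using n by (intro sos.scale sos_sum asos) auto
  have "1 - Y = cs (complex_of_real (1 / n)) ((\<Sum>k\<in>K. 1 - a k) + 1)"
  proof -
    have nn: "1 = cs (complex_of_real (1 / n)) (of_nat (Suc (card K)) :: 'a bmat)"
    proof -
      have "(of_nat (Suc (card K)) :: 'a bmat) = cs (complex_of_real n) 1"
        using scaleR_conv_cs[of n 1] by (simp add: n_def scaleR_conv_of_real)
      thus ?thesis using n by (simp add: cs_cs)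
    qed
    have "(\<Sum>k\<in>K. 1 - a k) + 1 = of_nat (Suc (card K)) - X" by (simp add: sum_subtractf X)
    thus ?thesis using nn by (simp only: cs_minus_right Y_def)
  qed
  moreover have "(\<Sum>k\<in>K. 1 - a k) + 1 \<in> sos"
    using sos.square[of 1] by (intro sos.add sos_sum bsos) auto
  ultimately have Zsos: "1 - Y \<in> sos" using n by (auto simp del: of_real_divide intro!: sos.scale)
  define L where "L Q = Re (vstate F \<xi> (pev (map_poly complex_of_real Q) Y))" for Q
  have mult: "map_poly complex_of_real (P * Q) = map_poly complex_of_real P * map_poly complex_of_real Q" for P Q
    by (intro poly_eqI) (simp add: coeff_map_poly coeff_mult)
  have powm: "map_poly complex_of_real (P ^ k) = map_poly complex_of_real P ^ k" for P k
    by (induction k) (simp_all add: mult)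
  have pevpow: "pev (P ^ k) Y = pev P Y ^ k" for P k
    by (induction k) (simp_all add: pev_mult one_pCons pev_pCons)
  have m01: "map_poly complex_of_real [:0, 1:] = [:0, 1:]" "map_poly complex_of_real [:1, -1:] = [:1, -1:]"
    by (simp_all add: map_poly_pCons)
  have pevX: "pev [:0, 1:] Y = Y" "pev [:1, -1:] Y = 1 - Y"
    by (simp_all add: pev_pCons cs_uminus_left)
  have Ladd: "L (P + Q) = L P + L Q" for P Q
  proof -
    have "map_poly complex_of_real (P + Q) = map_poly complex_of_real P + map_poly complex_of_real Q"
      by (intro poly_eqI) (simp add: coeff_map_poly)
    thus ?thesis by (simp add: L_def pev_add vstate_add)
  qed
  have Lsmult: "L (Polynomial.smult c P) = c * L P" for c P
  proof -
    have "map_poly complex_of_real (Polynomial.smult c P) = Polynomial.smult (complex_of_real c) (map_poly complex_of_real P)"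
      by (intro poly_eqI) (simp add: coeff_map_poly)
    thus ?thesis by (simp add: L_def pev_smult vstate_cs)
  qed
  have "vstate F \<xi> 1 = 1" using vstate_one[OF F, of \<xi>] by (simp add: unit)
  hence Lone: "L 1 = 1" by (simp add: L_def one_pCons map_poly_pCons pev_pCons)
  have Lpos: "0 \<le> L ([:0, 1:] ^ j * [:1, -1:] ^ l)" for j l
    using vstate_sos[OF sos_power_product[OF Yadj Ysos Zsos, of j l] F, of \<xi>]
    by (simp only: L_def mult powm m01 pev_mult pevpow pevX)
  obtain \<mu> where \<mu>: "prob_space \<mu>" "sets \<mu> = sets borel" "AE x in \<mu>. x \<in> {0..1}"
    and mom: "\<And>j::nat. (LINT x|\<mu>. x ^ j) = L ([:0, 1:] ^ j)"
    by (rule Hausdorff_moment_problem[of L, OF Ladd Lsmult Lone Lpos]) blast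
  define \<nu> where "\<nu> = distr \<mu> borel (\<lambda>x. n * x)"
  have msb: "(\<lambda>x. n * x) \<in> measurable \<mu> borel" using \<mu>(2) by (auto simp: measurable_cong_sets[OF \<mu>(2) refl])
  have "compactly_supported_prob \<nu>"
    unfolding compactly_supported_prob_def
  proof (intro conjI exI[of _ "{0..n}"])
    show "prob_space \<nu>" unfolding \<nu>_def by (rule prob_space.prob_space_distr[OF \<mu>(1) msb])
    have "AE x in \<mu>. \<not> n * x \<in> - {0..n}" using \<mu>(3) by eventually_elim (use n in auto)
    hence "emeasure \<mu> ((\<lambda>x. n * x) -` (- {0..n}) \<inter> space \<mu>) = 0"
      by (subst (asm) AE_iff_measurable[OF measurable_sets[OF msb]]) auto
    thus "emeasure \<nu> (- {0..n}) = 0" unfolding \<nu>_def by (subst emeasure_distr[OF msb]) auto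
  qed (auto simp: \<nu>_def)
  moreover have "complex_of_real (LINT x|\<nu>. x ^ j) = vstate F \<xi> (X ^ j)" for j :: nat
  proof -
    have "(LINT x|\<nu>. x ^ j) = (LINT x|\<mu>. (n * x) ^ j)" unfolding \<nu>_def by (rule integral_distr[OF msb]) simp
    also have "\<dots> = n ^ j * Re (vstate F \<xi> (Y ^ j))"
      unfolding power_mult_distrib by (simp only: integral_mult_right_zero mom L_def powm m01 pevpow pevX)
    also have "complex_of_real \<dots> = complex_of_real (n ^ j) * vstate F \<xi> (Y ^ j)"
      using vstate_sos[OF sos_power_product[OF Yadj Ysos Zsos, of j 0] F, of \<xi>] by simp
    also have "\<dots> = vstate F \<xi> (cs (complex_of_real (n ^ j)) (Y ^ j))" by (simp only: vstate_cs)
    also have "cs (complex_of_real (n ^ j)) (Y ^ j) = X ^ j"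
    proof -
      have "X = n *\<^sub>R Y" using n by (simp add: Y_def scaleR_conv_cs cs_cs)
      thus ?thesis unfolding scaleR_conv_cs[symmetric] by (simp only: scaleR_power)
    qed
    finally show ?thesis .
  qed
  ultimately show ?thesis using that by blast
qed

section \<open>Commutants as \<open>C\<^sup>*\<close>-algebras in a given universe\<close>

text \<open>The lower Dedekind cuts of the real and imaginary parts of all entries form a subset of
  a countable set that determines the matrix; the flag \<open>b\<close> selects the part. Sets of
  naturals are equipotent to the reals.\<close>

lemma bmat_embeds:
  assumes "(UNIV :: real set) \<lesssim> (UNIV :: 'u set)"
  shows "\<exists>E :: 'i::countable bmat \<Rightarrow> 'u. inj E"
proof -
  define g :: "'i bmat \<Rightarrow> nat set" where "g M = to_nat ` {(i, j, b, r :: rat).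
    real_of_rat r < (if b then Re (ent M i j) else Im (ent M i j))}" for M
  have "inj g"
  proof (rule injI)
    fix M N assume "g M = g N"
    hence eq: "{(i, j, b, r :: rat). real_of_rat r < (if b then Re (ent M i j) else Im (ent M i j))}
      = {(i, j, b, r). real_of_rat r < (if b then Re (ent N i j) else Im (ent N i j))}"
      unfolding g_def by (simp add: inj_image_eq_iff)
    have q: "real_of_rat r < (if b then Re (ent M i j) else Im (ent M i j))
        \<longleftrightarrow> real_of_rat r < (if b then Re (ent N i j) else Im (ent N i j))" for i j b r
      using arg_cong[OF eq, of "\<lambda>S. (i, j, b, r) \<in> S"] by simp
    have le: "x \<le> y" if "\<And>r. real_of_rat r < x \<Longrightarrow> real_of_rat r < y" for x y
    proof (rule ccontr)
      assume "\<not> x \<le> y"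
      then obtain r where "y < real_of_rat r" "real_of_rat r < x" using of_rat_dense[of y x] by auto
      thus False using that[of r] by simp
    qed
    show "M = N"
    proof (rule bmat_eqI)
      fix i j
      have "Re (ent M i j) = Re (ent N i j)" using q[of _ True i j] by (intro antisym le) simp_all
      moreover have "Im (ent M i j) = Im (ent N i j)" using q[of _ False i j] by (intro antisym le) simp_all
      ultimately show "ent M i j = ent N i j" by (simp add: complex_eq_iff)
    qed
  qed
  moreover obtain f :: "nat set \<Rightarrow> real" where f: "inj f"
    using eqpoll_imp_lepoll[OF nat_sets_eqpoll_reals] unfolding lepoll_def by auto
  moreover obtain h :: "real \<Rightarrow> 'u" where h: "inj h" using assms unfolding lepoll_def by auto
  ultimately have "inj (h \<circ> (f \<circ> g))" by (intro inj_compose)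
  thus ?thesis by blast
qed

text \<open>The structure is carried along the injection \<open>E\<close> into the universe, with
  \<open>D\<close> inverting it. Closure of \<open>R\<close> under adjoints makes the commutant
  closed under the involution.\<close>

locale bmat_model =
  fixes E :: "'i bmat \<Rightarrow> 'u" and R :: "'i bmat set"
  assumes inj_E: "inj E" and adj_R: "adj ` R \<subseteq> R"
begin

definition D :: "'u \<Rightarrow> 'i bmat" where "D = inv_into UNIV E"

lemma D_E [simp]: "D (E x) = x"
  unfolding D_def using inj_E by simp

lemma E_eq_iff [simp]: "E x = E y \<longleftrightarrow> x = y"
  using inj_E by (auto dest: injD)

definition alg :: "'u cstar_alg" where
  "alg = \<lparr>carrier = E ` commutant R, monoid.mult = (\<lambda>x y. E (D x * D y)), one = E 1,
     zero = E 0, add = (\<lambda>x y. E (D x + D y)), smult = (\<lambda>c x. E (cs c (D x))),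
     star = (\<lambda>x. E (adj (D x))), cnorm = (\<lambda>x. norm (D x))\<rparr>"

lemma alg_simps [simp]:
  "carrier alg = E ` commutant R" "E x \<otimes>\<^bsub>alg\<^esub> E y = E (x * y)" "\<one>\<^bsub>alg\<^esub> = E 1" "\<zero>\<^bsub>alg\<^esub> = E 0"
  "E x \<oplus>\<^bsub>alg\<^esub> E y = E (x + y)" "c \<odot>\<^bsub>alg\<^esub> E x = E (cs c x)" "star alg (E x) = E (adj x)"
  "cnorm alg (E x) = norm x"
  by (simp_all add: alg_def)

lemma alg_ring: "ring alg"
proof (rule ringI)
  show "abelian_group alg"
  proof (rule abelian_groupI)
    fix x assume "x \<in> carrier alg"
    then obtain u where u: "x = E u" "u \<in> commutant R" by auto
    thus "\<exists>y\<in>carrier alg. y \<oplus>\<^bsub>alg\<^esub> x = \<zero>\<^bsub>alg\<^esub>"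
      by (intro bexI[of _ "E (- u)"]) (auto simp: commutant_uminus)
  qed (auto simp: commutant_add commutant_0 algebra_simps)
  show "Group.monoid alg"
    by (rule monoidI) (auto simp: commutant_times commutant_1 mult.assoc)
qed (auto simp: algebra_simps)

lemma alg_minus:
  assumes "x \<in> commutant R" and "y \<in> commutant R"
  shows "E x \<ominus>\<^bsub>alg\<^esub> E y = E (x - y)"
proof -
  interpret ring alg by (rule alg_ring)
  have "\<ominus>\<^bsub>alg\<^esub> E y = E (- y)"
    using assms by (intro minus_equality) (auto simp: commutant_uminus)
  thus ?thesis by (simp add: a_minus_def)
qed

lemma alg_cstar: "unital_cstar_algebra alg"
proof -
  interpret ring alg by (rule alg_ring)
  show ?thesis
  proof (unfold_locales, goal_cases)
    \<comment> \<open>Completeness, the one axiom that is no direct matrix computation: the sequence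
      converges among all bounded matrices, and the commutant is closed.\<close>
    case (19 X)
    have X: "X n = E (D (X n))" "D (X n) \<in> commutant R" for n using 19(1)[of n] by auto
    have m: "cnorm alg (X m \<ominus>\<^bsub>alg\<^esub> X n) = norm (D (X m) - D (X n))" for m n
      by (subst X(1)[of m], subst X(1)[of n]) (simp add: alg_minus X(2))
    have "Cauchy (\<lambda>n. D (X n))"
      unfolding Cauchy_def dist_norm using 19(2) unfolding m by blast
    then obtain y where y: "(\<lambda>n. D (X n)) \<longlonglongrightarrow> y" using Cauchy_convergent convergent_def by blast
    have yR: "y \<in> commutant R" by (rule closed_commutant[OF X(2) y])
    have "cnorm alg (X n \<ominus>\<^bsub>alg\<^esub> E y) = norm (D (X n) - y)" for n
      by (subst X(1)[of n]) (simp add: alg_minus X(2) yR)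
    moreover have "(\<lambda>n. norm (D (X n) - y)) \<longlonglongrightarrow> 0" using y by (simp add: LIM_zero tendsto_norm_zero)
    ultimately show ?case using yR by (intro bexI[of _ "E y"]) auto
  qed (auto simp: commutant_cs commutant_adj[OF adj_R] cs_add_left cs_add_right cs_cs cs_mult_left
      cs_mult_right adj_add adj_cs adj_times norm_cs norm_triangle_ineq norm_mult_ineq norm_adj_times)
qed

sublocale A: unital_cstar_algebra alg by (rule alg_cstar)

lemma poly_at_E: "x \<in> commutant R \<Longrightarrow> poly_at alg Q (E x) = E (pev Q x)"
  by (induction Q) (simp_all add: A.poly_at_pCons pev_pCons)

lemma list_mult_E: "list_mult alg (map (\<lambda>j. E (f j)) xs) = E (prod_list (map f xs))"
  by (induction xs) (simp_all add: list_mult_def)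

lemma spectrum_E:
  assumes x: "x \<in> commutant R"
  shows "spectrum alg (E x) = bspec x"
proof -
  have "E (cs z 1 - x) \<in> Units alg \<longleftrightarrow> invertible_bmat (cs z 1 - x)" for z
  proof -
    have zx: "cs z 1 - x \<in> commutant R" by (intro commutant_minus commutant_cs commutant_1 x)
    show ?thesis
      using commutant_inverse[OF zx] zx unfolding Units_def invertible_bmat_def by auto
  qed
  thus ?thesis unfolding spectrum_def bspec_def
    by (simp add: alg_minus commutant_cs commutant_1 x)
qed

lemma cstar_abs_E:
  assumes x: "x \<in> commutant R" and sa: "adj x = x"
  obtains y where "is_abs x y" and "cstar_abs alg (E x) = E y"
proof -
  obtain h y where y: "is_abs x y" and lim: "(\<lambda>n. x * pev (h n) x) \<longlonglongrightarrow> y"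
    and uniq: "\<And>z. is_abs x z \<Longrightarrow> z = y"
    by (rule abs_bmat_exists[OF sa]) blast
  have yR: "y \<in> commutant R"
    by (rule closed_commutant[OF _ lim]) (intro commutant_times commutant_pev x)
  have eq: "(\<forall>Q. uniform_limit (spectrum alg (E x)) (\<lambda>n. poly (Q n)) (\<lambda>z. complex_of_real (cmod z)) sequentially \<longrightarrow>
          (\<lambda>n. cnorm alg (poly_at alg (Q n) (E x) \<ominus>\<^bsub>alg\<^esub> E z)) \<longlonglongrightarrow> 0) \<longleftrightarrow> is_abs x z"
    if z: "z \<in> commutant R" for z
    unfolding is_abs_def spectrum_E[OF x] poly_at_E[OF x] alg_minus[OF commutant_pev[OF x] z] alg_simps
      tendsto_norm_zero_iff LIM_zero_iff ..
  have "cstar_abs alg (E x) = E y"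
    unfolding cstar_abs_def cont_fun_calc_def
  proof (rule the_equality)
    show "E y \<in> carrier alg \<and> (\<forall>Q. uniform_limit (spectrum alg (E x)) (\<lambda>n. poly (Q n)) (\<lambda>z. complex_of_real (cmod z)) sequentially \<longrightarrow>
          (\<lambda>n. cnorm alg (poly_at alg (Q n) (E x) \<ominus>\<^bsub>alg\<^esub> E y)) \<longlonglongrightarrow> 0)"
      unfolding eq[OF yR] using y yR by simp
    fix v assume v: "v \<in> carrier alg \<and> (\<forall>Q. uniform_limit (spectrum alg (E x)) (\<lambda>n. poly (Q n)) (\<lambda>z. complex_of_real (cmod z)) sequentially \<longrightarrow>
          (\<lambda>n. cnorm alg (poly_at alg (Q n) (E x) \<ominus>\<^bsub>alg\<^esub> v)) \<longlonglongrightarrow> 0)"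
    then obtain z where z: "v = E z" "z \<in> commutant R" by auto
    have "is_abs x z" using conjunct2[OF v] unfolding z(1) eq[OF z(2)] .
    thus "v = E y" using uniq z by simp
  qed
  thus ?thesis using that y by blast
qed

lemma unital_subalgebra_E:
  assumes B: "B \<subseteq> commutant R" and "1 \<in> B" and "\<And>x y. x \<in> B \<Longrightarrow> y \<in> B \<Longrightarrow> x + y \<in> B"
    and "\<And>x y. x \<in> B \<Longrightarrow> y \<in> B \<Longrightarrow> x * y \<in> B" and cs: "\<And>c x. x \<in> B \<Longrightarrow> cs c x \<in> B"
  shows "unital_subalgebra alg (E ` B)"
  unfolding unital_subalgebra_def
proof
  show "subring (E ` B) alg"
  proof (rule A.subringI)
    fix h assume "h \<in> E ` B"
    then obtain x where x: "h = E x" "x \<in> B" by auto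
    have "\<ominus>\<^bsub>alg\<^esub> h = (- 1) \<odot>\<^bsub>alg\<^esub> h" using x B by (subst A.smult_minus_one) auto
    thus "\<ominus>\<^bsub>alg\<^esub> h \<in> E ` B" using cs[OF x(2), of "-1"] x by simp
  qed (use assms in auto)
  show "\<forall>c. \<forall>x\<in>E ` B. c \<odot>\<^bsub>alg\<^esub> x \<in> E ` B" using cs by auto
qed

end

lemma integral_bernoulli_measure:
  fixes f :: "real \<Rightarrow> real"
  assumes "p \<in> {0..1}" and "f \<in> borel_measurable borel"
  shows "(LINT x|bernoulli_measure p. f x) = p * f 1 + (1 - p) * f 0"
proof -
  have "(LINT x|bernoulli_measure p. f x) = (LINT b|measure_pmf (bernoulli_pmf p). f (of_bool b))"
    unfolding bernoulli_measure_def using assms(2) by (intro integral_distr) auto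
  also have "\<dots> = p * f 1 + (1 - p) * f 0"
    using assms(1) by (subst integral_measure_pmf_real[of UNIV]) (auto simp: UNIV_bool)
  finally show ?thesis .
qed

lemma compactly_supported_bernoulli_measure:
  assumes "p \<in> {0..1}"
  shows "compactly_supported_prob (bernoulli_measure p)"
  unfolding compactly_supported_prob_def
proof (intro conjI exI[of _ "{0..1}"])
  show "prob_space (bernoulli_measure p)"
    unfolding bernoulli_measure_def by (intro prob_space.prob_space_distr prob_space_measure_pmf) auto
  show "emeasure (bernoulli_measure p) (- {0..1}) = 0"
    by (subst emeasure_bernoulli_measure[OF assms]) auto
qed (auto simp: bernoulli_measure_def)

section \<open>Tracial vector states on a commutant and the laws of its elements\<close>

locale bmat_state = bmat_model E R for E :: "'i bmat \<Rightarrow> 'u" and R +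
  fixes F :: "'i set" and \<xi> :: "'i \<Rightarrow> complex"
  assumes finite_F: "finite F" and unit: "L2_set (\<lambda>i. cmod (\<xi> i)) F = 1"
    and trace: "\<And>X Y. X \<in> commutant R \<Longrightarrow> Y \<in> commutant R \<Longrightarrow> vstate F \<xi> (X * Y) = vstate F \<xi> (Y * X)"
begin

definition \<tau> :: "'u \<Rightarrow> complex" where "\<tau> x = vstate F \<xi> (D x)"

lemma \<tau>_E [simp]: "\<tau> (E x) = vstate F \<xi> x"
  by (simp add: \<tau>_def)

sublocale tracial_nc_prob_space alg \<tau>
proof (unfold_locales, goal_cases)
  case (3 x)
  then show ?case by (auto simp: vstate_adj_times_self[OF finite_F])
next
  case 4
  show ?case using vstate_one[OF finite_F, of \<xi>] by (simp add: unit)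
qed (auto simp: vstate_add vstate_cs trace)

lemma has_distribution_E:
  assumes X: "X \<in> commutant R" "adj X = X" and \<mu>: "compactly_supported_prob \<mu>"
    and mom: "\<And>j::nat. complex_of_real (LINT x|\<mu>. x ^ j) = vstate F \<xi> (X ^ j)"
  shows "has_distribution alg \<tau> (E X) \<mu>"
  unfolding has_distribution_def
proof (intro conjI allI)
  show "self_adjoint alg (E X)" using X by (simp add: self_adjoint_def)
  show "compactly_supported_prob \<mu>" by fact
  fix Q :: "complex poly"
  obtain K where K: "AE x in \<mu>. \<bar>x\<bar> \<le> K" using compactly_supported_AE_bound[OF \<mu>] by blast
  interpret real_distribution \<mu> by (rule compactly_supported_real_distribution[OF \<mu>])
  have int: "integrable \<mu> (\<lambda>x. complex_of_real (x ^ i))" for i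
    using integrable_bounded_power[OF K, of i] by (rule integrable_of_real)
  have "(LINT x|\<mu>. poly Q (complex_of_real x))
      = (LINT x|\<mu>. (\<Sum>i\<le>Polynomial.degree Q. Polynomial.coeff Q i * complex_of_real (x ^ i)))"
    by (simp add: poly_altdef)
  also have "\<dots> = (\<Sum>i\<le>Polynomial.degree Q. (LINT x|\<mu>. Polynomial.coeff Q i * complex_of_real (x ^ i)))"
    by (intro Bochner_Integration.integral_sum integrable_mult_right int)
  also have "\<dots> = (\<Sum>i\<le>Polynomial.degree Q. Polynomial.coeff Q i * vstate F \<xi> (X ^ i))"
    by (simp only: integral_mult_right_zero integral_complex_of_real mom)
  also have "\<dots> = vstate F \<xi> (pev Q X)"
  proof -
    have z: "vstate F \<xi> 0 = 0" using vstate_cs[of F \<xi> 0 0] by simp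
    have "vstate F \<xi> (\<Sum>i\<in>I. f i) = (\<Sum>i\<in>I. vstate F \<xi> (f i))" for I and f :: "nat \<Rightarrow> 'i bmat"
      by (induction I rule: infinite_finite_induct) (simp_all add: z vstate_add)
    thus ?thesis by (simp add: pev_def vstate_cs)
  qed
  also have "\<dots> = \<tau> (poly_at alg Q (E X))" by (simp add: poly_at_E[OF X(1)])
  finally show "(LINT x|\<mu>. poly Q (complex_of_real x)) = \<tau> (poly_at alg Q (E X))" .
qed

lemma sum_of_projections_has_distribution:
  assumes K: "finite K"
    and a: "\<And>k. k \<in> K \<Longrightarrow> a k \<in> commutant R" "\<And>k. k \<in> K \<Longrightarrow> adj (a k) = a k" "\<And>k. k \<in> K \<Longrightarrow> a k * a k = a k"
  obtains \<mu> where "has_distribution alg \<tau> (E (\<Sum>k\<in>K. a k)) \<mu>"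
proof -
  obtain \<mu> where \<mu>: "compactly_supported_prob \<mu>" "\<And>j::nat. complex_of_real (LINT x|\<mu>. x ^ j) = vstate F \<xi> ((\<Sum>k\<in>K. a k) ^ j)"
    by (rule sum_of_projections_distribution[OF finite_F unit K a(2,3) refl]) blast+
  have "(\<Sum>k\<in>K. a k) \<in> commutant R"
    using a(1) by (induction K rule: infinite_finite_induct) (auto simp: commutant_0 commutant_add)
  moreover have "adj (\<Sum>k\<in>K. a k) = (\<Sum>k\<in>K. a k)"
    using a(2) by (induction K rule: infinite_finite_induct) (auto simp: adj_add)
  ultimately show ?thesis using that has_distribution_E \<mu> by blast
qed

lemma projection_has_distribution:
  assumes a: "a \<in> commutant R" "adj a = a" "a * a = a" and p: "p \<in> {0..1}"
    and t: "vstate F \<xi> a = complex_of_real p"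
  shows "has_distribution alg \<tau> (E a) (bernoulli_measure p)"
proof (rule has_distribution_E[OF a(1,2) compactly_supported_bernoulli_measure[OF p]])
  fix j :: nat
  have "vstate F \<xi> 1 = 1" using tau_one by simp
  moreover have "a ^ Suc i = a" for i by (induction i) (simp_all add: a(3))
  moreover have "(LINT x|bernoulli_measure p. x ^ j) = p * 1 ^ j + (1 - p) * 0 ^ j"
    by (rule integral_bernoulli_measure[OF p]) simp
  ultimately show "complex_of_real (LINT x|bernoulli_measure p. x ^ j) = vstate F \<xi> (a ^ j)"
    using t by (cases j) (simp_all del: power_Suc)
qed

end

section \<open>Matrices acting on one syllable\<close>

text \<open>Schur's test: the modulus of an entry is split into two square roots, one joined to
  \<open>\<eta>\<close> and one to \<open>\<xi>\<close>, and Cauchy-Schwarz is applied on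
  \<open>F \<times> G\<close>. The row sums control the first factor, the column sums the
  second.\<close>

lemma mbound_Schur:
  assumes C: "0 \<le> C"
    and row: "\<And>i G. finite G \<Longrightarrow> (\<Sum>j\<in>G. cmod (M i j)) \<le> C"
    and col: "\<And>j G. finite G \<Longrightarrow> (\<Sum>i\<in>G. cmod (M i j)) \<le> C"
  shows "mbound M C"
proof (rule mboundI[OF C])
  fix F G :: "'a set" and \<eta> \<xi> :: "'a \<Rightarrow> complex" assume F: "finite F" and G: "finite G"
  define u where "u = (\<lambda>(i, j). sqrt (cmod (M i j)) * cmod (\<eta> i))"
  define v where "v = (\<lambda>(i, j). sqrt (cmod (M i j)) * cmod (\<xi> j))"
  have uv: "\<bar>u (i, j)\<bar> * \<bar>v (i, j)\<bar> = cmod (\<eta> i * M i j * \<xi> j)" for i j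
  proof -
    have "\<bar>u (i, j)\<bar> * \<bar>v (i, j)\<bar> = (sqrt (cmod (M i j)) * sqrt (cmod (M i j))) * (cmod (\<eta> i) * cmod (\<xi> j))"
      by (simp add: u_def v_def abs_mult mult_ac del: real_sqrt_mult_self)
    thus ?thesis by (simp add: norm_mult mult_ac)
  qed
  have "L2_set u (F \<times> G) \<le> sqrt (C * (\<Sum>i\<in>F. (cmod (\<eta> i))\<^sup>2))"
  proof -
    have "(\<Sum>w\<in>F \<times> G. (u w)\<^sup>2) = (\<Sum>i\<in>F. (\<Sum>j\<in>G. cmod (M i j)) * (cmod (\<eta> i))\<^sup>2)"
      by (simp add: sum.cartesian_product' u_def power_mult_distrib sum_distrib_right split_def)
    also have "\<dots> \<le> (\<Sum>i\<in>F. C * (cmod (\<eta> i))\<^sup>2)" by (intro sum_mono mult_right_mono row G) auto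
    finally show ?thesis by (simp add: L2_set_def sum_distrib_left)
  qed
  moreover have "L2_set v (F \<times> G) \<le> sqrt (C * (\<Sum>j\<in>G. (cmod (\<xi> j))\<^sup>2))"
  proof -
    have "(\<Sum>w\<in>F \<times> G. (v w)\<^sup>2) = (\<Sum>j\<in>G. \<Sum>i\<in>F. cmod (M i j) * (cmod (\<xi> j))\<^sup>2)"
      unfolding sum.cartesian_product' v_def by (subst sum.swap) (simp add: power_mult_distrib split_def)
    also have "\<dots> = (\<Sum>j\<in>G. (\<Sum>i\<in>F. cmod (M i j)) * (cmod (\<xi> j))\<^sup>2)" by (simp add: sum_distrib_right)
    also have "\<dots> \<le> (\<Sum>j\<in>G. C * (cmod (\<xi> j))\<^sup>2)" by (intro sum_mono mult_right_mono col F) auto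
    finally show ?thesis by (simp add: L2_set_def sum_distrib_left)
  qed
  ultimately have uvb: "L2_set u (F \<times> G) * L2_set v (F \<times> G)
      \<le> sqrt (C * (\<Sum>i\<in>F. (cmod (\<eta> i))\<^sup>2)) * sqrt (C * (\<Sum>j\<in>G. (cmod (\<xi> j))\<^sup>2))"
    by (intro mult_mono) (auto simp: C sum_nonneg)
  have "cmod (\<Sum>i\<in>F. \<Sum>j\<in>G. \<eta> i * M i j * \<xi> j) \<le> (\<Sum>i\<in>F. \<Sum>j\<in>G. cmod (\<eta> i * M i j * \<xi> j))"
    by (rule order_trans[OF norm_sum sum_mono[OF norm_sum]])
  also have "\<dots> = (\<Sum>w\<in>F \<times> G. \<bar>u w\<bar> * \<bar>v w\<bar>)" by (simp add: sum.cartesian_product' uv)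
  also have "\<dots> \<le> L2_set u (F \<times> G) * L2_set v (F \<times> G)" by (rule L2_set_mult_ineq)
  also note uvb
  also have "sqrt (C * (\<Sum>i\<in>F. (cmod (\<eta> i))\<^sup>2)) * sqrt (C * (\<Sum>j\<in>G. (cmod (\<xi> j))\<^sup>2))
      = C * (L2_set (\<lambda>i. cmod (\<eta> i)) F * L2_set (\<lambda>j. cmod (\<xi> j)) G)"
    using C by (simp add: L2_set_def real_sqrt_mult)
  finally show "cmod (\<Sum>i\<in>F. \<Sum>j\<in>G. \<eta> i * M i j * \<xi> j)
       \<le> C * (L2_set (\<lambda>i. cmod (\<eta> i)) F * L2_set (\<lambda>j. cmod (\<xi> j)) G)" .
qed

text \<open>\<open>w \<mapsto> (head k w, tail k w)\<close> splits off the \<open>k\<close>-th tensor or free factor, whose basis is indexed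
  by \<open>{0, 1, 2}\<close> with \<open>0\<close> the vacuum.\<close>

locale syllables =
  fixes W :: "'i set" and I :: "nat set" and head :: "nat \<Rightarrow> 'i \<Rightarrow> nat" and tail :: "nat \<Rightarrow> 'i \<Rightarrow> 'i"
  assumes head_less: "k \<in> I \<Longrightarrow> w \<in> W \<Longrightarrow> head k w < 3"
    and head_tail_inj: "k \<in> I \<Longrightarrow> v \<in> W \<Longrightarrow> w \<in> W \<Longrightarrow> head k v = head k w \<Longrightarrow> tail k v = tail k w \<Longrightarrow> v = w"
    and head_tail_surj: "k \<in> I \<Longrightarrow> w \<in> W \<Longrightarrow> i < 3 \<Longrightarrow> \<exists>v\<in>W. head k v = i \<and> tail k v = tail k w"
begin

definition subst_head :: "nat \<Rightarrow> nat \<Rightarrow> 'i \<Rightarrow> 'i" where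
  "subst_head k i w = (SOME v. v \<in> W \<and> head k v = i \<and> tail k v = tail k w)"

lemma subst_head:
  assumes "k \<in> I" and "w \<in> W" and "i < 3"
  shows "subst_head k i w \<in> W" "head k (subst_head k i w) = i" "tail k (subst_head k i w) = tail k w"
proof -
  have "\<exists>v. v \<in> W \<and> head k v = i \<and> tail k v = tail k w" using head_tail_surj[OF assms] by blast
  from someI_ex[OF this] show "subst_head k i w \<in> W" "head k (subst_head k i w) = i"
    "tail k (subst_head k i w) = tail k w" by (auto simp: subst_head_def)
qed

lemma subst_head_eqI:
  assumes "k \<in> I" and "w \<in> W" and "v \<in> W" and "head k v = i" and "tail k v = tail k w"
  shows "subst_head k i w = v"
proof -
  have i: "i < 3" using assms(4) head_less[OF assms(1,3)] by simp
  show ?thesis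
    by (rule head_tail_inj[OF assms(1) subst_head(1)[OF assms(1,2) i] assms(3)])
      (simp_all add: subst_head[OF assms(1,2) i] assms(4,5))
qed

lemma fiber_sum:
  fixes f :: "'i \<Rightarrow> complex"
  assumes k: "k \<in> I" and w: "w \<in> W"
    and f: "\<And>u. \<not> (u \<in> W \<and> tail k u = tail k w) \<Longrightarrow> f u = 0"
  shows "(\<Sum>\<^sub>\<infinity>u. f u) = (\<Sum>i<3. f (subst_head k i w))"
proof -
  have "(\<Sum>\<^sub>\<infinity>u. f u) = (\<Sum>\<^sub>\<infinity>u\<in>{u \<in> W. tail k u = tail k w}. f u)"
    by (rule infsum_cong_neutral) (use f in auto)
  also have "\<dots> = (\<Sum>\<^sub>\<infinity>i\<in>{..<3}. f (subst_head k i w))"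
    by (rule infsum_reindex_bij_witness[where j="head k" and i="\<lambda>i. subst_head k i w"])
      (use k w subst_head[OF k w] head_less[OF k] subst_head_eqI[OF k w] in auto)
  also have "\<dots> = (\<Sum>i<3. f (subst_head k i w))" by simp
  finally show ?thesis .
qed

text \<open>Under the splitting of words into head and tail this is \<open>x\<close> tensored with
  the identity. Basis vectors outside \<open>W\<close> are annihilated, so the identity matrix in
  place of \<open>x\<close> gives the projection onto the span of \<open>W\<close>, which may differ
  from 1.\<close>

definition Lam :: "nat \<Rightarrow> (nat \<Rightarrow> nat \<Rightarrow> real) \<Rightarrow> 'i bmat" where
  "Lam k x = Abs_bmat (\<lambda>v w. if v \<in> W \<and> w \<in> W \<and> tail k v = tail k w
     then complex_of_real (x (head k v) (head k w)) else 0)"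

lemma ent_Lam:
  assumes k: "k \<in> I"
  shows "ent (Lam k x) v w = (if v \<in> W \<and> w \<in> W \<and> tail k v = tail k w
     then complex_of_real (x (head k v) (head k w)) else 0)"
proof -
  let ?M = "\<lambda>v w. if v \<in> W \<and> w \<in> W \<and> tail k v = tail k w
     then complex_of_real (x (head k v) (head k w)) else 0"
  define B where "B = (\<Sum>i<3. \<Sum>j<3. \<bar>x i j\<bar>)"
  have B0: "0 \<le> B" by (simp add: B_def sum_nonneg)
  have B: "cmod (?M v w) \<le> B" for v w
  proof (cases "v \<in> W \<and> w \<in> W")
    case True
    hence h: "head k v < 3" "head k w < 3" using head_less[OF k] by auto
    have "\<bar>x (head k v) (head k w)\<bar> \<le> (\<Sum>j<3. \<bar>x (head k v) j\<bar>)"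
      using h by (intro member_le_sum) auto
    also have "\<dots> \<le> B" unfolding B_def using h
      by (intro member_le_sum[where f="\<lambda>i. \<Sum>j<3. \<bar>x i j\<bar>"]) (auto intro: sum_nonneg)
    finally show ?thesis using B0 by auto
  qed (use B0 in auto)
  have card3: "card {w \<in> G. w \<in> W \<and> tail k w = t} \<le> 3" for G t
  proof -
    have "card {w \<in> G. w \<in> W \<and> tail k w = t} \<le> card {..<3::nat}"
      proof (rule card_inj_on_le[where f="head k"])
      show "inj_on (head k) {w \<in> G. w \<in> W \<and> tail k w = t}"
      proof (rule inj_onI)
        fix u v assume "u \<in> {w \<in> G. w \<in> W \<and> tail k w = t}" "v \<in> {w \<in> G. w \<in> W \<and> tail k w = t}"
          "head k u = head k v"
        thus "u = v" using head_tail_inj[OF k, of u v] by simp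
      qed
      show "head k ` {w \<in> G. w \<in> W \<and> tail k w = t} \<subseteq> {..<3}" using head_less[OF k] by auto
    qed simp
    thus ?thesis by simp
  qed
  have sum3: "(\<Sum>w\<in>G. cmod (g w)) \<le> 3 * B"
    if G: "finite G" and g: "\<And>w. cmod (g w) \<le> B" "\<And>w. \<not> (w \<in> W \<and> tail k w = t) \<Longrightarrow> g w = 0" for G t and g :: "'i \<Rightarrow> complex"
  proof -
    have "(\<Sum>w\<in>G. cmod (g w)) = (\<Sum>w\<in>{w \<in> G. w \<in> W \<and> tail k w = t}. cmod (g w))"
      using G g(2) by (intro sum.mono_neutral_right) auto
    also have "\<dots> \<le> real (card {w \<in> G. w \<in> W \<and> tail k w = t}) * B"
      using g(1) by (intro sum_bounded_above) auto
    also have "\<dots> \<le> 3 * B" using card3[of G t] B0 by (intro mult_right_mono) auto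
    finally show ?thesis .
  qed
  \<comment> \<open>A word is determined by its tail and one of three heads, so every row and column
    has at most three nonzero entries, each of modulus at most \<open>B\<close>.\<close>
  have "mbound ?M (3 * B)"
  proof (rule mbound_Schur)
    show "(\<Sum>w\<in>G. cmod (?M v w)) \<le> 3 * B" if "finite G" for v G
      by (rule sum3[OF that B, of "tail k v"]) auto
    show "(\<Sum>v\<in>G. cmod (?M v w)) \<le> 3 * B" if "finite G" for w G
      by (rule sum3[OF that B, of "tail k w"]) auto
  qed (use B0 in simp)
  hence "ent (Abs_bmat ?M) = ?M" by (intro Abs_bmat_inverse) blast
  thus ?thesis by (simp add: Lam_def)
qed

lemma ent_times_Lam:
  assumes k: "k \<in> I"
  shows "ent (M * Lam k x) v w
    = (if w \<in> W then \<Sum>i<3. ent M v (subst_head k i w) * complex_of_real (x i (head k w)) else 0)"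
proof (cases "w \<in> W")
  case True
  have "ent (M * Lam k x) v w = (\<Sum>i<3. ent M v (subst_head k i w) * ent (Lam k x) (subst_head k i w) w)"
    unfolding ent_times by (rule fiber_sum[OF k True]) (use k in \<open>auto simp: ent_Lam\<close>)
  thus ?thesis using True k by (auto simp: ent_Lam subst_head intro!: sum.cong)
qed (use k in \<open>simp add: ent_times ent_Lam\<close>)

lemma ent_Lam_times:
  assumes k: "k \<in> I"
  shows "ent (Lam k x * M) v w
    = (if v \<in> W then \<Sum>i<3. complex_of_real (x (head k v) i) * ent M (subst_head k i v) w else 0)"
proof (cases "v \<in> W")
  case True
  have "ent (Lam k x * M) v w = (\<Sum>i<3. ent (Lam k x) v (subst_head k i v) * ent M (subst_head k i v) w)"
    unfolding ent_times by (rule fiber_sum[OF k True]) (use k in \<open>auto simp: ent_Lam\<close>)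
  thus ?thesis using True k by (auto simp: ent_Lam subst_head intro!: sum.cong)
qed (use k in \<open>simp add: ent_times ent_Lam\<close>)

lemma Lam_times:
  assumes k: "k \<in> I"
  shows "Lam k x * Lam k y = Lam k (\<lambda>i j. \<Sum>l<3. x i l * y l j)"
proof (rule bmat_eqI)
  fix v w
  show "ent (Lam k x * Lam k y) v w = ent (Lam k (\<lambda>i j. \<Sum>l<3. x i l * y l j)) v w"
  proof (cases "v \<in> W")
    case True
    thus ?thesis unfolding ent_Lam_times[OF k] ent_Lam[OF k]
      using subst_head[OF k] by (auto intro!: sum.cong)
  qed (simp add: ent_Lam_times[OF k] ent_Lam[OF k])
qed

lemma Lam_diff: "k \<in> I \<Longrightarrow> Lam k x - Lam k y = Lam k (\<lambda>i j. x i j - y i j)"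
  by (rule bmat_eqI) (simp add: minus_bmat.rep_eq ent_Lam)

lemma Lam_cong: "k \<in> I \<Longrightarrow> (\<And>i j. i < 3 \<Longrightarrow> j < 3 \<Longrightarrow> x i j = y i j) \<Longrightarrow> Lam k x = Lam k y"
  by (rule bmat_eqI) (simp add: ent_Lam head_less)

lemma adj_Lam: "k \<in> I \<Longrightarrow> adj (Lam k x) = Lam k (\<lambda>i j. x j i)"
  by (rule bmat_eqI) (auto simp: adj.rep_eq ent_Lam)

end

text \<open>\<open>rot U f\<close> is multiplication by \<open>f\<close> on the three-point space, in the orthonormal basis given by
  the rows of \<open>U\<close>.\<close>

definition rot :: "(nat \<Rightarrow> nat \<Rightarrow> real) \<Rightarrow> (nat \<Rightarrow> real) \<Rightarrow> nat \<Rightarrow> nat \<Rightarrow> real" where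
  "rot U f i j = (\<Sum>s<3. f s * U i s * U j s)"

definition orthogonal3 :: "(nat \<Rightarrow> nat \<Rightarrow> real) \<Rightarrow> bool" where
  "orthogonal3 U \<longleftrightarrow> (\<forall>i<3. \<forall>j<3. (\<Sum>s<3. U i s * U j s) = of_bool (i = j)) \<and>
     (\<forall>s<3. \<forall>t<3. (\<Sum>i<3. U i s * U i t) = of_bool (s = t))"

lemma rot_sym: "rot U f i j = rot U f j i"
  by (simp add: rot_def mult_ac)

lemma rot_times:
  assumes "orthogonal3 U"
  shows "(\<Sum>l<3. rot U f i l * rot U g l j) = rot U (\<lambda>s. f s * g s) i j"
proof -
  have "(\<Sum>l<3. rot U f i l * rot U g l j)
      = (\<Sum>l<3. \<Sum>s<3. \<Sum>t<3. f s * U i s * (g t * U j t) * (U l s * U l t))"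
    unfolding rot_def sum_product by (simp add: mult_ac)
  also have "\<dots> = (\<Sum>s<3. \<Sum>l<3. \<Sum>t<3. f s * U i s * (g t * U j t) * (U l s * U l t))" by (rule sum.swap)
  also have "\<dots> = (\<Sum>s<3. \<Sum>t<3. \<Sum>l<3. f s * U i s * (g t * U j t) * (U l s * U l t))"
    by (intro sum.cong refl sum.swap)
  also have "\<dots> = (\<Sum>s<3. \<Sum>t<3. f s * U i s * (g t * U j t) * of_bool (s = t))"
    using assms by (intro sum.cong refl) (simp add: sum_distrib_left[symmetric] orthogonal3_def)
  also have "\<dots> = rot U (\<lambda>s. f s * g s) i j"
    unfolding rot_def by (intro sum.cong refl) (simp add: of_bool_def mult_ac if_distrib cong: if_cong)
  finally show ?thesis .
qed

lemma rot_one: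
  assumes "orthogonal3 U" and "i < 3" and "j < 3"
  shows "rot U (\<lambda>_. 1) i j = of_bool (i = j)"
  using assms by (simp add: rot_def orthogonal3_def)

text \<open>This is cyclicity of the vacuum: row 0 of \<open>U\<close> represents the vacuum as a
  function on the three points, so multiplication by row \<open>i\<close> divided by row 0 sends it
  to the basis vector \<open>i\<close>.\<close>

lemma rot_cyclic:
  assumes "orthogonal3 U" and "\<And>s. s < 3 \<Longrightarrow> U 0 s \<noteq> 0" and "i < 3" and "j < 3"
  shows "rot U (\<lambda>s. U i s / U 0 s) 0 j = of_bool (i = j)"
proof -
  have "rot U (\<lambda>s. U i s / U 0 s) 0 j = (\<Sum>s<3. U i s * U j s)"
    unfolding rot_def using assms(2) by (intro sum.cong refl) simp
  thus ?thesis using assms by (simp add: orthogonal3_def)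
qed

lemma sum_lessThan_3: "(\<Sum>i<3. f i) = f 0 + f 1 + f (2::nat)" for f :: "nat \<Rightarrow> real"
  by (simp add: numeral_3_eq_3 numeral_2_eq_2)

text \<open>The square roots of the weights form a unit vector, which is completed to an orthonormal
  basis.\<close>

lemma orthogonal3_exists:
  fixes w :: "nat \<Rightarrow> real"
  assumes pos: "\<And>s. s < 3 \<Longrightarrow> 0 < w s" and one: "(\<Sum>s<3. w s) = 1"
  obtains U where "orthogonal3 U" and "\<And>s. s < 3 \<Longrightarrow> U 0 s = sqrt (w s)"
proof -
  define r c where "r = sqrt (w 0 + w 1)" and "c = sqrt (w 2)"
  define u v where "u = sqrt (w 0) / r" and "v = sqrt (w 1) / r"
  have w: "w 0 > 0" "w 1 > 0" "w 2 > 0" using pos by auto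
  have r: "r > 0" using w by (simp add: r_def)
  have rc: "r * r + c * c = 1" using one w by (simp add: r_def c_def sum_lessThan_3)
  have uv: "u * u + v * v = 1"
  proof -
    have "u * u + v * v = (w 0 + w 1) / (r * r)" using w by (simp add: u_def v_def add_divide_distrib)
    also have "r * r = w 0 + w 1" using w by (simp add: r_def)
    finally show ?thesis using w by simp
  qed
  \<comment> \<open>Spherical coordinates: with the unit pairs \<open>(u, v)\<close> and
    \<open>(r, c)\<close>, the first row is \<open>(u * r, v * r, c)\<close>, and the other two are
    the directions of longitude and latitude. The facts \<open>e0\<close> to \<open>e7\<close> are
    the scalar products of rows or columns that take more than one rewriting step.\<close>
  define U where "U i s = (if i = 0 then (if s = 0 then u * r else if s = 1 then v * r else c)
     else if i = 1 then (if s = 0 then - v else if s = 1 then u else 0)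
     else (if s = 0 then - u * c else if s = 1 then - v * c else r))" for i s :: nat
  have cr: "c * c + r * r = 1" and vu: "v * v + u * u = 1" using rc uv by (simp_all add: add.commute)
  have "u * r * (u * r) + v * r * (v * r) + c * c = (u * u + v * v) * (r * r) + c * c" by (simp add: algebra_simps)
  hence e0: "u * r * (u * r) + v * r * (v * r) + c * c = 1" by (simp add: uv rc cr vu)
  have "- (u * r * (u * c)) - v * r * (v * c) + c * r = c * r - (u * u + v * v) * (c * r)" by (simp add: algebra_simps)
  hence e1: "- (u * r * (u * c)) - v * r * (v * c) + c * r = 0" by (simp add: uv rc cr vu)
  have "- (u * c * (u * r)) - v * c * (v * r) + r * c = r * c - (u * u + v * v) * (r * c)" by (simp add: algebra_simps)
  hence e2: "- (u * c * (u * r)) - v * c * (v * r) + r * c = 0" by (simp add: uv rc cr vu)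
  have "u * c * (u * c) + v * c * (v * c) + r * r = (u * u + v * v) * (c * c) + r * r" by (simp add: algebra_simps)
  hence e3: "u * c * (u * c) + v * c * (v * c) + r * r = 1" by (simp add: uv rc cr vu)
  have "u * r * (u * r) + v * v + u * c * (u * c) = (u * u) * (r * r + c * c) + v * v" by (simp add: algebra_simps)
  hence e4: "u * r * (u * r) + v * v + u * c * (u * c) = 1" by (simp add: uv rc cr vu)
  have "u * r * (v * r) - v * u + u * c * (v * c) = (u * v) * (r * r + c * c) - u * v" by (simp add: algebra_simps)
  hence e5: "u * r * (v * r) - v * u + u * c * (v * c) = 0" by (simp add: uv rc cr vu)
  have "v * r * (u * r) - u * v + v * c * (u * c) = (u * v) * (r * r + c * c) - u * v" by (simp add: algebra_simps)
  hence e6: "v * r * (u * r) - u * v + v * c * (u * c) = 0" by (simp add: uv rc cr vu)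
  have "v * r * (v * r) + u * u + v * c * (v * c) = (v * v) * (r * r + c * c) + u * u" by (simp add: algebra_simps)
  hence e7: "v * r * (v * r) + u * u + v * c * (v * c) = 1" by (simp add: uv rc cr vu)
  have less3: "(\<forall>i<3. P i) \<longleftrightarrow> P 0 \<and> P 1 \<and> P (2::nat)" for P
    by (auto simp: numeral_3_eq_3 numeral_2_eq_2 less_Suc_eq)
  have "orthogonal3 U"
    unfolding orthogonal3_def less3 sum_lessThan_3 U_def
    by (simp add: uv vu cr e0 e1 e2 e3 e4 e5 e6 e7)
  moreover have "U 0 s = sqrt (w s)" if "s < 3" for s
    using that r by (auto simp: U_def u_def v_def c_def less_Suc_eq numeral_3_eq_3 numeral_2_eq_2)
  ultimately show ?thesis using that by blast
qed

section \<open>Word spaces\<close>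

lemma (in unital_cstar_algebra) unital_subalgebra_generated:
  assumes a: "a \<in> carrier A"
  shows "unital_subalgebra A (generated_algebra A a)"
proof -
  let ?T = "{t. unital_subalgebra A t \<and> {a} \<subseteq> t}"
  have G: "generated_algebra A a = \<Inter>?T" by (simp add: generated_algebra_def hull_def)
  have car: "carrier A \<in> ?T"
    using a smult_closed carrier_is_subring by (auto simp: unital_subalgebra_def)
  have sub: "subring t A" if "t \<in> ?T" for t using that by (simp add: unital_subalgebra_def)
  have "subring (\<Inter>?T) A"
  proof (rule subringI)
    show "\<Inter>?T \<subseteq> carrier A" using car by blast
    show "\<one> \<in> \<Inter>?T" using subringE(3)[OF sub] by blast
    show "\<And>h. h \<in> \<Inter>?T \<Longrightarrow> \<ominus> h \<in> \<Inter>?T" using subringE(5)[OF sub] by blast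
    show "\<And>h1 h2. h1 \<in> \<Inter>?T \<Longrightarrow> h2 \<in> \<Inter>?T \<Longrightarrow> h1 \<otimes> h2 \<in> \<Inter>?T" using subringE(6)[OF sub] by blast
    show "\<And>h1 h2. h1 \<in> \<Inter>?T \<Longrightarrow> h2 \<in> \<Inter>?T \<Longrightarrow> h1 \<oplus> h2 \<in> \<Inter>?T" using subringE(7)[OF sub] by blast
  qed
  moreover have "c \<odot> x \<in> \<Inter>?T" if "x \<in> \<Inter>?T" for c x using that by (auto simp: unital_subalgebra_def)
  ultimately show ?thesis unfolding G unital_subalgebra_def by blast
qed

text \<open>A Hilbert space with orthonormal basis \<open>W\<close> and vacuum \<open>e\<close>, on which the \<open>k\<close>-th factor acts from
  the left through \<open>head\<close>, \<open>tail\<close> and from the right through \<open>rhead\<close>, \<open>rtail\<close>. For a set \<open>K\<close> of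
  factors, \<open>w \<mapsto> (pre K w, post K w)\<close> is the decomposition that makes the factors in \<open>K\<close> act on
  \<open>pre K w\<close> only. The algebra is the commutant of the right action.\<close>

locale word_space =
  L: syllables W I head tail + Rt: syllables W I rhead rtail
  for W :: "'i set" and I :: "nat set" and head tail rhead rtail +
  fixes e :: 'i and U :: "nat \<Rightarrow> nat \<Rightarrow> nat \<Rightarrow> real" and rv :: "'i \<Rightarrow> 'i"
    and pre post :: "nat set \<Rightarrow> 'i \<Rightarrow> 'i"
  assumes I_nonempty: "I \<noteq> {}" and e_W: "e \<in> W" and head_e: "k \<in> I \<Longrightarrow> head k e = 0"
    and U: "k \<in> I \<Longrightarrow> orthogonal3 (U k)" "k \<in> I \<Longrightarrow> s < 3 \<Longrightarrow> U k 0 s \<noteq> 0"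
    and left_right_commute: "k \<in> I \<Longrightarrow> l \<in> I \<Longrightarrow>
      L.Lam k (rot (U k) f) * Rt.Lam l (rot (U l) g) = Rt.Lam l (rot (U l) g) * L.Lam k (rot (U k) f)"
    and rv: "w \<in> W \<Longrightarrow> rv w \<in> W" "w \<in> W \<Longrightarrow> rv (rv w) = w"
    and transfer_rv: "(\<And>k i v z. k \<in> I \<Longrightarrow> i < 3 \<Longrightarrow> v \<in> W \<Longrightarrow> z \<in> W \<Longrightarrow> rhead k v = 0 \<Longrightarrow> rhead k z = 0 \<Longrightarrow>
        h v (Rt.subst_head k i z) = h (Rt.subst_head k i v) z) \<Longrightarrow> w \<in> W \<Longrightarrow> h e w = (h (rv w) e :: complex)"
    and pre_W: "w \<in> W \<Longrightarrow> pre K w \<in> W"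
    and post_pre: "w \<in> W \<Longrightarrow> post K (pre K w) = e" and pre_pre: "w \<in> W \<Longrightarrow> pre K (pre K w) = pre K w"
    and post_e: "post K e = e"
    and pre_post_inj: "v \<in> W \<Longrightarrow> w \<in> W \<Longrightarrow> pre K v = pre K w \<Longrightarrow> post K v = post K w \<Longrightarrow> v = w"
    and pre_post_surj: "u \<in> W \<Longrightarrow> post K u = e \<Longrightarrow> z \<in> W \<Longrightarrow> \<exists>w\<in>W. pre K w = u \<and> post K w = post K z"
    and head_pre: "k \<in> I \<Longrightarrow> k \<in> K \<Longrightarrow> w \<in> W \<Longrightarrow> head k (pre K w) = head k w"
    and tail_pre: "k \<in> I \<Longrightarrow> k \<in> K \<Longrightarrow> v \<in> W \<Longrightarrow> w \<in> W \<Longrightarrow>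
      tail k v = tail k w \<longleftrightarrow> post K v = post K w \<and> tail k (pre K v) = tail k (pre K w)"
begin

definition RR :: "'i bmat set" where
  "RR = {Rt.Lam k (rot (U k) f) | k f. k \<in> I}"

lemma adj_RR: "adj ` RR \<subseteq> RR"
proof -
  have "adj (Rt.Lam k (rot (U k) f)) = Rt.Lam k (rot (U k) f)" if "k \<in> I" for k f
    unfolding Rt.adj_Lam[OF that] by (intro Rt.Lam_cong that rot_sym)
  thus ?thesis unfolding RR_def by (smt (verit) image_subset_iff mem_Collect_eq)
qed

lemma Lam_commutant: "k \<in> I \<Longrightarrow> L.Lam k (rot (U k) f) \<in> commutant RR"
  unfolding commutant_def RR_def by (auto simp: left_right_commute)

text \<open>The right action has an element that creates the letter \<open>i\<close> from the vacuum
  of factor \<open>k\<close>. Comparing entries of its two products with \<open>M\<close> leaves a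
  single term on each side, as \<open>v\<close> and \<open>z\<close> have trivial right head. Thus a
  letter can be moved from the end of the column index to the end of the row index.\<close>

lemma commutant_transfer:
  assumes M: "M \<in> commutant RR" and k: "k \<in> I" and i: "i < 3" and v: "v \<in> W" and z: "z \<in> W"
    and h: "rhead k v = 0" "rhead k z = 0"
  shows "ent M v (Rt.subst_head k i z) = ent M (Rt.subst_head k i v) z"
proof -
  let ?x = "rot (U k) (\<lambda>s. U k i s / U k 0 s)"
  have x: "?x 0 j = of_bool (i = j)" if "j < 3" for j
    using rot_cyclic[OF U(1)[OF k] U(2)[OF k] i that] by simp
  have x': "?x j 0 = of_bool (i = j)" if "j < 3" for j using x[OF that] by (simp only: rot_sym)
  have "Rt.Lam k ?x \<in> RR" using k by (auto simp: RR_def)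
  hence c: "M * Rt.Lam k ?x = Rt.Lam k ?x * M" using M by (simp add: commutant_def)
  have "ent (M * Rt.Lam k ?x) v z = (\<Sum>j<3. ent M v (Rt.subst_head k j z) * complex_of_real (?x j 0))"
    using z h by (simp add: Rt.ent_times_Lam[OF k])
  also have "\<dots> = (\<Sum>j<3. if i = j then ent M v (Rt.subst_head k j z) else 0)"
    by (intro sum.cong refl) (simp add: x')
  also have "\<dots> = ent M v (Rt.subst_head k i z)" using i by simp
  finally have 1: "ent (M * Rt.Lam k ?x) v z = ent M v (Rt.subst_head k i z)" .
  have "ent (Rt.Lam k ?x * M) v z = (\<Sum>j<3. complex_of_real (?x 0 j) * ent M (Rt.subst_head k j v) z)"
    using v h by (simp add: Rt.ent_Lam_times[OF k])
  also have "\<dots> = (\<Sum>j<3. if i = j then ent M (Rt.subst_head k j v) z else 0)"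
    by (intro sum.cong refl) (simp add: x)
  also have "\<dots> = ent M (Rt.subst_head k i v) z" using i by simp
  finally show ?thesis using 1 c by simp
qed

text \<open>The constant function 1 acts from the right as the projection onto the span of
  \<open>W\<close>, and \<open>M\<close> commutes with it.\<close>

lemma commutant_support:
  assumes M: "M \<in> commutant RR" and w: "w \<notin> W"
  shows "ent M e w = 0"
proof -
  obtain k where k: "k \<in> I" using I_nonempty by auto
  let ?x = "rot (U k) (\<lambda>_. 1)"
  define j where "j = rhead k e"
  have j: "j < 3" using Rt.head_less[OF k e_W] by (simp add: j_def)
  have x: "?x j i = of_bool (j = i)" if "i < 3" for i by (rule rot_one[OF U(1)[OF k] j that])
  have "Rt.Lam k ?x \<in> RR" using k by (auto simp: RR_def)
  hence c: "M * Rt.Lam k ?x = Rt.Lam k ?x * M" using M by (simp add: commutant_def)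
  have "ent (Rt.Lam k ?x * M) e w = (\<Sum>i<3. complex_of_real (?x j i) * ent M (Rt.subst_head k i e) w)"
    using e_W by (simp add: Rt.ent_Lam_times[OF k] j_def)
  also have "\<dots> = (\<Sum>i<3. if j = i then ent M (Rt.subst_head k i e) w else 0)"
    by (intro sum.cong refl) (simp add: x)
  also have "\<dots> = ent M (Rt.subst_head k j e) w" using j by simp
  also have "Rt.subst_head k j e = e" by (rule Rt.subst_head_eqI[OF k e_W e_W]) (simp_all add: j_def)
  finally have "ent (Rt.Lam k ?x * M) e w = ent M e w" .
  moreover have "ent (M * Rt.Lam k ?x) e w = 0" using w by (simp add: Rt.ent_times_Lam[OF k])
  ultimately show ?thesis using c by simp
qed

lemma commutant_rv:
  assumes "M \<in> commutant RR" and "w \<in> W"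
  shows "ent M e w = ent M (rv w) e"
  by (rule transfer_rv[of "ent M", OF commutant_transfer[OF assms(1)] assms(2)])

lemma vacuum_state: "vstate {e} (\<lambda>_. 1) M = ent M e e"
  by (simp add: vstate_def mvec_def)

lemma ent_times_vacuum:
  assumes "M \<in> commutant RR"
  shows "ent (M * N) e w = (\<Sum>\<^sub>\<infinity>u\<in>W. ent M e u * ent N u w)"
  unfolding ent_times by (rule infsum_cong_neutral) (use commutant_support[OF assms] in auto)

text \<open>The vacuum row of each factor is its vacuum column reindexed by the involution
  \<open>rv\<close>. Reindexing the sum for \<open>M * N\<close> therefore turns it into the sum for
  \<open>N * M\<close>.\<close>

lemma vacuum_trace:
  assumes M: "M \<in> commutant RR" and N: "N \<in> commutant RR"
  shows "vstate {e} (\<lambda>_. 1) (M * N) = vstate {e} (\<lambda>_. 1) (N * M)"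
proof -
  have "ent (M * N) e e = (\<Sum>\<^sub>\<infinity>w\<in>W. ent M e w * ent N w e)" by (rule ent_times_vacuum[OF M])
  also have "\<dots> = (\<Sum>\<^sub>\<infinity>w\<in>W. ent N e w * ent M w e)"
  proof (rule infsum_reindex_bij_witness[where i=rv and j=rv])
    fix w assume w: "w \<in> W"
    show "ent N e (rv w) * ent M (rv w) e = ent M e w * ent N w e"
      using commutant_rv[OF M w] commutant_rv[OF N rv(1)[OF w]] rv(2)[OF w] by simp
  qed (use rv in auto)
  also have "\<dots> = ent (N * M) e e" by (rule ent_times_vacuum[OF N, symmetric])
  finally show ?thesis by (simp add: vacuum_state)
qed

section \<open>Projections of the factors and algebras acting on groups of factors\<close>

definition Pr :: "nat \<Rightarrow> nat set \<Rightarrow> 'i bmat" where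
  "Pr k S = L.Lam k (rot (U k) (\<lambda>s. of_bool (s \<in> S)))"

lemma Pr_commutant: "k \<in> I \<Longrightarrow> Pr k S \<in> commutant RR"
  unfolding Pr_def by (rule Lam_commutant)

lemma adj_Pr: "k \<in> I \<Longrightarrow> adj (Pr k S) = Pr k S"
  unfolding Pr_def by (subst L.adj_Lam) (auto intro!: L.Lam_cong rot_sym)

lemma Pr_times: "k \<in> I \<Longrightarrow> Pr k S * Pr k T = Pr k (S \<inter> T)"
  unfolding Pr_def by (subst L.Lam_times) (auto intro!: L.Lam_cong simp: rot_times U of_bool_conj[symmetric])

lemma Pr_diff:
  assumes "k \<in> I" and "S \<subseteq> T"
  shows "Pr k T - Pr k S = Pr k (T - S)"
proof -
  have "rot (U k) (\<lambda>s. of_bool (s \<in> T)) i j - rot (U k) (\<lambda>s. of_bool (s \<in> S)) i j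
      = rot (U k) (\<lambda>s. of_bool (s \<in> T - S)) i j" for i j
    unfolding rot_def sum_subtractf[symmetric] using assms(2)
    by (intro sum.cong refl) (auto simp: of_bool_def)
  thus ?thesis unfolding Pr_def by (simp add: L.Lam_diff assms(1))
qed

lemma vacuum_Pr:
  assumes k: "k \<in> I" and S: "S \<subseteq> {..<3}"
  shows "vstate {e} (\<lambda>_. 1) (Pr k S) = complex_of_real (\<Sum>s\<in>S. (U k 0 s)\<^sup>2)"
proof -
  have "rot (U k) (\<lambda>s. of_bool (s \<in> S)) 0 0 = (\<Sum>s\<in>S. (U k 0 s)\<^sup>2)"
    unfolding rot_def using S
    by (subst sum.mono_neutral_cong_right[of "{..<3}" S _ "\<lambda>s. (U k 0 s)\<^sup>2"]) (auto simp: power2_eq_square)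
  thus ?thesis using k by (simp add: vacuum_state Pr_def L.ent_Lam e_W head_e)
qed

text \<open>The elements that act on \<open>pre K\<close> alone, like a matrix tensored with the
  identity on \<open>post K\<close>. Describing them by entries replaces a description of the
  algebra generated by the factors in \<open>K\<close>, of which this is an upper bound. Only
  columns in \<open>W\<close> are constrained, so that 1 belongs to it.\<close>

definition Alg :: "nat set \<Rightarrow> 'i bmat set" where
  "Alg K = {M \<in> commutant RR. \<forall>v. \<forall>z\<in>W. ent M v z
     = (if v \<in> W \<and> post K v = post K z then ent M (pre K v) (pre K z) else 0)}"

lemma AlgD: "M \<in> Alg K \<Longrightarrow> z \<in> W \<Longrightarrow> ent M v z
     = (if v \<in> W \<and> post K v = post K z then ent M (pre K v) (pre K z) else 0)"
  by (simp add: Alg_def)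

lemma Alg_commutant: "M \<in> Alg K \<Longrightarrow> M \<in> commutant RR"
  by (simp add: Alg_def)

lemma Alg_1: "1 \<in> Alg K"
  using pre_post_inj by (auto simp: Alg_def commutant_1 one_bmat.rep_eq)

lemma Alg_add: "M \<in> Alg K \<Longrightarrow> N \<in> Alg K \<Longrightarrow> M + N \<in> Alg K"
  by (simp add: Alg_def commutant_add plus_bmat.rep_eq)

lemma Alg_cs: "M \<in> Alg K \<Longrightarrow> cs c M \<in> Alg K"
  by (simp add: Alg_def commutant_cs cs.rep_eq)

text \<open>The inner sum runs over the words that share \<open>post K\<close> with
  \<open>z\<close>. The map \<open>pre K\<close> sends them bijectively onto the words with
  \<open>post K\<close> equal to \<open>e\<close>, which gives the inner sum of the reference
  entry.\<close>

lemma Alg_times: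
  assumes M: "M \<in> Alg K" and N: "N \<in> Alg K"
  shows "M * N \<in> Alg K"
  unfolding Alg_def
proof (intro CollectI conjI allI ballI)
  show "M * N \<in> commutant RR" using M N by (simp add: Alg_commutant commutant_times)
  fix v z assume z: "z \<in> W"
  define T where "T = {u \<in> W. post K u = post K z}"
  define T0 where "T0 = {u \<in> W. post K u = e}"
  have TW: "u \<in> T \<Longrightarrow> u \<in> W" for u by (simp add: T_def)
  have bij: "bij_betw (pre K) T T0"
    unfolding bij_betw_def
  proof
    show "inj_on (pre K) T" by (rule inj_onI) (use pre_post_inj in \<open>auto simp: T_def\<close>)
    show "pre K ` T = T0"
    proof
      show "pre K ` T \<subseteq> T0" using pre_W post_pre by (auto simp: T_def T0_def)
      show "T0 \<subseteq> pre K ` T"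
      proof
        fix u assume "u \<in> T0"
        then obtain w where "w \<in> W" "pre K w = u" "post K w = post K z"
          using pre_post_surj[OF _ _ z, of u K] by (auto simp: T0_def)
        thus "u \<in> pre K ` T" by (auto simp: T_def)
      qed
    qed
  qed
  have "ent (M * N) v z = (\<Sum>\<^sub>\<infinity>u\<in>T. ent M v u * ent N u z)"
    unfolding ent_times by (rule infsum_cong_neutral) (use AlgD[OF N z] in \<open>auto simp: T_def\<close>)
  also have "\<dots> = (if v \<in> W \<and> post K v = post K z then ent (M * N) (pre K v) (pre K z) else 0)"
  proof (cases "v \<in> W \<and> post K v = post K z")
    case True
    have "(\<Sum>\<^sub>\<infinity>u\<in>T. ent M v u * ent N u z) = (\<Sum>\<^sub>\<infinity>u\<in>T. ent M (pre K v) (pre K u) * ent N (pre K u) (pre K z))"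
    proof (rule infsum_cong)
      fix u assume u: "u \<in> T"
      show "ent M v u * ent N u z = ent M (pre K v) (pre K u) * ent N (pre K u) (pre K z)"
        using AlgD[OF M TW[OF u], of v] AlgD[OF N z, of u] True u by (simp add: T_def)
    qed
    also have "\<dots> = (\<Sum>\<^sub>\<infinity>u\<in>T0. ent M (pre K v) u * ent N u (pre K z))"
      by (rule infsum_reindex_bij_betw[OF bij, where f="\<lambda>u. ent M (pre K v) u * ent N u (pre K z)"])
    also have "\<dots> = ent (M * N) (pre K v) (pre K z)"
      unfolding ent_times
      by (rule infsum_cong_neutral)
        (use AlgD[OF N pre_W[OF z, of K]] post_pre[OF z, of K] in \<open>auto simp: T0_def\<close>)
    finally show ?thesis using True by simp
  next
    case False
    have "(\<Sum>\<^sub>\<infinity>u\<in>T. ent M v u * ent N u z) = (\<Sum>\<^sub>\<infinity>u\<in>T. 0)"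
      by (rule infsum_cong) (use AlgD[OF M TW, of _ v] False in \<open>auto simp: T_def\<close>)
    thus ?thesis unfolding if_not_P[OF False] by simp
  qed
  finally show "ent (M * N) v z = (if v \<in> W \<and> post K v = post K z then ent (M * N) (pre K v) (pre K z) else 0)" .
qed

lemma Pr_Alg: "k \<in> I \<Longrightarrow> k \<in> K \<Longrightarrow> Pr k S \<in> Alg K"
  unfolding Alg_def
proof (intro CollectI conjI allI ballI)
  assume k: "k \<in> I" "k \<in> K"
  show "Pr k S \<in> commutant RR" by (rule Pr_commutant[OF k(1)])
  fix v z assume z: "z \<in> W"
  show "ent (Pr k S) v z = (if v \<in> W \<and> post K v = post K z then ent (Pr k S) (pre K v) (pre K z) else 0)"
  proof (cases "v \<in> W")
    case True
    thus ?thesis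
      unfolding Pr_def L.ent_Lam[OF k(1)] tail_pre[OF k True z]
      using z by (simp add: pre_W head_pre[OF k])
  qed (simp add: Pr_def L.ent_Lam[OF k(1)])
qed

lemma Alg_sum:
  assumes "\<And>k. k \<in> J \<Longrightarrow> f k \<in> Alg K"
  shows "(\<Sum>k\<in>J. f k) \<in> Alg K"
  using assms
proof (induction J rule: infinite_finite_induct)
  case (insert x F)
  thus ?case by (simp add: Alg_add)
qed (use Alg_cs[OF Alg_1, of 0] in simp_all)

lemma Alg_vacuum_column:
  assumes "M \<in> Alg K" and "ent M v e \<noteq> 0"
  shows "v \<in> W" and "post K v = e"
  using AlgD[OF assms(1) e_W, of v] assms(2) by (auto simp: post_e split: if_splits)

lemma Alg_vacuum_row:
  assumes "M \<in> Alg K" and "ent M e w \<noteq> 0"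
  shows "w \<in> W" and "post K w = e"
proof -
  show w: "w \<in> W" using commutant_support[OF Alg_commutant[OF assms(1)], of w] assms(2) by blast
  show "post K w = e" using AlgD[OF assms(1) w, of e] assms(2) by (auto simp: post_e split: if_splits)
qed

end

section \<open>Independence, convolutions and the coupling in a word space\<close>

locale word_model = word_space W I head tail rhead rtail e U rv pre post
  for W :: "'i set" and I head tail rhead rtail e U rv pre post +
  fixes E :: "'i bmat \<Rightarrow> 'u"
  assumes inj: "inj E"
begin

sublocale M: bmat_state E RR "{e}" "\<lambda>_. 1"
  by unfold_locales (use inj adj_RR vacuum_trace in auto)

lemma generated_algebra_Alg:
  assumes "X \<in> Alg K"
  shows "generated_algebra M.alg (E X) \<subseteq> E ` Alg K"
proof (rule M.A.generated_algebra_minimal)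
  show "unital_subalgebra M.alg (E ` Alg K)"
    by (rule M.unital_subalgebra_E)
      (auto simp: Alg_1 Alg_add Alg_times Alg_cs Alg_commutant)
qed (use assms in simp)

lemma unital_subalgebra_generated_E:
  "X \<in> Alg K \<Longrightarrow> unital_subalgebra M.alg (generated_algebra M.alg (E X))"
  by (rule M.A.unital_subalgebra_generated) (simp add: Alg_commutant)

end

lemma (in word_space) pre_e: "pre K e = e"
  by (rule pre_post_inj[of _ _ K]) (simp_all add: pre_W e_W pre_pre post_pre post_e)

context word_model
begin

text \<open>The vacuum row of an element of \<open>Alg K\<close> and the vacuum column of one of
  \<open>Alg K'\<close> are supported on sets of words that meet only in \<open>e\<close>. Hence the
  vacuum entry of their product has one term, and the state factorizes.\<close>

lemma tensor_independent_Alg: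
  assumes disj: "\<And>w. w \<in> W \<Longrightarrow> post K w = e \<Longrightarrow> post K' w = e \<Longrightarrow> w = e"
    and X: "X \<in> Alg K" and Y: "Y \<in> Alg K'" and XY: "X * Y = Y * X"
  shows "tensor_independent M.alg M.\<tau> [generated_algebra M.alg (E X), generated_algebra M.alg (E Y)]"
proof -
  let ?G = "generated_algebra M.alg (E X)" and ?H = "generated_algebra M.alg (E Y)"
  \<comment> \<open>Only \<open>X\<close> and \<open>Y\<close> are assumed to commute. A double
    commutant passes this to the generated algebras: that of \<open>X\<close> lies in the commutant
    \<open>B\<close> of \<open>Y\<close>, and that of \<open>Y\<close> in the commutant
    \<open>C\<close> of \<open>B\<close>.\<close>
  define B where "B = commutant (RR \<union> {Y})"
  define C where "C = commutant (RR \<union> B)"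
  have sub: "unital_subalgebra M.alg (E ` commutant (RR \<union> Z))" for Z
  proof (rule M.unital_subalgebra_E)
    show "commutant (RR \<union> Z) \<subseteq> commutant RR" by (auto simp: commutant_def)
  qed (simp_all add: commutant_1 commutant_add commutant_times commutant_cs)
  have "X \<in> B" using Alg_commutant[OF X] XY by (auto simp: B_def commutant_def)
  hence G: "?G \<subseteq> E ` B" unfolding B_def by (intro M.A.generated_algebra_minimal sub) (auto simp: B_def)
  have "Y \<in> C" using Alg_commutant[OF Y] by (auto simp: B_def C_def commutant_def)
  hence H: "?H \<subseteq> E ` C" unfolding C_def by (intro M.A.generated_algebra_minimal sub) (auto simp: C_def)
  have comm: "x \<otimes>\<^bsub>M.alg\<^esub> y = y \<otimes>\<^bsub>M.alg\<^esub> x" if xy: "x \<in> ?G" "y \<in> ?H" for x y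
  proof -
    obtain u where u: "x = E u" "u \<in> B" using xy G by blast
    obtain v where v: "y = E v" "v \<in> C" using xy H by blast
    have "v * u = u * v" using u v by (auto simp: C_def commutant_def)
    thus ?thesis by (simp add: u v)
  qed
  have mult: "M.\<tau> (x \<otimes>\<^bsub>M.alg\<^esub> y) = M.\<tau> x * M.\<tau> y" if xy: "x \<in> ?G" "y \<in> ?H" for x y
  proof -
    obtain u where u: "x = E u" "u \<in> Alg K" using xy generated_algebra_Alg[OF X] by blast
    obtain v where v: "y = E v" "v \<in> Alg K'" using xy generated_algebra_Alg[OF Y] by blast
    have z: "ent u e w * ent v w e = 0" if "w \<noteq> e" for w
      using Alg_vacuum_row[OF u(2), of w] Alg_vacuum_column[OF v(2), of w] disj[of w] that by auto
    have "ent (u * v) e e = (\<Sum>\<^sub>\<infinity>w\<in>{e}. ent u e w * ent v w e)"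
      unfolding ent_times by (rule infsum_cong_neutral) (use z in auto)
    thus ?thesis by (simp add: u v vacuum_state)
  qed
  have ord: "list_mult M.alg (map a [0..<2]) = a 0 \<otimes>\<^bsub>M.alg\<^esub> a 1" if ab: "a 0 \<in> ?G" "a 1 \<in> ?H" for a :: "nat \<Rightarrow> 'u"
  proof -
    obtain v where "a 1 = E v" "v \<in> Alg K'" using ab(2) generated_algebra_Alg[OF Y] by blast
    thus ?thesis by (simp add: list_mult_def numeral_2_eq_2)
  qed
  show ?thesis
    unfolding tensor_independent_def
  proof (intro conjI allI impI ballI)
    fix B assume "B \<in> set [?G, ?H]"
    thus "unital_subalgebra M.alg B" using unital_subalgebra_generated_E X Y by auto
  next
    fix i j x y assume "i < length [?G, ?H]" "j < length [?G, ?H]" "i \<noteq> j" "x \<in> [?G, ?H] ! i" "y \<in> [?G, ?H] ! j"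
    thus "x \<otimes>\<^bsub>M.alg\<^esub> y = y \<otimes>\<^bsub>M.alg\<^esub> x"
      using comm[of x y] comm[of y x] by (auto simp: less_Suc_eq)
  next
    fix a assume a: "\<forall>k<length [?G, ?H]. a k \<in> [?G, ?H] ! k"
    have a0: "a 0 \<in> ?G" and a1: "a 1 \<in> ?H" using a[rule_format, of 0] a[rule_format, of 1] by auto
    show "M.\<tau> (list_mult M.alg (map a [0..<length [?G, ?H]])) = (\<Prod>k<length [?G, ?H]. M.\<tau> (a k))"
      using ord[OF a0 a1] mult[OF a0 a1] by (simp add: numeral_2_eq_2)
  qed
qed

text \<open>A centered element of \<open>Alg (K j)\<close>, applied to a word with trivial prefix
  for \<open>K j\<close>, yields only words with nontrivial prefix for \<open>K j\<close>. By
  \<open>free\<close> such words have trivial prefix for the preceding factor of the product, so an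
  alternating product applied to the vacuum never returns to it.\<close>

lemma free_product_vacuum_column:
  assumes free: "\<And>i j w. Suc j < m \<Longrightarrow> w \<in> W \<Longrightarrow> pre (K (Suc j)) w \<noteq> e \<Longrightarrow> pre (K j) w = e"
    and f: "\<And>j. j < m \<Longrightarrow> f j \<in> Alg (K j)" "\<And>j. j < m \<Longrightarrow> ent (f j) e e = 0"
    and j: "j < m" and v: "ent (prod_list (map f [j..<m])) v e \<noteq> 0"
  shows "v \<in> W \<and> pre (K j) v \<noteq> e"
proof -
  have "\<forall>v. ent (prod_list (map f [j..<m])) v e \<noteq> 0 \<longrightarrow> v \<in> W \<and> pre (K j) v \<noteq> e"
    using j
  proof (induction "m - j" arbitrary: j)
    case 0
    then show ?case by simp
  next
    case (Suc d)
    show ?case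
    proof (intro allI impI)
      fix v assume v: "ent (prod_list (map f [j..<m])) v e \<noteq> 0"
      define N where "N = prod_list (map f [Suc j..<m])"
      have "prod_list (map f [j..<m]) = f j * N" using Suc.prems by (simp add: N_def upt_conv_Cons)
      with v have nz: "(\<Sum>\<^sub>\<infinity>u. ent (f j) v u * ent N u e) \<noteq> 0" by (simp add: ent_times)
      have "\<exists>u. ent (f j) v u * ent N u e \<noteq> 0"
      proof (rule ccontr)
        assume "\<nexists>u. ent (f j) v u * ent N u e \<noteq> 0"
        hence "(\<Sum>\<^sub>\<infinity>u. ent (f j) v u * ent N u e) = 0" by (intro infsum_0) blast
        thus False using nz by contradiction
      qed
      then obtain u where u: "ent (f j) v u \<noteq> 0" "ent N u e \<noteq> 0" by auto
      have ue: "u \<in> W \<and> pre (K j) u = e"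
      proof (cases "Suc j < m")
        case True
        hence "u \<in> W \<and> pre (K (Suc j)) u \<noteq> e" using Suc.hyps(1)[of "Suc j"] Suc.hyps(2) u(2) by (simp add: N_def)
        thus ?thesis using free[OF True] by blast
      next
        case False
        hence "N = 1" by (simp add: N_def)
        hence "u = e" using u(2) by (simp add: one_bmat.rep_eq split: if_splits)
        thus ?thesis using e_W pre_e by simp
      qed
      hence "v \<in> W" "ent (f j) (pre (K j) v) e \<noteq> 0"
        using AlgD[OF f(1)[OF Suc.prems], of u v] u(1) by (auto split: if_splits)
      thus "v \<in> W \<and> pre (K j) v \<noteq> e" using f(2)[OF Suc.prems] by auto
    qed
  qed
  thus ?thesis using v by blast
qed

lemma freely_independent_Alg:
  assumes free: "\<And>w. w \<in> W \<Longrightarrow> pre K w \<noteq> e \<Longrightarrow> pre K' w = e"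
    and X: "X \<in> Alg K" and Y: "Y \<in> Alg K'"
  shows "freely_independent M.alg M.\<tau> [generated_algebra M.alg (E X), generated_algebra M.alg (E Y)]"
  unfolding freely_independent_def
proof (intro conjI allI impI ballI)
  let ?G = "generated_algebra M.alg (E X)" and ?H = "generated_algebra M.alg (E Y)"
  fix B assume "B \<in> set [?G, ?H]"
  thus "unital_subalgebra M.alg B" using unital_subalgebra_generated_E X Y by auto
next
  let ?G = "generated_algebra M.alg (E X)" and ?H = "generated_algebra M.alg (E Y)"
  fix m :: nat and i :: "nat \<Rightarrow> nat" and a
  assume m: "m \<ge> 1"
    and "(\<forall>j<m. i j < length [?G, ?H] \<and> a j \<in> [?G, ?H] ! i j \<and> M.\<tau> (a j) = 0) \<and>
        (\<forall>j. Suc j < m \<longrightarrow> i j \<noteq> i (Suc j))"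
  hence i: "\<And>j. j < m \<Longrightarrow> i j < 2" and a: "\<And>j. j < m \<Longrightarrow> a j \<in> [?G, ?H] ! i j"
    and t: "\<And>j. j < m \<Longrightarrow> M.\<tau> (a j) = 0" and alt: "\<And>j. Suc j < m \<Longrightarrow> i j \<noteq> i (Suc j)"
    by (auto simp: numeral_2_eq_2)
  define KK where "KK j = (if i j = 0 then K else K')" for j
  have aE: "\<exists>x. a j = E x \<and> x \<in> Alg (KK j)" if "j < m" for j
  proof (cases "i j = 0")
    case True
    thus ?thesis using a[OF that] generated_algebra_Alg[OF X] by (auto simp: KK_def)
  next
    case False
    hence "i j = 1" using i[OF that] by simp
    thus ?thesis using a[OF that] generated_algebra_Alg[OF Y] by (auto simp: KK_def)
  qed
  define f where "f j = M.D (a j)" for j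
  have f: "a j = E (f j)" "f j \<in> Alg (KK j)" if "j < m" for j using aE[OF that] by (auto simp: f_def)
  have f0: "ent (f j) e e = 0" if "j < m" for j using t[OF that] f(1)[OF that] by (simp add: vacuum_state)
  have fr: "pre (KK j) w = e" if "Suc j < m" "w \<in> W" "pre (KK (Suc j)) w \<noteq> e" for j w
    using that alt[OF that(1)] i[OF that(1)] i[of j] free[OF that(2)] by (auto simp: KK_def split: if_splits)
  have "ent (prod_list (map f [0..<m])) e e = 0"
    using free_product_vacuum_column[of m KK f 0 e, OF fr f(2) f0] m pre_e by auto
  moreover have "map a [0..<m] = map (\<lambda>j. E (f j)) [0..<m]" using f(1) by auto
  ultimately show "M.\<tau> (list_mult M.alg (map a [0..<m])) = 0"
    by (simp only: M.list_mult_E M.\<tau>_E vacuum_state)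
qed

lemma sum_Pr_properties:
  assumes "J \<subseteq> I"
  shows "(\<Sum>k\<in>J. Pr k (S k)) \<in> commutant RR" "adj (\<Sum>k\<in>J. Pr k (S k)) = (\<Sum>k\<in>J. Pr k (S k))"
proof -
  show "(\<Sum>k\<in>J. Pr k (S k)) \<in> commutant RR"
    using assms by (induction J rule: infinite_finite_induct) (auto simp: commutant_0 commutant_add Pr_commutant)
  show "adj (\<Sum>k\<in>J. Pr k (S k)) = (\<Sum>k\<in>J. Pr k (S k))"
    using assms by (induction J rule: infinite_finite_induct) (auto simp: adj_add adj_Pr)
qed

lemma Pr_has_distribution:
  assumes "k \<in> I" and "S \<subseteq> {..<3}" and "(\<Sum>s\<in>S. (U k 0 s)\<^sup>2) = p" and "p \<in> {0..1}"
  shows "has_distribution M.alg M.\<tau> (E (Pr k S)) (bernoulli_measure p)"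
  by (rule M.projection_has_distribution) (use assms in \<open>simp_all add: Pr_commutant adj_Pr Pr_times vacuum_Pr\<close>)

text \<open>At each stage the moment problem supplies some law of the enlarged sum, this law is a
  convolution of the previous one with the next Bernoulli law by independence, and uniqueness makes
  it the value of \<open>THE\<close>.\<close>

lemma iterated_convolution_sum_Pr:
  fixes S :: "nat \<Rightarrow> nat set" and p :: "nat \<Rightarrow> real" and indep :: "'u independence"
  assumes I: "{1..n} \<subseteq> I" and S: "\<And>k. k \<in> {1..n} \<Longrightarrow> S k \<subseteq> {..<3}"
    and p: "\<And>k. k \<in> {1..n} \<Longrightarrow> (\<Sum>s\<in>S k. (U k 0 s)\<^sup>2) = p k" "\<And>k. k \<in> {1..n} \<Longrightarrow> p k \<in> {0..1}"
    and indep: "indep \<in> {tensor_independent, freely_independent}"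
    and ind: "\<And>m. 1 \<le> m \<Longrightarrow> m < n \<Longrightarrow> indep M.alg M.\<tau>
      [generated_algebra M.alg (E (\<Sum>k=1..m. Pr k (S k))), generated_algebra M.alg (E (Pr (Suc m) (S (Suc m))))]"
    and conv: "conv = (\<lambda>\<mu> \<nu>. THE \<eta>. is_convolution indep \<mu> \<nu> \<eta>)"
    and m: "1 \<le> m" "m \<le> n"
  shows "has_distribution M.alg M.\<tau> (E (\<Sum>k=1..m. Pr k (S k))) (iterated_convolution conv (\<lambda>k. bernoulli_measure (p k)) m)"
  using m
proof (induction m rule: nat_induct_at_least)
  case base
  then show ?case using Pr_has_distribution[of 1 "S 1" "p 1"] I S p by (auto simp: iterated_convolution_def)
next
  case (Suc m)
  let ?\<mu> = "\<lambda>k. bernoulli_measure (p k)"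
  let ?A = "\<Sum>k=1..m. Pr k (S k)" and ?b = "Pr (Suc m) (S (Suc m))"
  have b: "has_distribution M.alg M.\<tau> (E ?b) (?\<mu> (Suc m))"
    using I S p Suc by (intro Pr_has_distribution) auto
  obtain \<eta> where \<eta>: "has_distribution M.alg M.\<tau> (E (\<Sum>k\<in>{1..Suc m}. Pr k (S k))) \<eta>"
  proof (rule M.sum_of_projections_has_distribution)
    show "finite {1..Suc m}" by simp
    fix k assume "k \<in> {1..Suc m}"
    hence "k \<in> I" using I Suc by auto
    thus "Pr k (S k) \<in> commutant RR" "adj (Pr k (S k)) = Pr k (S k)" "Pr k (S k) * Pr k (S k) = Pr k (S k)"
      by (simp_all add: Pr_commutant adj_Pr Pr_times)
  qed
  have sum: "(\<Sum>k\<in>{1..Suc m}. Pr k (S k)) = ?A + ?b" by simp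
  have "is_convolution indep (iterated_convolution conv ?\<mu> m) (?\<mu> (Suc m)) \<eta>"
    unfolding is_convolution_def
    using M.nc_prob_space_axioms Suc b \<eta> ind[of m] unfolding sum
    by (intro exI[of _ "M.alg"] exI[of _ "M.\<tau>"] exI[of _ "E ?A"] exI[of _ "E ?b"]) auto
  hence "conv (iterated_convolution conv ?\<mu> m) (?\<mu> (Suc m)) = \<eta>"
    unfolding conv by (intro the_equality) (auto intro: is_convolution_unique[OF indep])
  moreover have "iterated_convolution conv ?\<mu> (Suc m) = conv (iterated_convolution conv ?\<mu> m) (?\<mu> (Suc m))"
    using Suc by (simp add: iterated_convolution_def)
  ultimately show ?case using \<eta> by simp
qed

lemma nc_wasserstein_coupling:
  fixes S T :: "nat \<Rightarrow> nat set"
  assumes I: "{1..n} \<subseteq> I" and S: "\<And>k. k \<in> {1..n} \<Longrightarrow> S k \<subseteq> {..<3}" and T: "\<And>k. k \<in> {1..n} \<Longrightarrow> T k \<subseteq> {..<3}"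
    and p: "\<And>k. k \<in> {1..n} \<Longrightarrow> (\<Sum>s\<in>S k. (U k 0 s)\<^sup>2) = p k"
    and q: "\<And>k. k \<in> {1..n} \<Longrightarrow> (\<Sum>s\<in>T k. (U k 0 s)\<^sup>2) = q"
    and ST: "\<And>k. k \<in> {1..n} \<Longrightarrow> S k \<subseteq> T k \<or> T k \<subseteq> S k"
    and \<gamma>1: "has_distribution M.alg M.\<tau> (E (\<Sum>k=1..n. Pr k (S k))) \<gamma>\<^sub>1"
    and \<gamma>2: "has_distribution M.alg M.\<tau> (E (\<Sum>k=1..n. Pr k (T k))) \<gamma>\<^sub>2"
  shows "nc_wasserstein TYPE('u) \<gamma>\<^sub>1 \<gamma>\<^sub>2 \<le> ereal (\<Sum>k=1..n. \<bar>p k - q\<bar>)"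
proof -
  let ?A = "\<Sum>k=1..n. Pr k (S k)" and ?B = "\<Sum>k=1..n. Pr k (T k)"
  define x where "x = ?B - ?A"
  have AB: "?A \<in> commutant RR" "?B \<in> commutant RR" "adj ?A = ?A" "adj ?B = ?B"
    using sum_Pr_properties[OF I] by auto
  have x: "x \<in> commutant RR" "adj x = x" using AB by (simp_all add: x_def commutant_minus adj_minus)
  obtain y where y: "is_abs x y" and cy: "cstar_abs M.alg (E x) = E y" by (rule M.cstar_abs_E[OF x])
  \<comment> \<open>The symmetric difference. Since the two events are nested, the difference of
    their indicators is the indicator of \<open>V k\<close> up to one global sign.\<close>
  define V where "V k = (T k - S k) \<union> (S k - T k)" for k
  define \<epsilon> where "\<epsilon> k = (if S k \<subseteq> T k then 1 else -1 :: complex)" for k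
  have d: "Pr k (T k) - Pr k (S k) = cs (\<epsilon> k) (Pr k (V k))" if k: "k \<in> {1..n}" for k
  proof (cases "S k \<subseteq> T k")
    case True
    hence "V k = T k - S k" by (auto simp: V_def)
    thus ?thesis using True k I Pr_diff[of k "S k" "T k"] by (auto simp: \<epsilon>_def)
  next
    case False
    hence TS: "T k \<subseteq> S k" using ST[OF k] by blast
    hence "V k = S k - T k" by (auto simp: V_def)
    moreover have "Pr k (S k) - Pr k (T k) = Pr k (S k - T k)" using TS k I by (intro Pr_diff) auto
    ultimately have "Pr k (T k) - Pr k (S k) = - Pr k (V k)" by (metis minus_diff_eq)
    thus ?thesis using False by (simp add: \<epsilon>_def cs_uminus_left)
  qed
  have w: "Re (vstate {e} (\<lambda>_. 1) (Pr k (V k))) = \<bar>p k - q\<bar>" if k: "k \<in> {1..n}" for k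
  proof -
    have kI: "k \<in> I" using k I by blast
    have V3: "V k \<subseteq> {..<3}" using S[OF k] T[OF k] by (auto simp: V_def)
    have fin: "finite (S k)" "finite (T k)" using S[OF k] T[OF k] finite_subset by blast+
    have "(\<Sum>s\<in>V k. (U k 0 s)\<^sup>2) = \<bar>p k - q\<bar>"
    proof (cases "S k \<subseteq> T k")
      case True
      hence "V k = T k - S k" by (auto simp: V_def)
      hence "(\<Sum>s\<in>V k. (U k 0 s)\<^sup>2) = q - p k"
        using sum_diff[OF fin(2) True, of "\<lambda>s. (U k 0 s)\<^sup>2"] p[OF k] q[OF k] by simp
      moreover have "0 \<le> (\<Sum>s\<in>V k. (U k 0 s)\<^sup>2)" by (simp add: sum_nonneg)
      ultimately show ?thesis by simp
    next
      case False
      hence TS: "T k \<subseteq> S k" using ST[OF k] by blast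
      hence "V k = S k - T k" by (auto simp: V_def)
      hence "(\<Sum>s\<in>V k. (U k 0 s)\<^sup>2) = p k - q"
        using sum_diff[OF fin(1) TS, of "\<lambda>s. (U k 0 s)\<^sup>2"] p[OF k] q[OF k] by simp
      moreover have "0 \<le> (\<Sum>s\<in>V k. (U k 0 s)\<^sup>2)" by (simp add: sum_nonneg)
      ultimately show ?thesis by simp
    qed
    thus ?thesis by (simp add: vacuum_Pr[OF kI V3])
  qed
  have "cmod (vstate {e} (\<lambda>_. 1) y) \<le> (\<Sum>k\<in>{1..n}. Re (vstate {e} (\<lambda>_. 1) (Pr k (V k))))"
  proof (rule trace_abs_bound[where R = RR and \<epsilon> = \<epsilon> and x = x])
    show "vstate {e} (\<lambda>_. 1) (X * Y) = vstate {e} (\<lambda>_. 1) (Y * X)" if "X \<in> commutant RR" "Y \<in> commutant RR" for X Y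
      using that by (rule vacuum_trace)
    fix k assume "k \<in> {1..n}"
    hence "k \<in> I" using I by blast
    thus "Pr k (V k) \<in> commutant RR" "adj (Pr k (V k)) = Pr k (V k)" "Pr k (V k) * Pr k (V k) = Pr k (V k)"
      by (simp_all add: Pr_commutant adj_Pr Pr_times)
    show "cmod (\<epsilon> k) \<le> 1" by (simp add: \<epsilon>_def)
  next
    show "x = (\<Sum>k\<in>{1..n}. cs (\<epsilon> k) (Pr k (V k)))"
      unfolding x_def sum_subtractf[symmetric] by (intro sum.cong refl d)
  qed (use x y in simp_all)
  also have "\<dots> = (\<Sum>k=1..n. \<bar>p k - q\<bar>)" by (intro sum.cong refl w)
  finally have le: "Re (M.\<tau> (cstar_abs M.alg (E ?B \<ominus>\<^bsub>M.alg\<^esub> E ?A))) \<le> (\<Sum>k=1..n. \<bar>p k - q\<bar>)"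
    using complex_Re_le_cmod[of "vstate {e} (\<lambda>_. 1) y"] AB cy by (simp add: M.alg_minus x_def)
  have "nc_wasserstein TYPE('u) \<gamma>\<^sub>1 \<gamma>\<^sub>2 \<le> ereal (Re (M.\<tau> (cstar_abs M.alg (E ?B \<ominus>\<^bsub>M.alg\<^esub> E ?A))))"
    unfolding nc_wasserstein_def
    by (rule Inf_lower) (use M.tracial_nc_prob_space_axioms \<gamma>1 \<gamma>2 in blast)
  also have "\<dots> \<le> ereal (\<Sum>k=1..n. \<bar>p k - q\<bar>)" using le by simp
  finally show ?thesis .
qed

end

text \<open>Generically the atoms have masses \<open>p\<close>, \<open>q - p\<close> and
  \<open>1 - q\<close>. Whenever one of these vanishes, the available mass is redistributed so that
  all three atoms stay positive; thirds serve when both laws are Dirac.\<close>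

lemma coupling_weights_le:
  fixes p q :: real
  assumes "0 \<le> p" and "p \<le> q" and "q \<le> 1"
  shows "\<exists>w S T. (\<forall>s<3::nat. 0 < w s) \<and> (\<Sum>s<3. w s) = 1 \<and> S \<subseteq> {..<3} \<and> T \<subseteq> {..<3} \<and> S \<subseteq> T \<and>
    (\<Sum>s\<in>S. w s) = p \<and> (\<Sum>s\<in>T. w s) = q"
proof -
  have three: "{..<3} = {0, 1, 2::nat}" by auto
  have all3: "(\<forall>s<3. P s) \<longleftrightarrow> P 0 \<and> P 1 \<and> P (2::nat)" for P
    by (auto simp: numeral_3_eq_3 numeral_2_eq_2 less_Suc_eq)
  have ex: ?thesis if "S \<subseteq> {0, 1, 2}" "T \<subseteq> {0, 1, 2}" "S \<subseteq> T" "0 < a" "0 < b" "0 < c" "a + b + c = 1"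
    "(\<Sum>s\<in>S. if s = 0 then a else if s = 1 then b else c) = p"
    "(\<Sum>s\<in>T. if s = 0 then a else if s = 1 then b else c) = q" for S T :: "nat set" and a b c
    using that by (intro exI[of _ "\<lambda>s. if s = 0 then a else if s = 1 then b else c"] exI[of _ S] exI[of _ T])
      (simp add: three all3)
  consider "0 < p" "p < q" "q < 1" | "p = 0" "q = 1" | "p = 0" "q = 0" | "p = 1" "q = 1"
    | "p = 0" "0 < q" "q < 1" | "0 < p" "p < 1" "q = p" | "0 < p" "p < 1" "q = 1"
    using assms by linarith
  thus ?thesis
  proof cases
    case 1 thus ?thesis by (intro ex[of "{0}" "{0, 1}" p "q - p" "1 - q"]) auto
  next
    case 2 thus ?thesis by (intro ex[of "{}" "{0, 1, 2}" "1/3" "1/3" "1/3"]) auto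
  next
    case 3 thus ?thesis by (intro ex[of "{}" "{}" "1/3" "1/3" "1/3"]) auto
  next
    case 4 thus ?thesis by (intro ex[of "{0, 1, 2}" "{0, 1, 2}" "1/3" "1/3" "1/3"]) auto
  next
    case 5 thus ?thesis by (intro ex[of "{}" "{0, 1}" "q/2" "q/2" "1 - q"]) auto
  next
    case 6 thus ?thesis by (intro ex[of "{0, 1}" "{0, 1}" "p/2" "p/2" "1 - p"]) auto
  next
    case 7 thus ?thesis by (intro ex[of "{0, 1}" "{0, 1, 2}" "p/2" "p/2" "1 - p"]) auto
  qed
qed

text \<open>Three points of positive mass suffice to couple two Bernoulli laws monotonically; positivity
  makes the vacuum cyclic.\<close>

lemma coupling_orthogonal3:
  fixes p q :: real
  assumes "p \<in> {0..1}" and "q \<in> {0..1}"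
  shows "\<exists>V S T. orthogonal3 V \<and> (\<forall>s<3. V 0 s \<noteq> 0) \<and> S \<subseteq> {..<3} \<and> T \<subseteq> {..<3} \<and> (S \<subseteq> T \<or> T \<subseteq> S) \<and>
    (\<Sum>s\<in>S. (V 0 s)\<^sup>2) = p \<and> (\<Sum>s\<in>T. (V 0 s)\<^sup>2) = q"
proof -
  have "\<exists>w S T. (\<forall>s<3::nat. 0 < w s) \<and> (\<Sum>s<3. w s) = 1 \<and> S \<subseteq> {..<3} \<and> T \<subseteq> {..<3} \<and> (S \<subseteq> T \<or> T \<subseteq> S) \<and>
    (\<Sum>s\<in>S. w s) = p \<and> (\<Sum>s\<in>T. w s) = q"
  proof (cases "p \<le> q")
    case True
    with assms show ?thesis using coupling_weights_le[of p q] by (metis atLeastAtMost_iff)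
  next
    case False
    with assms show ?thesis using coupling_weights_le[of q p] by (metis atLeastAtMost_iff nle_le)
  qed
  then obtain w S T where w: "\<And>s. s < (3::nat) \<Longrightarrow> 0 < w s" "(\<Sum>s<3. w s) = 1"
    and ST: "S \<subseteq> {..<3}" "T \<subseteq> {..<3}" "S \<subseteq> T \<or> T \<subseteq> S" "(\<Sum>s\<in>S. w s) = p" "(\<Sum>s\<in>T. w s) = q" by auto
  obtain V where V: "orthogonal3 V" "\<And>s. s < 3 \<Longrightarrow> V 0 s = sqrt (w s)" using orthogonal3_exists[OF w] by blast
  have sq: "(\<Sum>s\<in>Z. (V 0 s)\<^sup>2) = (\<Sum>s\<in>Z. w s)" if "Z \<subseteq> {..<3}" for Z
    using that w(1) V(2) by (intro sum.cong refl) (auto simp: subset_eq less_imp_le)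
  have "\<forall>s<3. V 0 s \<noteq> 0" using V(2) w(1) by (metis less_irrefl real_sqrt_eq_zero_cancel_iff)
  thus ?thesis using V(1) ST
    by (intro exI[of _ V] exI[of _ S] exI[of _ T]) (simp add: sq)
qed

lemma rot_commute:
  assumes "orthogonal3 U"
  shows "(\<Sum>l<3. rot U f i l * rot U g l j) = (\<Sum>l<3. rot U g i l * rot U f l j)"
  unfolding rot_times[OF assms] by (simp only: mult.commute)

section \<open>The free product\<close>

type_synonym fword = "(nat \<times> nat) list"

text \<open>The orthonormal basis of the free product Hilbert space: a letter \<open>(k, i)\<close>
  is the non-vacuum basis vector \<open>i\<close> of factor \<open>k\<close>, neighbours belong to
  different factors, and the empty word is the vacuum.\<close>

definition fwords :: "fword set" where
  "fwords = {w. (\<forall>x\<in>set w. snd x \<in> {1, 2}) \<and> successively (\<lambda>x y. fst x \<noteq> fst y) w}"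

fun fhead :: "nat \<Rightarrow> fword \<Rightarrow> nat" where
  "fhead k [] = 0"
| "fhead k (x # w) = (if fst x = k then snd x else 0)"

fun ftail :: "nat \<Rightarrow> fword \<Rightarrow> fword" where
  "ftail k [] = []"
| "ftail k (x # w) = (if fst x = k then w else x # w)"

definition fcons :: "nat \<Rightarrow> nat \<Rightarrow> fword \<Rightarrow> fword" where
  "fcons k i w = (if i = 0 then w else (k, i) # w)"

lemma fwords_Nil [simp]: "[] \<in> fwords"
  by (simp add: fwords_def)

lemma fwords_Cons: "x # w \<in> fwords \<longleftrightarrow> snd x \<in> {1, 2} \<and> w \<in> fwords \<and> (w \<noteq> [] \<longrightarrow> fst x \<noteq> fst (hd w))"
  by (auto simp: fwords_def successively_Cons)

lemma fwords_append: "u @ w \<in> fwords \<longleftrightarrow>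
    u \<in> fwords \<and> w \<in> fwords \<and> (u \<noteq> [] \<and> w \<noteq> [] \<longrightarrow> fst (last u) \<noteq> fst (hd w))"
  by (auto simp: fwords_def successively_append_iff)

lemma fwords_rev [simp]: "rev w \<in> fwords \<longleftrightarrow> w \<in> fwords"
  by (simp add: fwords_def successively_rev) (metis (mono_tags, lifting) successively_cong)

lemma fhead_less: "w \<in> fwords \<Longrightarrow> fhead k w < 3"
  by (cases w) (auto simp: fwords_Cons)

lemma ftail_fwords: "w \<in> fwords \<Longrightarrow> ftail k w \<in> fwords"
  by (cases w) (auto simp: fwords_Cons)

lemma fhead_ftail: "w \<in> fwords \<Longrightarrow> fhead k (ftail k w) = 0"
proof (cases w)
  case (Cons x t)
  assume "w \<in> fwords"
  thus ?thesis using Cons by (cases t) (auto simp: fwords_Cons)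
qed simp

lemma fcons_fhead_ftail: "w \<in> fwords \<Longrightarrow> fcons k (fhead k w) (ftail k w) = w"
  by (cases w) (auto simp: fwords_Cons fcons_def prod_eq_iff)

lemma fhead_eq_0: "w \<in> fwords \<Longrightarrow> fhead k w = 0 \<longleftrightarrow> (w \<noteq> [] \<longrightarrow> fst (hd w) \<noteq> k)"
  by (cases w) (auto simp: fwords_Cons)

lemma ftail_eq: "fhead k w = 0 \<Longrightarrow> w \<in> fwords \<Longrightarrow> ftail k w = w"
  by (cases w) (auto simp: fwords_Cons)

lemma fcons_props:
  assumes "w \<in> fwords" and "fhead k w = 0" and "i < 3"
  shows "fcons k i w \<in> fwords" "fhead k (fcons k i w) = i" "ftail k (fcons k i w) = w"
proof -
  have "i = 0 \<or> i = 1 \<or> i = 2" using assms(3) by auto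
  thus "fcons k i w \<in> fwords" using assms fhead_eq_0[OF assms(1), of k] by (auto simp: fcons_def fwords_Cons)
  show "fhead k (fcons k i w) = i" "ftail k (fcons k i w) = w"
    using assms ftail_eq[OF assms(2,1)] by (auto simp: fcons_def)
qed

text \<open>The right action is the left action conjugated by word reversal.\<close>

definition frhead :: "nat \<Rightarrow> fword \<Rightarrow> nat" where "frhead k w = fhead k (rev w)"

definition frtail :: "nat \<Rightarrow> fword \<Rightarrow> fword" where "frtail k w = rev (ftail k (rev w))"

interpretation FL: syllables fwords UNIV fhead ftail
proof
  show "v = w" if "v \<in> fwords" "w \<in> fwords" "fhead k v = fhead k w" "ftail k v = ftail k w" for k v w
    using that fcons_fhead_ftail by metis
  show "\<exists>v\<in>fwords. fhead k v = i \<and> ftail k v = ftail k w" if "w \<in> fwords" "i < 3" for k w i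
    using fcons_props[OF ftail_fwords[OF that(1)] fhead_ftail[OF that(1)] that(2)]
    by (intro bexI[of _ "fcons k i (ftail k w)"]) auto
qed (rule fhead_less)

interpretation FR: syllables fwords UNIV frhead frtail
proof
  show "v = w" if "v \<in> fwords" "w \<in> fwords" "frhead k v = frhead k w" "frtail k v = frtail k w" for k v w
    using FL.head_tail_inj[of k "rev v" "rev w"] that by (simp add: frhead_def frtail_def)
  show "\<exists>v\<in>fwords. frhead k v = i \<and> frtail k v = frtail k w" if wi: "w \<in> fwords" "i < 3" for k w i
  proof -
    obtain v where "v \<in> fwords" "fhead k v = i" "ftail k v = ftail k (rev w)"
      using FL.head_tail_surj[of k "rev w" i] wi by auto
    thus ?thesis by (intro bexI[of _ "rev v"]) (auto simp: frhead_def frtail_def)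
  qed
qed (simp add: frhead_def fhead_less)

lemma FL_subst_head: "w \<in> fwords \<Longrightarrow> i < 3 \<Longrightarrow> FL.subst_head k i w = fcons k i (ftail k w)"
  by (rule FL.subst_head_eqI) (simp_all add: fcons_props ftail_fwords fhead_ftail)

lemma FR_subst_head:
  assumes "w \<in> fwords" and "frhead k w = 0" and "0 < i" and "i < 3"
  shows "FR.subst_head k i w = w @ [(k, i)]"
proof -
  have r: "rev w \<in> fwords" "fhead k (rev w) = 0" using assms by (simp_all add: frhead_def)
  have c: "(k, i) # rev w \<in> fwords"
    using fcons_props(1)[OF r assms(4)] assms(3) by (simp add: fcons_def)
  hence "rev ((k, i) # rev w) \<in> fwords" by (simp only: fwords_rev)
  hence "w @ [(k, i)] \<in> fwords" by simp
  thus ?thesis using assms(1) ftail_eq[OF r(2,1)]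
    by (intro FR.subst_head_eqI) (simp_all add: frhead_def frtail_def)
qed

lemma fhead_append: "u \<noteq> [] \<Longrightarrow> fhead k (u @ w) = fhead k u"
  by (cases u) auto

lemma ftail_append: "u \<noteq> [] \<Longrightarrow> ftail k (u @ w) = ftail k u @ w"
  by (cases u) auto

text \<open>Left and right actions interact only on words of length at most one.\<close>

lemma frhead_fcons: "k \<noteq> l \<or> s \<noteq> [] \<Longrightarrow> frhead l (fcons k i s) = frhead l s"
  by (cases "s = []") (auto simp: frhead_def fcons_def fhead_append)

lemma frtail_fcons: "k \<noteq> l \<or> s \<noteq> [] \<Longrightarrow> frtail l (fcons k i s) = fcons k i (frtail l s)"
  by (cases "s = []") (auto simp: frtail_def fcons_def ftail_append)

lemma frtail_prefix: "\<exists>u. s = frtail l s @ u"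
proof (cases "rev s")
  case (Cons x w)
  hence "s = rev w @ [x]" by (metis rev_rev_ident rev.simps(2))
  thus ?thesis by (auto simp: frtail_def)
qed (auto simp: frtail_def)

lemma frtail_fwords: "s \<in> fwords \<Longrightarrow> frtail l s \<in> fwords"
  by (simp add: frtail_def ftail_fwords)

lemma fhead_frtail: "s \<in> fwords \<Longrightarrow> fhead k s = 0 \<Longrightarrow> fhead k (frtail l s) = 0"
proof -
  assume s: "s \<in> fwords" "fhead k s = 0"
  obtain u where u: "s = frtail l s @ u" using frtail_prefix by blast
  show ?thesis
  proof (cases "frtail l s = []")
    case False
    thus ?thesis using fhead_append[OF False, of k u] u s(2) by simp
  qed simp
qed

lemma frtail_nonempty:
  assumes "s \<in> fwords" and "fhead k s = 0" and "s \<noteq> []"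
  shows "frtail k s \<noteq> []"
proof
  assume "frtail k s = []"
  with fcons_fhead_ftail[of "rev s" k] assms(1) have "fcons k (fhead k (rev s)) [] = rev s"
    by (simp add: frtail_def)
  hence "s = [(k, fhead k (rev s))]" using assms(3) by (auto simp: fcons_def split: if_splits)
  hence "fst (hd s) = k" by (metis fst_conv list.sel(1))
  thus False using fhead_eq_0[OF assms(1), of k] assms(2,3) by simp
qed

text \<open>As long as the first letter is out of reach of the right action, that action is the
  identity on it, so the entry reduces to one between the remaining words.\<close>

lemma FR_Lam_fcons:
  assumes st: "s \<in> fwords" "t \<in> fwords" "fhead k s = 0" "fhead k t = 0" and ij: "i < 3" "j < 3"
    and c: "k \<noteq> l \<or> (s \<noteq> [] \<and> t \<noteq> [])"
  shows "ent (FR.Lam l y) (fcons k i s) (fcons k j t) = (if i = j then ent (FR.Lam l y) s t else 0)"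
proof -
  have cs: "k \<noteq> l \<or> s \<noteq> []" and ct: "k \<noteq> l \<or> t \<noteq> []" using c by auto
  have "fcons k i (frtail l s) = fcons k j (frtail l t) \<longleftrightarrow> i = j \<and> frtail l s = frtail l t"
    using fcons_props(2,3)[OF frtail_fwords[OF st(1)] fhead_frtail[OF st(1,3)] ij(1)]
      fcons_props(2,3)[OF frtail_fwords[OF st(2)] fhead_frtail[OF st(2,4)] ij(2)] by metis
  thus ?thesis using st ij
    by (simp add: FR.ent_Lam frhead_fcons[OF cs] frhead_fcons[OF ct] frtail_fcons[OF cs] frtail_fcons[OF ct] fcons_props)
qed

text \<open>Both actions touch the same letter only if \<open>k = l\<close> and nothing remains
  after splitting off the head; there the two products of \<open>x\<close> and \<open>y\<close>
  agree by assumption. If exactly one remainder is empty, the right tails differ and all entries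
  vanish; in every other case the actions do not overlap.\<close>

lemma free_left_right_commute:
  assumes xy: "k = l \<Longrightarrow> (\<And>a b. (\<Sum>i<3. x a i * y i b) = (\<Sum>i<3. y a i * x i b))"
  shows "FL.Lam k x * FR.Lam l y = FR.Lam l y * FL.Lam k x"
proof (rule bmat_eqI)
  fix v z
  show "ent (FL.Lam k x * FR.Lam l y) v z = ent (FR.Lam l y * FL.Lam k x) v z"
  proof (cases "v \<in> fwords \<and> z \<in> fwords")
    case False
    thus ?thesis
      by (auto simp: FL.ent_Lam_times FL.ent_times_Lam FR.ent_times_Lam FR.ent_Lam_times FL.ent_Lam FR.ent_Lam)
  next
    case True
    hence vz: "v \<in> fwords" "z \<in> fwords" by auto
    define a s where "a = fhead k v" and "s = ftail k v"
    define b t where "b = fhead k z" and "t = ftail k z"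
    have st: "s \<in> fwords" "t \<in> fwords" "fhead k s = 0" "fhead k t = 0"
      using vz by (simp_all add: s_def t_def ftail_fwords fhead_ftail)
    have ab: "a < 3" "b < 3" using vz fhead_less by (auto simp: a_def b_def)
    have v: "v = fcons k a s" and z: "z = fcons k b t"
      using vz fcons_fhead_ftail by (simp_all add: a_def b_def s_def t_def)
    have l: "ent (FL.Lam k x * FR.Lam l y) v z
        = (\<Sum>i<3. complex_of_real (x a i) * ent (FR.Lam l y) (fcons k i s) (fcons k b t))"
      using vz by (simp add: FL.ent_Lam_times FL_subst_head a_def[symmetric] s_def[symmetric] z[symmetric])
    have r: "ent (FR.Lam l y * FL.Lam k x) v z
        = (\<Sum>i<3. ent (FR.Lam l y) (fcons k a s) (fcons k i t) * complex_of_real (x i b))"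
      using vz by (simp add: FL.ent_times_Lam FL_subst_head b_def[symmetric] t_def[symmetric] v[symmetric])
    consider (generic) "k \<noteq> l \<or> (s \<noteq> [] \<and> t \<noteq> [])" | (both) "k = l" "s = []" "t = []"
      | (left) "k = l" "s = []" "t \<noteq> []" | (right) "k = l" "s \<noteq> []" "t = []" by blast
    thus ?thesis
    proof cases
      case generic
      have "ent (FL.Lam k x * FR.Lam l y) v z
          = (\<Sum>i<3. if i = b then complex_of_real (x a i) * ent (FR.Lam l y) s t else 0)"
        unfolding l by (intro sum.cong refl) (simp add: FR_Lam_fcons[OF st _ ab(2) generic])
      moreover have "ent (FR.Lam l y * FL.Lam k x) v z
          = (\<Sum>i<3. if a = i then ent (FR.Lam l y) s t * complex_of_real (x i b) else 0)"
        unfolding r by (intro sum.cong refl) (simp add: FR_Lam_fcons[OF st ab(1) _ generic])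
      ultimately show ?thesis using ab by simp
    next
      case both
      have e: "ent (FR.Lam l y) (fcons k i []) (fcons k j []) = complex_of_real (y i j)" if "i < 3" "j < 3" for i j
        using fcons_props(1)[of "[]" k i] fcons_props(1)[of "[]" k j] that both(1)
        by (auto simp: FR.ent_Lam frhead_def frtail_def fcons_def)
      have "ent (FL.Lam k x * FR.Lam l y) v z = (\<Sum>i<3. complex_of_real (x a i * y i b))"
        unfolding l both(2,3) using e ab by (intro sum.cong refl) simp
      also have "\<dots> = (\<Sum>i<3. complex_of_real (y a i * x i b))"
        using xy[OF both(1), of a b] by (simp only: of_real_sum[symmetric])
      also have "\<dots> = ent (FR.Lam l y * FL.Lam k x) v z"
        unfolding r both(2,3) using e ab by (intro sum.cong refl) simp
      finally show ?thesis .
    next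
      case left
      have ne: "frtail l t \<noteq> []" using frtail_nonempty[OF st(2,4) left(3)] left(1) by simp
      have A: "frtail l (fcons k i s) = []" for i using left by (simp add: fcons_def frtail_def)
      have B: "frtail l (fcons k i t) \<noteq> []" for i using left ne frtail_fcons[of k l t i] by (simp add: fcons_def)
      have "ent (FR.Lam l y) (fcons k i s) (fcons k j t) = 0" for i j using A[of i] B[of j] by (simp add: FR.ent_Lam eq_commute[of "[]"])
      thus ?thesis unfolding l r by simp
    next
      case right
      have ne: "frtail l s \<noteq> []" using frtail_nonempty[OF st(1,3) right(2)] right(1) by simp
      have A: "frtail l (fcons k i t) = []" for i using right by (simp add: fcons_def frtail_def)
      have B: "frtail l (fcons k i s) \<noteq> []" for i using right ne frtail_fcons[of k l s i] by (simp add: fcons_def)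
      have "ent (FR.Lam l y) (fcons k i s) (fcons k j t) = 0" for i j using A[of j] B[of i] by (simp add: FR.ent_Lam)
      thus ?thesis unfolding l r by simp
    qed
  qed
qed

text \<open>The maximal prefix with letters from \<open>K\<close> carries the free product of the
  factors in \<open>K\<close>; splitting it off expresses associativity of the free product.\<close>

definition fpre :: "nat set \<Rightarrow> fword \<Rightarrow> fword" where "fpre K = takeWhile (\<lambda>x. fst x \<in> K)"

definition fpost :: "nat set \<Rightarrow> fword \<Rightarrow> fword" where "fpost K = dropWhile (\<lambda>x. fst x \<in> K)"

lemma fpre_fpost: "fpre K w @ fpost K w = w"
  by (simp add: fpre_def fpost_def)

lemma fpre_fpost_append:
  assumes "\<forall>x\<in>set u. fst x \<in> K" and "w \<noteq> [] \<Longrightarrow> fst (hd w) \<notin> K"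
  shows "fpre K (u @ w) = u" "fpost K (u @ w) = w"
proof -
  have "takeWhile (\<lambda>x. fst x \<in> K) w = []" "dropWhile (\<lambda>x. fst x \<in> K) w = w"
    using assms(2) by (cases w; auto)+
  thus "fpre K (u @ w) = u" "fpost K (u @ w) = w"
    using assms(1) by (simp_all add: fpre_def fpost_def)
qed

lemma set_fpre: "x \<in> set (fpre K w) \<Longrightarrow> fst x \<in> K"
  by (auto simp: fpre_def dest: set_takeWhileD)

lemma hd_fpost: "fpost K w \<noteq> [] \<Longrightarrow> fst (hd (fpost K w)) \<notin> K"
  unfolding fpost_def by (rule hd_dropWhile)

lemma ftail_fpre_fpost:
  assumes "k \<in> K"
  shows "fpre K (ftail k w) = ftail k (fpre K w)" "fpost K (ftail k w) = fpost K w"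
proof -
  have eq: "ftail k w = ftail k (fpre K w) @ fpost K w"
    using assms by (cases w) (auto simp: fpre_def fpost_def)
  have "\<forall>x\<in>set (ftail k (fpre K w)). fst x \<in> K"
    using set_fpre[of _ K w] by (cases "fpre K w") auto
  thus "fpre K (ftail k w) = ftail k (fpre K w)" "fpost K (ftail k w) = fpost K w"
    unfolding eq by (simp_all add: fpre_fpost_append hd_fpost)
qed

text \<open>The last letter of the column word is moved to the end of the row word first, so the
  suffix \<open>s\<close> arrives reversed. This is why reversal takes the place of
  \<open>rv\<close> in the free case.\<close>

lemma free_transfer:
  fixes h :: "fword \<Rightarrow> fword \<Rightarrow> complex"
  assumes h: "\<And>k i v z. i < 3 \<Longrightarrow> v \<in> fwords \<Longrightarrow> z \<in> fwords \<Longrightarrow> frhead k v = 0 \<Longrightarrow> frhead k z = 0 \<Longrightarrow>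
        h v (FR.subst_head k i z) = h (FR.subst_head k i v) z"
  shows "u @ s \<in> fwords \<Longrightarrow> h (rev s) u = h [] (u @ s)"
proof (induction s arbitrary: u)
  case (Cons x s)
  obtain k i where x: "x = (k, i)" by (cases x)
  have i: "0 < i" "i < 3" and xs: "x # s \<in> fwords" and ux: "u @ [x] \<in> fwords"
    using Cons.prems fwords_append[of "u @ [x]" s] by (auto simp: fwords_append fwords_Cons x)
  have s: "s \<in> fwords" "frhead k (rev s) = 0"
    using xs by (auto simp: fwords_Cons x frhead_def fhead_eq_0)
  have u: "u \<in> fwords" "frhead k u = 0"
    using ux by (auto simp: fwords_append x frhead_def fhead_eq_0 hd_rev)
  have "h (rev s) (u @ [x]) = h [] (u @ x # s)" using Cons.IH[of "u @ [x]"] Cons.prems by simp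
  moreover have "h (rev s) (FR.subst_head k i u) = h (FR.subst_head k i (rev s)) u"
    using s u i by (intro h) simp_all
  ultimately show ?case using s u i by (simp add: FR_subst_head x)
qed simp

lemma free_word_space:
  assumes "\<And>k. orthogonal3 (U k)" and "\<And>k s. s < 3 \<Longrightarrow> U k 0 s \<noteq> 0"
  shows "word_space fwords UNIV fhead ftail frhead frtail [] U rev fpre fpost"
proof
  show "FL.Lam k (rot (U k) f) * FR.Lam l (rot (U l) g) = FR.Lam l (rot (U l) g) * FL.Lam k (rot (U k) f)" for k l f g
    by (rule free_left_right_commute) (hypsubst, rule rot_commute[OF assms(1)])
  show "h [] w = h (rev w) []"
    if "\<And>k i v z. k \<in> UNIV \<Longrightarrow> i < 3 \<Longrightarrow> v \<in> fwords \<Longrightarrow> z \<in> fwords \<Longrightarrow> frhead k v = 0 \<Longrightarrow> frhead k z = 0 \<Longrightarrow>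
        h v (FR.subst_head k i z) = h (FR.subst_head k i v) z" "w \<in> fwords" for h :: "fword \<Rightarrow> fword \<Rightarrow> complex" and w
    using free_transfer[of h "[]" w] that by simp
  show "fpre K w \<in> fwords" if "w \<in> fwords" for K w
    using that fpre_fpost[of K w] fwords_append by metis
  show "fpost K (fpre K w) = []" "fpre K (fpre K w) = fpre K w" for K w
    using fpre_fpost_append[of "fpre K w" K "[]"] set_fpre by auto
  show "v = w" if "fpre K v = fpre K w" "fpost K v = fpost K w" for K v w
    using that fpre_fpost by metis
  show "\<exists>w\<in>fwords. fpre K w = u \<and> fpost K w = fpost K z" if u: "u \<in> fwords" "fpost K u = []" and z: "z \<in> fwords" for u K z
  proof (rule bexI[of _ "u @ fpost K z"])
    have uK: "\<forall>x\<in>set u. fst x \<in> K" using u(2) by (auto simp: fpost_def)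
    show "fpre K (u @ fpost K z) = u \<and> fpost K (u @ fpost K z) = fpost K z"
      using fpre_fpost_append[OF uK hd_fpost] by blast
    have "fpost K z \<in> fwords" using z fpre_fpost[of K z] fwords_append by metis
    moreover have "fst (last u) \<in> K" if "u \<noteq> []" using uK last_in_set[OF that] by blast
    ultimately show "u @ fpost K z \<in> fwords" using u(1) hd_fpost[of K z] by (auto simp: fwords_append)
  qed
  show "fhead k (fpre K w) = fhead k w" if "k \<in> K" for k K w
    using that by (cases w) (auto simp: fpre_def)
  show "ftail k v = ftail k w \<longleftrightarrow> fpost K v = fpost K w \<and> ftail k (fpre K v) = ftail k (fpre K w)" if "k \<in> K" for k K v w
    using ftail_fpre_fpost[OF that] fpre_fpost by metis
qed (use assms in \<open>auto simp: fpost_def\<close>)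

lemma fpre_disjoint: "K \<inter> K' = {} \<Longrightarrow> fpre K w \<noteq> [] \<Longrightarrow> fpre K' w = []"
  by (cases w) (auto simp: fpre_def split: if_splits)

section \<open>The tensor product\<close>

definition twords :: "nat \<Rightarrow> nat list set" where
  "twords N = {w. length w = N \<and> (\<forall>i<N. w ! i < 3)}"

text \<open>The coordinate is reset to 0 instead of being deleted, so a tail is again a word of the
  same length and no index shifts.\<close>

definition ttail :: "nat \<Rightarrow> nat list \<Rightarrow> nat list" where
  "ttail k w = w[k := 0]"

definition tpre :: "nat set \<Rightarrow> nat list \<Rightarrow> nat list" where
  "tpre K w = map (\<lambda>i. if i \<in> K then w ! i else 0) [0..<length w]"

definition tpost :: "nat set \<Rightarrow> nat list \<Rightarrow> nat list" where
  "tpost K w = map (\<lambda>i. if i \<in> K then 0 else w ! i) [0..<length w]"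

lemma twords_update: "w \<in> twords N \<Longrightarrow> i < 3 \<Longrightarrow> w[k := i] \<in> twords N"
  by (auto simp: twords_def) (metis nth_list_update_eq nth_list_update_neq)

lemma ttail_eq_iff:
  assumes "v \<in> twords N" and "w \<in> twords N" and "k < N"
  shows "ttail k v = ttail k w \<longleftrightarrow> (\<forall>i<N. i \<noteq> k \<longrightarrow> v ! i = w ! i)"
  using assms by (auto simp: ttail_def twords_def list_eq_iff_nth_eq nth_list_update)

lemma twords_eqI:
  "v \<in> twords N \<Longrightarrow> w \<in> twords N \<Longrightarrow> (\<And>i. i < N \<Longrightarrow> v ! i = w ! i) \<Longrightarrow> v = w"
  by (auto simp: twords_def intro: nth_equalityI)

lemma tensor_syllables: "syllables (twords N) {..<N} (\<lambda>k w. w ! k) ttail"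
proof
  show "v = w" if "k \<in> {..<N}" "v \<in> twords N" "w \<in> twords N" "v ! k = w ! k" "ttail k v = ttail k w" for k v w
    using that ttail_eq_iff[of v N w k] by (intro twords_eqI[of v N w]) auto
  show "\<exists>v\<in>twords N. v ! k = i \<and> ttail k v = ttail k w" if "k \<in> {..<N}" "w \<in> twords N" "i < 3" for k w i
    using that by (intro bexI[of _ "w[k := i]"] twords_update) (auto simp: ttail_def twords_def)
qed (auto simp: twords_def)

lemma tensor_subst_head:
  assumes "k < N" and "w \<in> twords N" and "i < 3"
  shows "syllables.subst_head (twords N) (\<lambda>k w. w ! k) ttail k i w = w[k := i]"
  by (rule syllables.subst_head_eqI[OF tensor_syllables])
    (use assms in \<open>auto simp: twords_update ttail_def, auto simp: twords_def\<close>)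

text \<open>The right-hand side is symmetric under exchanging \<open>(k, x)\<close> with
  \<open>(l, y)\<close>, which yields commutation of distinct factors.\<close>

lemma tensor_Lam_times:
  assumes kl: "k < N" "l < N" "k \<noteq> l" and vz: "v \<in> twords N" "z \<in> twords N"
  shows "ent (syllables.Lam (twords N) (\<lambda>k w. w ! k) ttail k x * syllables.Lam (twords N) (\<lambda>k w. w ! k) ttail l y) v z
    = (if \<forall>i<N. i \<noteq> k \<and> i \<noteq> l \<longrightarrow> v ! i = z ! i then complex_of_real (x (v ! k) (z ! k)) * complex_of_real (y (v ! l) (z ! l)) else 0)"
proof -
  interpret T: syllables "twords N" "{..<N}" "\<lambda>k w. w ! k" ttail by (rule tensor_syllables)
  have len: "length v = N" "length z = N" and zk: "z ! k < 3" using vz kl by (auto simp: twords_def)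
  have "ent (T.Lam k x * T.Lam l y) v z = (\<Sum>i<3. complex_of_real (x (v ! k) i) * ent (T.Lam l y) (v[k := i]) z)"
    using kl vz by (simp add: T.ent_Lam_times tensor_subst_head)
  also have "\<dots> = (\<Sum>i<3. if i = z ! k then (if \<forall>i<N. i \<noteq> k \<and> i \<noteq> l \<longrightarrow> v ! i = z ! i
      then complex_of_real (x (v ! k) (z ! k)) * complex_of_real (y (v ! l) (z ! l)) else 0) else 0)"
  proof (intro sum.cong refl)
    fix i :: nat assume i: "i \<in> {..<3}"
    have "ttail l (v[k := i]) = ttail l z \<longleftrightarrow> i = z ! k \<and> (\<forall>i<N. i \<noteq> k \<and> i \<noteq> l \<longrightarrow> v ! i = z ! i)"
      using ttail_eq_iff[OF twords_update[OF vz(1)] vz(2) kl(2), of i k] i kl len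
      by (auto simp: nth_list_update split: if_splits)
    thus "complex_of_real (x (v ! k) i) * ent (T.Lam l y) (v[k := i]) z
        = (if i = z ! k then (if \<forall>i<N. i \<noteq> k \<and> i \<noteq> l \<longrightarrow> v ! i = z ! i
      then complex_of_real (x (v ! k) (z ! k)) * complex_of_real (y (v ! l) (z ! l)) else 0) else 0)"
      using kl vz i len by (auto simp: T.ent_Lam twords_update)
  qed
  also have "\<dots> = (if \<forall>i<N. i \<noteq> k \<and> i \<noteq> l \<longrightarrow> v ! i = z ! i
      then complex_of_real (x (v ! k) (z ! k)) * complex_of_real (y (v ! l) (z ! l)) else 0)"
    using zk by simp
  finally show ?thesis .
qed

lemma tpre_nth: "i < length w \<Longrightarrow> tpre K w ! i = (if i \<in> K then w ! i else 0)"
  by (simp add: tpre_def)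

lemma tpost_nth: "i < length w \<Longrightarrow> tpost K w ! i = (if i \<in> K then 0 else w ! i)"
  by (simp add: tpost_def)

lemma length_tpre_tpost [simp]: "length (tpre K w) = length w" "length (tpost K w) = length w"
  by (simp_all add: tpre_def tpost_def)

lemma tpre_tpost_twords: "w \<in> twords N \<Longrightarrow> tpre K w \<in> twords N" "w \<in> twords N \<Longrightarrow> tpost K w \<in> twords N"
  by (auto simp: twords_def tpre_nth tpost_nth)

text \<open>Coordinates are moved one by one: after \<open>m\<close> moves the row index holds the
  first \<open>m\<close> coordinates of \<open>w\<close> and the column index the others. Order is
  irrelevant here, so no reversal appears.\<close>

lemma tensor_transfer:
  fixes h :: "nat list \<Rightarrow> nat list \<Rightarrow> complex"
  assumes h: "\<And>k i v z. k < N \<Longrightarrow> i < 3 \<Longrightarrow> v \<in> twords N \<Longrightarrow> z \<in> twords N \<Longrightarrow> v ! k = 0 \<Longrightarrow> z ! k = 0 \<Longrightarrow>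
        h v (z[k := i]) = h (v[k := i]) z" and w: "w \<in> twords N"
  shows "h (replicate N 0) w = h w (replicate N 0)"
proof -
  have len: "length w = N" using w by (simp add: twords_def)
  have "m \<le> N \<Longrightarrow> h (tpre {..<m} w) (tpost {..<m} w) = h (replicate N 0) w" for m
  proof (induction m)
    case 0
    have "tpre {..<0} w = replicate N 0" "tpost {..<0} w = w"
      using len by (auto simp: list_eq_iff_nth_eq tpre_nth tpost_nth)
    then show ?case by simp
  next
    case (Suc m)
    have i: "w ! m < 3" using w Suc by (auto simp: twords_def)
    have z: "(tpost {..<Suc m} w)[m := w ! m] = tpost {..<m} w"
      using len Suc.prems by (auto simp: list_eq_iff_nth_eq nth_list_update tpost_nth)
    have v: "(tpre {..<m} w)[m := w ! m] = tpre {..<Suc m} w"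
      using len Suc.prems by (auto simp: list_eq_iff_nth_eq nth_list_update tpre_nth)
    have "h (tpre {..<m} w) ((tpost {..<Suc m} w)[m := w ! m]) = h ((tpre {..<m} w)[m := w ! m]) (tpost {..<Suc m} w)"
      using len Suc.prems i w by (intro h) (auto simp: tpre_tpost_twords tpre_nth tpost_nth)
    thus ?case using Suc unfolding z v by simp
  qed
  from this[of N] have "h (tpre {..<N} w) (tpost {..<N} w) = h (replicate N 0) w" by simp
  moreover have "tpre {..<N} w = w" "tpost {..<N} w = replicate N 0"
    using len by (auto simp: list_eq_iff_nth_eq tpre_nth tpost_nth)
  ultimately show ?thesis by simp
qed

text \<open>The factors are commutative and occupy separate coordinates, so left and right
  multiplication coincide and \<open>rv\<close> is the identity.\<close>

lemma tensor_word_space: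
  assumes U: "\<And>k. orthogonal3 (U k)" "\<And>k s. s < 3 \<Longrightarrow> U k 0 s \<noteq> 0" and N: "N > 0"
  shows "word_space (twords N) {..<N} (\<lambda>k w. w ! k) ttail (\<lambda>k w. w ! k) ttail (replicate N 0) U (\<lambda>w. w) tpre tpost"
proof -
  interpret T: syllables "twords N" "{..<N}" "\<lambda>k w. w ! k" ttail by (rule tensor_syllables)
  show ?thesis
  proof
    show "{..<N} \<noteq> {}" using N by auto
    show "T.Lam k (rot (U k) f) * T.Lam l (rot (U l) g) = T.Lam l (rot (U l) g) * T.Lam k (rot (U k) f)"
      if kl: "k \<in> {..<N}" "l \<in> {..<N}" for k l f g
    proof (cases "k = l")
      case True
      thus ?thesis using kl by (simp add: T.Lam_times rot_commute[OF U(1), of _ f _ g])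
    next
      case False
      show ?thesis
      proof (rule bmat_eqI)
        fix v z
        show "ent (T.Lam k (rot (U k) f) * T.Lam l (rot (U l) g)) v z = ent (T.Lam l (rot (U l) g) * T.Lam k (rot (U k) f)) v z"
        proof (cases "v \<in> twords N \<and> z \<in> twords N")
          case True
          thus ?thesis using kl False tensor_Lam_times[of k N l v z] tensor_Lam_times[of l N k v z]
            by (auto simp: mult.commute)
        next
          case False
          thus ?thesis using kl by (auto simp: T.ent_Lam_times T.ent_times_Lam T.ent_Lam)
        qed
      qed
    qed
    show "h (replicate N 0) w = h w (replicate N 0)"
      if h: "\<And>k i v z. k \<in> {..<N} \<Longrightarrow> i < 3 \<Longrightarrow> v \<in> twords N \<Longrightarrow> z \<in> twords N \<Longrightarrow> v ! k = 0 \<Longrightarrow> z ! k = 0 \<Longrightarrow>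
        h v (T.subst_head k i z) = h (T.subst_head k i v) z" and w: "w \<in> twords N"
      for h :: "nat list \<Rightarrow> nat list \<Rightarrow> complex" and w
    proof (rule tensor_transfer[OF _ w])
      fix k i v z assume "k < N" "i < (3::nat)" "v \<in> twords N" "z \<in> twords N" "v ! k = 0" "z ! k = 0"
      thus "h v (z[k := i]) = h (v[k := i]) z" using h[of k i v z] by (simp add: tensor_subst_head)
    qed
    show "tpost K (tpre K w) = replicate N 0" "tpre K (tpre K w) = tpre K w" if "w \<in> twords N" for K w
      using that by (auto simp: twords_def list_eq_iff_nth_eq tpre_nth tpost_nth)
    show "tpost K (replicate N 0) = replicate N 0" for K
      by (auto simp: list_eq_iff_nth_eq tpost_nth)
    show "v = w" if "v \<in> twords N" "w \<in> twords N" "tpre K v = tpre K w" "tpost K v = tpost K w" for K v w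
    proof (rule twords_eqI[OF that(1,2)])
      fix i assume "i < N"
      thus "v ! i = w ! i"
        using that(1,2) arg_cong[OF that(3), of "\<lambda>u. u ! i"] arg_cong[OF that(4), of "\<lambda>u. u ! i"]
        by (cases "i \<in> K") (auto simp: twords_def tpre_nth tpost_nth)
    qed
    show "\<exists>w\<in>twords N. tpre K w = u \<and> tpost K w = tpost K z"
      if u: "u \<in> twords N" "tpost K u = replicate N 0" and z: "z \<in> twords N" for u K z
    proof (rule bexI[of _ "map (\<lambda>i. if i \<in> K then u ! i else z ! i) [0..<N]"])
      have u0: "u ! i = 0" if "i < N" "i \<notin> K" for i
        using that u(1) arg_cong[OF u(2), of "\<lambda>w. w ! i"] by (simp add: twords_def tpost_nth)
      show "tpre K (map (\<lambda>i. if i \<in> K then u ! i else z ! i) [0..<N]) = u \<and>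
          tpost K (map (\<lambda>i. if i \<in> K then u ! i else z ! i) [0..<N]) = tpost K z"
        using u(1) z u0 by (auto simp: twords_def list_eq_iff_nth_eq tpre_nth tpost_nth)
      show "map (\<lambda>i. if i \<in> K then u ! i else z ! i) [0..<N] \<in> twords N"
        using u(1) z by (auto simp: twords_def)
    qed
    show "tpre K w ! k = w ! k" if "k \<in> {..<N}" "k \<in> K" "w \<in> twords N" for k K w
      using that by (simp add: twords_def tpre_nth)
    show "ttail k v = ttail k w \<longleftrightarrow> tpost K v = tpost K w \<and> ttail k (tpre K v) = ttail k (tpre K w)"
      if k: "k \<in> {..<N}" "k \<in> K" and v: "v \<in> twords N" and w: "w \<in> twords N" for k K v w
    proof -
      have len: "length v = N" "length w = N" using v w by (auto simp: twords_def)
      have "tpost K v = tpost K w \<longleftrightarrow> (\<forall>i<N. i \<notin> K \<longrightarrow> v ! i = w ! i)"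
        using len by (auto simp: list_eq_iff_nth_eq tpost_nth)
      moreover have "ttail k (tpre K v) = ttail k (tpre K w) \<longleftrightarrow> (\<forall>i<N. i \<noteq> k \<longrightarrow> i \<in> K \<longrightarrow> v ! i = w ! i)"
        using len k by (subst ttail_eq_iff[OF tpre_tpost_twords(1)[OF v] tpre_tpost_twords(1)[OF w]])
          (auto simp: tpre_nth)
      ultimately show ?thesis using ttail_eq_iff[OF v w] k by auto
    qed
  qed (use U in \<open>auto simp: twords_def tpre_nth\<close>)
qed

lemma tpost_disjoint:
  assumes "w \<in> twords N" and "K \<inter> K' = {}" and "tpost K w = replicate N 0" and "tpost K' w = replicate N 0"
  shows "w = replicate N 0"
proof (rule nth_equalityI)
  show "length w = length (replicate N 0)" using assms(1) by (simp add: twords_def)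
  fix i assume i: "i < length w"
  have len: "length w = N" using assms(1) by (simp add: twords_def)
  show "w ! i = replicate N 0 ! i"
    using i len assms(2) arg_cong[OF assms(3), of "\<lambda>u. u ! i"] arg_cong[OF assms(4), of "\<lambda>u. u ! i"]
    by (auto simp: tpost_nth split: if_splits)
qed

text \<open>Both sums live in the same space. Independence is demanded for every family
  \<open>V\<close>, since it is used once with the events \<open>S\<close> and once with
  \<open>T\<close>.\<close>

lemma (in word_model) nc_wasserstein_bernoulli_sums:
  fixes S T :: "nat \<Rightarrow> nat set" and p :: "nat \<Rightarrow> real" and indep :: "'u independence"
  assumes I: "{1..n} \<subseteq> I" and n: "1 \<le> n"
    and S: "\<And>k. S k \<subseteq> {..<3}" "\<And>k. (\<Sum>s\<in>S k. (U k 0 s)\<^sup>2) = p k" "\<And>k. p k \<in> {0..1}"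
    and T: "\<And>k. T k \<subseteq> {..<3}" "\<And>k. (\<Sum>s\<in>T k. (U k 0 s)\<^sup>2) = q" "q \<in> {0..1}"
    and ST: "\<And>k. S k \<subseteq> T k \<or> T k \<subseteq> S k"
    and indep: "indep \<in> {tensor_independent, freely_independent}"
    and ind: "\<And>m V. 1 \<le> m \<Longrightarrow> m < n \<Longrightarrow> indep M.alg M.\<tau>
      [generated_algebra M.alg (E (\<Sum>k=1..m. Pr k (V k))), generated_algebra M.alg (E (Pr (Suc m) (V (Suc m))))]"
    and conv: "conv = (\<lambda>\<mu> \<nu>. THE \<eta>. is_convolution indep \<mu> \<nu> \<eta>)"
  shows "nc_wasserstein TYPE('u)
      (iterated_convolution conv (\<lambda>k. bernoulli_measure (p k)) n) (binomial_convolution conv q n)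
    \<le> ereal (\<Sum>k = 1..n. \<bar>p k - q\<bar>)"
  unfolding binomial_convolution_def
proof (rule nc_wasserstein_coupling[OF I])
  show "has_distribution M.alg M.\<tau> (E (\<Sum>k=1..n. Pr k (S k))) (iterated_convolution conv (\<lambda>k. bernoulli_measure (p k)) n)"
    by (rule iterated_convolution_sum_Pr[OF I S indep _ conv n order_refl]) (rule ind)
  show "has_distribution M.alg M.\<tau> (E (\<Sum>k=1..n. Pr k (T k))) (iterated_convolution conv (\<lambda>_. bernoulli_measure q) n)"
    by (rule iterated_convolution_sum_Pr[where p = "\<lambda>_. q", OF I T indep _ conv n order_refl]) (rule ind)
qed (simp_all add: S T ST)

theorem proposition3p1:
  fixes conv :: "real measure \<Rightarrow> real measure \<Rightarrow> real measure"
    and n :: nat and p :: "nat \<Rightarrow> real" and q :: real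
  assumes universe: "(UNIV :: real set) \<lesssim> (UNIV :: 'u set)"
    and conv: "conv \<in> {tensor_convolution TYPE('u), free_convolution TYPE('u)}"
    and n: "n \<ge> 1"
    and p: "\<And>k. k \<in> {1..n} \<Longrightarrow> p k \<in> {0..1}"
    and q: "q = (1 / real n) * (\<Sum>j = 1..n. p j)"
  shows "nc_wasserstein TYPE('u)
      (iterated_convolution conv (\<lambda>k. bernoulli_measure (p k)) n)
      (binomial_convolution conv q n)
    \<le> ereal (\<Sum>k = 1..n. \<bar>p k - q\<bar>)"
proof -
  \<comment> \<open>Outside \<open>{1..n}\<close> the parameter is set to 0, a valid probability, so
    that couplings can be chosen for all indices at once.\<close>
  define p' where "p' k = (if k \<in> {1..n} then p k else 0)" for k
  have p': "p' k \<in> {0..1}" for k using p by (simp add: p'_def)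
  have q01: "q \<in> {0..1}"
  proof -
    have "0 \<le> (\<Sum>j = 1..n. p j)" using p by (intro sum_nonneg) auto
    moreover have "(\<Sum>j = 1..n. p j) \<le> (\<Sum>j = 1..n. 1)" using p by (intro sum_mono) auto
    ultimately show ?thesis using n by (simp add: q divide_le_eq)
  qed
  obtain U S T where U: "\<And>k. orthogonal3 (U k)" "\<And>k s. s < 3 \<Longrightarrow> U k 0 s \<noteq> 0"
    and S: "\<And>k. S k \<subseteq> {..<3}" "\<And>k. (\<Sum>s\<in>S k. (U k 0 s)\<^sup>2) = p' k"
    and T: "\<And>k. T k \<subseteq> {..<3}" "\<And>k. (\<Sum>s\<in>T k. (U k 0 s)\<^sup>2) = q"
    and ST: "\<And>k. S k \<subseteq> T k \<or> T k \<subseteq> S k"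
    using coupling_orthogonal3[OF p' q01] by metis
  have it: "iterated_convolution conv (\<lambda>k. bernoulli_measure (p k)) n
      = iterated_convolution conv (\<lambda>k. bernoulli_measure (p' k)) n"
  proof -
    have "map (\<lambda>k. bernoulli_measure (p k)) [2..<Suc n] = map (\<lambda>k. bernoulli_measure (p' k)) [2..<Suc n]"
      by (intro map_cong refl) (auto simp: p'_def)
    moreover have "p 1 = p' 1" using n by (simp add: p'_def)
    ultimately show ?thesis by (simp only: iterated_convolution_def)
  qed
  have sm: "(\<Sum>k = 1..n. \<bar>p k - q\<bar>) = (\<Sum>k = 1..n. \<bar>p' k - q\<bar>)" by (simp add: p'_def)
  have disj: "{1..m} \<inter> {Suc m} = {}" for m :: nat by auto
  show ?thesis
  proof (cases "conv = free_convolution TYPE('u)")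
    case True
    obtain E :: "fword bmat \<Rightarrow> 'u" where E: "inj E" using bmat_embeds[OF universe] by blast
    interpret F: word_space fwords UNIV fhead ftail frhead frtail "[]" U rev fpre fpost
      by (rule free_word_space[OF U])
    interpret F: word_model fwords UNIV fhead ftail frhead frtail "[]" U rev fpre fpost E
      by unfold_locales (rule E)
    have c: "conv = (\<lambda>\<mu> \<nu>. THE \<eta>. is_convolution (freely_independent :: 'u independence) \<mu> \<nu> \<eta>)"
      unfolding True by (intro ext) (simp add: free_convolution_def)
    show ?thesis unfolding it sm
    proof (rule F.nc_wasserstein_bernoulli_sums[OF _ n S p' T q01 ST _ _ c])
      fix m V
      show "freely_independent F.M.alg F.M.\<tau> [generated_algebra F.M.alg (E (\<Sum>k=1..m. F.Pr k (V k))),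
          generated_algebra F.M.alg (E (F.Pr (Suc m) (V (Suc m))))]"
        by (rule F.freely_independent_Alg[of "{1..m}" "{Suc m}"])
          (auto intro: fpre_disjoint[OF disj] F.Alg_sum F.Pr_Alg)
    qed auto
  next
    case False
    hence tc: "conv = tensor_convolution TYPE('u)" using conv by blast
    \<comment> \<open>Coordinates of a word are counted from 0 and the factors from 1, so the
      coordinates must run up to \<open>n\<close>.\<close>
    define N where "N = Suc n"
    have N: "N > 0" by (simp add: N_def)
    obtain E :: "nat list bmat \<Rightarrow> 'u" where E: "inj E" using bmat_embeds[OF universe] by blast
    interpret T: word_space "twords N" "{..<N}" "\<lambda>k w. w ! k" ttail "\<lambda>k w. w ! k" ttail "replicate N 0" U "\<lambda>w. w" tpre tpost
      by (rule tensor_word_space[OF U N])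
    interpret T: word_model "twords N" "{..<N}" "\<lambda>k w. w ! k" ttail "\<lambda>k w. w ! k" ttail "replicate N 0" U "\<lambda>w. w" tpre tpost E
      by unfold_locales (rule E)
    have c: "conv = (\<lambda>\<mu> \<nu>. THE \<eta>. is_convolution (tensor_independent :: 'u independence) \<mu> \<nu> \<eta>)"
      unfolding tc by (intro ext) (simp add: tensor_convolution_def)
    show ?thesis unfolding it sm
    proof (rule T.nc_wasserstein_bernoulli_sums[OF _ n S p' T q01 ST _ _ c])
      show "{1..n} \<subseteq> {..<N}" by (auto simp: N_def)
      fix m V assume m: "1 \<le> m" "m < n"
      show "tensor_independent T.M.alg T.M.\<tau> [generated_algebra T.M.alg (E (\<Sum>k=1..m. T.Pr k (V k))),
          generated_algebra T.M.alg (E (T.Pr (Suc m) (V (Suc m))))]"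
      proof (rule T.tensor_independent_Alg[of "{1..m}" "{Suc m}"])
        show "w = replicate N 0" if "w \<in> twords N" "tpost {1..m} w = replicate N 0" "tpost {Suc m} w = replicate N 0" for w
          using tpost_disjoint[OF that(1) disj that(2,3)] .
        show "(\<Sum>k=1..m. T.Pr k (V k)) \<in> T.Alg {1..m}"
          using m by (intro T.Alg_sum T.Pr_Alg) (auto simp: N_def)
        show "T.Pr (Suc m) (V (Suc m)) \<in> T.Alg {Suc m}"
          using m by (intro T.Pr_Alg) (auto simp: N_def)
        show "(\<Sum>k=1..m. T.Pr k (V k)) * T.Pr (Suc m) (V (Suc m)) = T.Pr (Suc m) (V (Suc m)) * (\<Sum>k=1..m. T.Pr k (V k))"
          unfolding sum_distrib_left sum_distrib_right
        proof (intro sum.cong refl)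
          fix k assume "k \<in> {1..m}"
          hence "k \<in> {..<N}" "Suc m \<in> {..<N}" using m by (auto simp: N_def)
          thus "T.Pr k (V k) * T.Pr (Suc m) (V (Suc m)) = T.Pr (Suc m) (V (Suc m)) * T.Pr k (V k)"
            unfolding T.Pr_def by (rule T.left_right_commute)
        qed
      qed
    qed auto
  qed
qed

end
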